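(* Let $V$ be an $L^2$-sparse potential, and let $v(\cdot,\lambda)$ be the solution of $-v''+Vv=\lambda v$ on $[0,\infty)$ at real spectral parameter $\lambda$ subject to $v(0,\lambda)=0$, $v'(0,\lambda)=1$. Let $\{(a_k,b_k)\}_{k\ge1}$ be a sequence of (finite) subintervals of $\mathbb{R}^+$ for which $$\lim_{k\to\infty}(b_k-a_k)=\infty\quad\text{and}\quad \lim_{k\to\infty}\int_{a_k}^{b_k}|V(t)|^2\,dt=0 .$$ Then for all Borel subsets $A,S$ of $\mathbb{R}$ with $|A|<\infty$, $$\lim_{k\to\infty}\frac1\pi\int_A\theta\left(m_+^{a_k}(\lambda),S\right)d\lambda=\frac1\pi\int_A\theta\left(i\sqrt\lambda,S\right)d\lambda,$$ $$\lim_{k\to\infty}\left|\left\{\lambda\in A:\frac{v'(b_k,\lambda)}{v(b_k,\lambda)}\in S\right\}\right|=\frac1\pi\int_A\theta\left(i\sqrt\lambda,-S\right)d\lambda .$$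
   Context: $|\cdot|$ applied to sets is Lebesgue measure, and $-S=\{-s:s\in S\}$. $L^2$-sparse: a real-valued function $V$ on $[0,\infty)$, integrable over every finite subinterval, is an $L^2$-sparse potential if for all $\delta,N>0$ there is a subinterval $(a,b)$ of $[0,\infty)$ with $b-a=N$ and $\int_a^b V(x)^2\,dx<\delta$. For such $V$, $-\frac{d^2}{dx^2}+V$ is in the limit-point case at infinity. $m$-functions: for $N\ge0$, $m^N(z)$ denotes the Dirichlet Weyl $m$-function of $-\frac{d^2}{dx^2}+V$ on $L^2(N,\infty)$, that is, $m^N(z)=F'(N,z)/F(N,z)$ for $\operatorname{Im} z>0$, where $F(\cdot,z)$ is any non-trivial solution of $-F''+VF=zF$ that is square integrable at infinity (unique up to scalar multiples). It is a Herglotz function (analytic in the upper half-plane with positive imaginary part), and $m^N_+(\lambda)=\lim_{d\to0^+}m^N(\lambda+id)$ is its boundary value, which exists for almost all $\lambda\in\mathbb{R}$. Angle subtended: for $z$ with $\operatorname{Im} z>0$, $\theta(z,S)=\int_S\frac{\operatorname{Im} z}{|t-z|^2}\,dt$ is the angle subtended at $z$ by $S$; for real $\lambda$, $\theta(\lambda,S)=\pi\chi_S(\lambda)$, with $\chi_S$ the characteristic function of $S$. Square root: $i\sqrt\lambda$ is the boundary value on $\mathbb{R}$ of $i\sqrt z$, where $\sqrt z$ has positive real and imaginary parts for $\operatorname{Im} z>0$; so $i\sqrt\lambda=i|\lambda|^{1/2}$ for $\lambda>0$ and $i\sqrt\lambda=-|\lambda|^{1/2}$ for $\lambda<0$. 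*)

theory Defs
  imports "HOL-Analysis.Analysis"
begin

(* V is a total function on the reals, but only its values on [0, infinity) are used. *)
definition locally_integrable :: "(real \<Rightarrow> real) \<Rightarrow> bool" where
  "locally_integrable V \<longleftrightarrow> (\<forall>R\<ge>0. set_integrable lebesgue {0..R} V)"

(* A locally integrable V need not be locally square integrable, so the integral of V^2 is
   taken in [0, infinity]; a Bochner integral would be 0 where V^2 is not integrable. *)
definition L2_sparse :: "(real \<Rightarrow> real) \<Rightarrow> bool" where
  "L2_sparse V \<longleftrightarrow> locally_integrable V \<and>
     (\<forall>\<delta>>0. \<forall>N>0. \<exists>a b. 0 \<le> a \<and> b - a = N \<and>
        (\<integral>\<^sup>+x\<in>{a<..<b}. ennreal ((V x)\<^sup>2) \<partial>lebesgue) < ennreal \<delta>)"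

(* F solves -F'' + V F = z F on [0, infinity) in the Caratheodory sense, with F' = G: for locally
   integrable V this says that F is C^1, that F' is locally absolutely continuous, and that
   F'' = (V - z) F almost everywhere.  The derivative at 0 is one-sided.  The type of values is
   real for the solution v and complex for the Weyl solutions. *)
definition schroedinger_solution ::
    "(real \<Rightarrow> real) \<Rightarrow> 'a::real_normed_field \<Rightarrow> (real \<Rightarrow> 'a) \<Rightarrow> (real \<Rightarrow> 'a) \<Rightarrow> bool" where
  "schroedinger_solution V z F G \<longleftrightarrow>
     (\<forall>x\<ge>0. (F has_vector_derivative G x) (at x within {0..}) \<and>
            ((\<lambda>t. (of_real (V t) - z) * F t) has_integral (G x - G 0)) {0..x})"

definition weyl_solution ::
    "(real \<Rightarrow> real) \<Rightarrow> complex \<Rightarrow> (real \<Rightarrow> complex) \<Rightarrow> (real \<Rightarrow> complex) \<Rightarrow> bool" where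
  "weyl_solution V z F G \<longleftrightarrow> schroedinger_solution V z F G \<and> (\<exists>x\<ge>0. F x \<noteq> 0) \<and>
     (\<exists>R\<ge>0. set_integrable lebesgue {R..} (\<lambda>x. (cmod (F x))\<^sup>2))"

(* Meaningful for Im z > 0 and N \<ge> 0 in the limit-point case at infinity, where the Weyl
   solution is unique up to a scalar factor, so that the quotient does not depend on it. *)
definition m_function :: "(real \<Rightarrow> real) \<Rightarrow> real \<Rightarrow> complex \<Rightarrow> complex" where
  "m_function V N z = (THE w. \<exists>F G. weyl_solution V z F G \<and> w = G N / F N)"

definition m_plus :: "(real \<Rightarrow> real) \<Rightarrow> real \<Rightarrow> real \<Rightarrow> complex" where
  "m_plus V N l = Lim (at_right 0) (\<lambda>d. m_function V N (Complex l d))"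

(* Only used for Im z \<ge> 0. *)
definition angle_subtended :: "complex \<Rightarrow> real set \<Rightarrow> real" where
  "angle_subtended z S =
     (if Im z = 0 then pi * indicator S (Re z)
      else (LINT t:S|lebesgue. Im z / (cmod (complex_of_real t - z))\<^sup>2))"

definition i_sqrt :: "real \<Rightarrow> complex" where
  "i_sqrt l = \<i> * csqrt (complex_of_real l)"

(* The principal root csqrt is the required branch on the upper half-plane, and i_sqrt is the
   boundary value of i * csqrt, also on the negative axis, where csqrt is discontinuous. *)
lemma csqrt_upper_half_plane:
  assumes "Im z > 0"
  shows "Re (csqrt z) > 0" "Im (csqrt z) > 0"
proof -
  have "\<bar>Re z\<bar>\<^sup>2 < (cmod z)\<^sup>2"
    using assms by (simp add: cmod_power2)
  then have "\<bar>Re z\<bar> < cmod z"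
    by (rule power2_less_imp_less) simp
  then show "Re (csqrt z) > 0" "Im (csqrt z) > 0"
    using assms by (auto simp: abs_less_iff)
qed

lemma i_sqrt_boundary_value:
  "((\<lambda>d. \<i> * csqrt (Complex l d)) \<longlongrightarrow> i_sqrt l) (at_right 0)"
proof -
  let ?w = "\<lambda>d. Complex (sqrt ((cmod (Complex l d) + l) / 2)) (sqrt ((cmod (Complex l d) - l) / 2))"
  have "\<forall>\<^sub>F d in at_right (0::real). ?w d = csqrt (Complex l d)"
    using eventually_at_right_less[of "0::real"]
    by (rule eventually_mono) (simp add: complex_eq_iff)
  moreover have "((\<lambda>d. \<i> * ?w d) \<longlongrightarrow> \<i> * ?w 0) (at_right 0)"
    unfolding complex_norm by (auto intro!: tendsto_eq_intros)
  moreover have "?w 0 = csqrt (complex_of_real l)"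
    by (auto simp: complex_eq_iff complex_norm)
  ultimately show ?thesis
    unfolding i_sqrt_def
    by (auto intro: Lim_transform_eventually elim: eventually_mono)
qed

lemma i_sqrt_pos: "l > 0 \<Longrightarrow> i_sqrt l = \<i> * complex_of_real (sqrt \<bar>l\<bar>)"
  by (simp add: i_sqrt_def complex_eq_iff)

lemma i_sqrt_neg: "l < 0 \<Longrightarrow> i_sqrt l = - complex_of_real (sqrt \<bar>l\<bar>)"
  by (simp add: i_sqrt_def complex_eq_iff)

end

theory Submission
  imports Defs "HOL-Complex_Analysis.Complex_Analysis" "HOL-Probability.Probability"
begin

text \<open>For \<open>Im z > 0\<close> a solution \<open>F\<close> with \<open>Im (F' cnj F) \<ge> 0\<close> at the right end of an interval of length
  \<open>L\<close> has \<open>F' / F\<close> close to \<open>\<i> \<surd>z\<close> at the left end when \<open>L\<close> is large and \<open>\<integral> V\<^sup>2\<close> is small: integrate the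
  equation against a cut-off free solution, and control \<open>\<integral> \<bar>F\<bar>\<^sup>2\<close> by the current \<open>Im (F' cnj F)\<close>. Applied to
  Weyl solutions on \<open>(a\<^sub>k, b\<^sub>k)\<close>, and after reflection to \<open>v\<close>, this shows that the Herglotz functions
  \<open>m\<^bsup>a\<^sub>k\<^esup>\<close> and \<open>- v'(b\<^sub>k) / v(b\<^sub>k)\<close> converge to \<open>\<i> \<surd>z\<close> pointwise in the upper half-plane. Pointwise
  convergence of Herglotz functions is enough for the convergence of the value distributions of their
  boundary values: by Poisson's formula for \<open>exp (\<i> t F)\<close>, the angle \<open>\<theta> (F z, S)\<close> is the Poisson average
  of \<open>\<theta> (F\<^sub>+, S)\<close>, so the integrals over \<open>A\<close> of \<open>\<theta> (F (\<lambda> + \<i> d), S)\<close> and of \<open>\<theta> (F\<^sub>+ (\<lambda>), S)\<close> differ by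
  at most the \<open>L\<^sup>1\<close> modulus of continuity of the indicator function of \<open>A\<close> at scale \<open>d\<close>, uniformly in
  \<open>F\<close>.\<close>

section \<open>Poisson's formula\<close>

text \<open>Pointwise convergence to \<open>i_sqrt\<close> is impossible for the real quotients
  \<open>v' / v\<close> on the positive axis, and the estimates of solutions carry a factor
  \<open>1 / Im z\<close> that degenerates there. Solutions are therefore compared at fixed points
  off the axis only. The sign in \<open>-S\<close> has its origin in the current of
  \<open>v\<close>: it is 0 at 0 and negative beyond, so that \<open>- v' / v\<close> is the
  Herglotz function and, read from \<open>b k\<close> towards \<open>a k\<close>, it meets the same
  sign condition at the far end as a Weyl solution. Two things have to be earned.
  \<open>m_function\<close> is a definite description, so Weyl solutions need existence, from
  compactness of a family of Dirichlet problems, and uniqueness of the quotient, from the smallness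
  of \<open>V\<close> far out. Boundary values need existence almost everywhere, which leads through
  primitives and the differentiability of Lipschitz functions down to Vitali's covering theorem. As
  \<open>V\<close> is only locally integrable, derivatives of solutions are understood through
  integrals, and a product rule for indefinite integrals replaces pointwise calculus.\<close>

text \<open>The Poisson integral of \<open>g\<close> at \<open>x + \<i> y\<close> is the integral of \<open>g (x + y s)\<close> against this law of
  \<open>s\<close>; it makes sense for \<open>y = 0\<close> as well.\<close>

definition cauchy_law :: "real measure" where
  "cauchy_law = density lborel (\<lambda>s. ennreal (1 / (pi * (1 + s\<^sup>2))))"

lemma space_cauchy_law [simp]: "space cauchy_law = UNIV"
  and sets_cauchy_law [simp, measurable_cong]: "sets cauchy_law = sets borel"
  by (simp_all add: cauchy_law_def)

lemma integrable_cauchy_density: "integrable lborel (\<lambda>s::real. 1 / (pi * (1 + s\<^sup>2)))"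
  and integral_cauchy_density: "(\<integral>s. 1 / (pi * (1 + s\<^sup>2)) \<partial>lborel) = (1::real)"
proof -
  have e: "1 / (pi * (1 + s\<^sup>2)) = (1 / pi) * inverse (1 + s\<^sup>2)" for s :: real
    by (simp add: field_simps)
  have 1: "integrable lborel (\<lambda>s::real. inverse (1 + s\<^sup>2))"
    using integrable_inverse_1_plus_square by (simp add: set_integrable_def)
  have 2: "(\<integral>s. inverse (1 + s\<^sup>2) \<partial>lborel) = pi"
    using LBINT_inverse_1_plus_square
    by (simp add: interval_lebesgue_integral_def set_lebesgue_integral_def)
  show "integrable lborel (\<lambda>s::real. 1 / (pi * (1 + s\<^sup>2)))"
    unfolding e by (intro integrable_mult_right 1)
  show "(\<integral>s. 1 / (pi * (1 + s\<^sup>2)) \<partial>lborel) = (1::real)"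
    unfolding e using 2 by simp
qed

lemma prob_space_cauchy_law: "prob_space cauchy_law"
proof
  have "emeasure cauchy_law UNIV = (\<integral>\<^sup>+s. ennreal (1 / (pi * (1 + s\<^sup>2))) \<partial>lborel)"
    by (simp add: cauchy_law_def emeasure_density)
  also have "\<dots> = ennreal (\<integral>s. 1 / (pi * (1 + s\<^sup>2)) \<partial>lborel)"
    by (intro nn_integral_eq_integral integrable_cauchy_density) (auto simp: add_nonneg_nonneg)
  finally show "emeasure cauchy_law (space cauchy_law) = 1"
    by (simp add: integral_cauchy_density)
qed

interpretation cauchy_law: prob_space cauchy_law
  by (rule prob_space_cauchy_law)

text \<open>The density is positive everywhere, so the null sets are those of Lebesgue measure.
  Boundary values known almost everywhere on the line can thus be integrated against the
  law.\<close>

lemma AE_cauchy_law: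
  "(AE s in cauchy_law. P s) \<longleftrightarrow> (AE s in lborel. P s)"
proof -
  have "(AE s in cauchy_law. P s) \<longleftrightarrow> (AE s in lborel. 0 < ennreal (1 / (pi * (1 + s\<^sup>2))) \<longrightarrow> P s)"
    unfolding cauchy_law_def by (rule AE_density) simp
  moreover have "0 < ennreal (1 / (pi * (1 + s\<^sup>2)))" for s
    by (simp add: add_pos_nonneg)
  ultimately show ?thesis by simp
qed

lemma integral_cauchy_law:
  fixes f :: "real \<Rightarrow> 'b::{banach, second_countable_topology}"
  assumes [measurable]: "f \<in> borel_measurable borel"
  shows "(\<integral>s. f s \<partial>cauchy_law) = (\<integral>s. (1 / (pi * (1 + s\<^sup>2))) *\<^sub>R f s \<partial>lborel)"
  unfolding cauchy_law_def by (subst integral_density) (auto simp: add_nonneg_nonneg)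

lemma integrable_cauchy_law_iff:
  fixes f :: "real \<Rightarrow> 'b::{banach, second_countable_topology}"
  assumes [measurable]: "f \<in> borel_measurable borel"
  shows "integrable cauchy_law f \<longleftrightarrow> integrable lborel (\<lambda>s. (1 / (pi * (1 + s\<^sup>2))) *\<^sub>R f s)"
  unfolding cauchy_law_def by (subst integrable_density) (auto simp: add_nonneg_nonneg)

text \<open>Cauchy's theorem and integration by parts yield integrals over symmetric intervals; this
  carries their limit over to the Lebesgue integral.\<close>

lemma integral_eq_limit_truncated:
  fixes f :: "real \<Rightarrow> complex"
  assumes "integrable lborel f" "continuous_on UNIV f"
  shows "(\<lambda>n. integral {-real n..real n} f) \<longlonglongrightarrow> (\<integral>s. f s \<partial>lborel)"
proof -
  have [measurable]: "f \<in> borel_measurable borel" using assms by simp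
  have "(\<lambda>n. \<integral>s. indicator {-real n..real n} s *\<^sub>R f s \<partial>lborel) \<longlonglongrightarrow> (\<integral>s. f s \<partial>lborel)"
  proof (rule integral_dominated_convergence[where w="\<lambda>s. norm (f s)"])
    show "AE x in lborel. (\<lambda>i. indicat_real {- real i..real i} x *\<^sub>R f x) \<longlonglongrightarrow> f x"
    proof (rule AE_I2, rule tendsto_eventually)
      fix x
      have "eventually (\<lambda>i. real i \<ge> \<bar>x\<bar>) sequentially"
        using filterlim_real_sequentially unfolding filterlim_at_top by blast
      then show "\<forall>\<^sub>F i in sequentially. indicat_real {- real i..real i} x *\<^sub>R f x = f x"
        by eventually_elim (auto simp: indicator_def)
    qed
  qed (use assms in \<open>auto intro!: AE_I2 simp: indicator_def\<close>)
  moreover have "(\<integral>s. indicator {-real n..real n} s *\<^sub>R f s \<partial>lborel) = integral {-real n..real n} f" for n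
  proof -
    have "set_integrable lborel {-real n..real n} f"
      unfolding set_integrable_def using assms(1)
      by (intro integrable_mult_indicator) auto
    from set_borel_integral_eq_integral(2)[OF this] show ?thesis
      by (simp add: set_lebesgue_integral_def)
  qed
  ultimately show ?thesis by simp
qed

text \<open>Poisson's formula at \<open>\<i>\<close>: the quotient \<open>(h w - h \<i>) / (w\<^sup>2 + 1)\<close> has no pole in the
  upper half-plane, hence integrates to 0 along large semicircles.\<close>

lemma poisson_formula_ii:
  fixes h :: "complex \<Rightarrow> complex"
  assumes e: "e > 0" and holo: "h holomorphic_on {z. Im z > -e}"
    and bd: "\<And>z. Im z \<ge> 0 \<Longrightarrow> norm (h z) \<le> M"
  shows "(\<integral>s. h (of_real s) \<partial>cauchy_law) = h \<i>"
proof -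
  \<comment> \<open>The cap 1 keeps the pole of \<open>1 / (z + \<i>)\<close> at
    \<open>- \<i>\<close> outside the half-plane on which \<open>k\<close> is holomorphic.\<close>
  define e' where "e' = min e 1"
  define f where "f = (\<lambda>z. if z = \<i> then deriv h \<i> else (h z - h \<i>) / (z - \<i>))"
  define k where "k = (\<lambda>z. f z / (z + \<i>))"
  have e': "e' > 0" "e' \<le> 1" "e' \<le> e" using e by (auto simp: e'_def)
  have M: "M \<ge> 0" using order_trans[OF norm_ge_zero bd[of 0]] by simp
  have "f holomorphic_on {z. Im z > -e}"
    unfolding f_def by (rule pole_lemma_open[OF holo]) (simp add: open_halfspace_Im_gt)
  then have fh: "f holomorphic_on {z. Im z > -e'}"
    by (rule holomorphic_on_subset) (use e' in auto)
  have kh: "k holomorphic_on {z. Im z > -e'}"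
    unfolding k_def
  proof (intro holomorphic_intros fh)
    fix z assume "z \<in> {z. Im z > -e'}"
    then have "Im (z + \<i>) > 0" using e' by simp
    then show "z + \<i> \<noteq> 0" by (metis less_irrefl zero_complex.simps(2))
  qed
  have kval: "k w = (h w - h \<i>) / (w\<^sup>2 + 1)" if "w \<noteq> \<i>" for w
    using that by (simp add: k_def f_def field_simps power2_eq_square)
  \<comment> \<open>On the semicircle \<open>k\<close> is O(1 / R^2) against a length of order R, so
    the arc contributes O(1 / R).\<close>
  have kbd: "norm (k w) \<le> 2 * M / (R\<^sup>2 - 1)" if "norm w = R" "Im w \<ge> 0" "R > 1" for w R
  proof -
    have "w \<noteq> \<i>" using that by auto
    have "R\<^sup>2 - 1 \<le> norm (w\<^sup>2 + 1)"
      using norm_triangle_ineq2[of "w\<^sup>2" "-1"] that by (simp add: norm_power)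
    moreover have "norm (h w - h \<i>) \<le> 2 * M"
      using norm_triangle_ineq4[of "h w" "h \<i>"] bd[of w] bd[of \<i>] that by simp
    moreover have "R\<^sup>2 > 1" using that by (simp add: one_less_power)
    ultimately show ?thesis
      unfolding kval[OF \<open>w \<noteq> \<i>\<close>] norm_divide using M by (intro frac_le) auto
  qed
  have hcont: "continuous_on UNIV (\<lambda>s. h (complex_of_real s))"
    by (rule continuous_on_compose2[OF holomorphic_on_imp_continuous_on[OF holo]])
       (use e in \<open>auto intro!: continuous_intros\<close>)
  have int_bd: "norm (integral {-real n..real n} (\<lambda>s. k (of_real s))) \<le> 2 * M / ((real n)\<^sup>2 - 1) * real n * pi"
    if n: "n \<ge> 2" for n
  proof -
    let ?R = "real n"
    let ?l = "linepath (- complex_of_real ?R) (of_real ?R)" and ?a = "part_circlepath 0 ?R 0 pi"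
    have Im_a: "Im w \<ge> 0" if "w \<in> path_image ?a" for w
      using that by (auto simp: path_image_part_circlepath n Im_exp sin_ge_zero)
    have norm_a: "norm w = ?R" if "w \<in> path_image ?a" for w
      using that n in_path_image_part_circlepath[of w 0 ?R 0 pi] by simp
    have sub_l: "path_image ?l \<subseteq> {z. Im z > -e'}"
    proof -
      have "path_image ?l \<subseteq> {z. Im z = 0}"
        by (auto simp: closed_segment_def)
      then show ?thesis using e' by auto
    qed
    have sub_a: "path_image ?a \<subseteq> {z. Im z > -e'}" using Im_a e' by fastforce
    have ends: "pathfinish ?l = pathstart ?a" "pathfinish ?a = pathstart ?l"
      using n by (auto simp: exp_Euler)
    have o: "open {z. Im z > -e'}" by (rule open_halfspace_Im_gt)
    have ci_l: "k contour_integrable_on ?l"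
      by (rule contour_integrable_holomorphic_simple[OF kh o]) (use sub_l in auto)
    have ci_a: "k contour_integrable_on ?a"
      by (rule contour_integrable_holomorphic_simple[OF kh o]) (use sub_a in auto)
    have "(k has_contour_integral 0) (?l +++ ?a)"
      by (rule Cauchy_theorem_convex_simple[OF kh])
         (use ends sub_l sub_a in \<open>auto simp: convex_halfspace_Im_gt path_image_join\<close>)
    then have "contour_integral ?l k + contour_integral ?a k = 0"
      using contour_integral_join[OF ci_l ci_a] contour_integral_unique by force
    then have "norm (contour_integral ?l k) = norm (contour_integral ?a k)"
      by (metis add_eq_0_iff norm_minus_cancel)
    also have "\<dots> \<le> 2 * M / (?R\<^sup>2 - 1) * ?R * \<bar>pi - 0\<bar>"
    proof (rule contour_integral_bound_part_circlepath[OF ci_a])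
      have "?R\<^sup>2 > 1" using n by (simp add: one_less_power)
      then show "0 \<le> 2 * M / (?R\<^sup>2 - 1)" using M by simp
      show "cmod (k x) \<le> 2 * M / (?R\<^sup>2 - 1)" if "x \<in> path_image ?a" for x
        using kbd[of x ?R] that norm_a Im_a n by auto
    qed (use n in auto)
    also have "contour_integral ?l k = integral {-?R..?R} (\<lambda>s. k (of_real s))"
    proof -
      have "(k has_contour_integral contour_integral ?l k) ?l"
        using ci_l by (rule has_contour_integral_integral)
      then have "((\<lambda>x. k (of_real x)) has_integral contour_integral ?l k) {-?R..?R}"
        using n by (subst (asm) has_contour_integral_linepath_Reals_iff) auto
      then show ?thesis by (simp add: integral_unique)
    qed
    finally show ?thesis by simp
  qed
  have lim0: "(\<lambda>n. integral {-real n..real n} (\<lambda>s. k (of_real s))) \<longlonglongrightarrow> 0"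
  proof (rule Lim_null_comparison)
    show "\<forall>\<^sub>F n in sequentially. norm (integral {-real n..real n} (\<lambda>s. k (of_real s))) \<le> 2 * M / ((real n)\<^sup>2 - 1) * real n * pi"
      using eventually_ge_at_top[of 2] by eventually_elim (rule int_bd)
    show "(\<lambda>n. 2 * M / ((real n)\<^sup>2 - 1) * real n * pi) \<longlonglongrightarrow> 0"
      by real_asymp
  qed
  let ?w = "\<lambda>s::real. (1 / (pi * (1 + s\<^sup>2)))"
  have kR: "k (of_real s) = pi *\<^sub>R (?w s *\<^sub>R (h (of_real s) - h \<i>))" for s
  proof -
    have "complex_of_real s \<noteq> \<i>" by (auto simp: complex_eq_iff)
    then have "k (of_real s) = (h (of_real s) - h \<i>) / of_real (s\<^sup>2 + 1)"
      by (simp add: kval)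
    also have "\<dots> = (1 / (1 + s\<^sup>2)) *\<^sub>R (h (of_real s) - h \<i>)"
      by (simp add: scaleR_conv_of_real add.commute)
    finally show ?thesis by simp
  qed
  have hb: "integrable cauchy_law (\<lambda>s. h (of_real s))"
    by (rule cauchy_law.integrable_const_bound[where B=M])
       (use bd hcont in \<open>auto intro: borel_measurable_continuous_onI simp: measurable_cong_sets[OF sets_cauchy_law refl]\<close>)
  then have hb2: "integrable cauchy_law (\<lambda>s. h (of_real s) - h \<i>)" by auto
  have cm: "(\<lambda>s. h (complex_of_real s) - h \<i>) \<in> borel_measurable borel"
    using hcont by (auto intro!: borel_measurable_continuous_onI continuous_intros)
  have ik: "integrable lborel (\<lambda>s. k (of_real s))"
    unfolding kR using hb2 unfolding integrable_cauchy_law_iff[OF cm] by (rule integrable_scaleR_right)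
  have "continuous_on UNIV (\<lambda>s. k (complex_of_real s))"
    by (rule continuous_on_compose2[OF holomorphic_on_imp_continuous_on[OF kh]])
       (use e' in \<open>auto intro!: continuous_intros\<close>)
  from integral_eq_limit_truncated[OF ik this] lim0
  have "(\<integral>s. k (of_real s) \<partial>lborel) = 0" by (rule LIMSEQ_unique)
  then have "pi *\<^sub>R (\<integral>s. h (of_real s) - h \<i> \<partial>cauchy_law) = 0"
    unfolding integral_cauchy_law[OF cm] kR by (subst (asm) integral_scaleR_right) auto
  then have 0: "(\<integral>s. h (of_real s) - h \<i> \<partial>cauchy_law) = 0"
    by (metis pi_neq_zero scaleR_eq_0_iff)
  have "(\<integral>s. h (of_real s) - h \<i> \<partial>cauchy_law) = (\<integral>s. h (of_real s) \<partial>cauchy_law) - h \<i>"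
    using Bochner_Integration.integral_diff[OF hb cauchy_law.integrable_const[of "h \<i>"]]
    by (simp only: lebesgue_integral_const cauchy_law.prob_space scaleR_one)
  with 0 show ?thesis by simp
qed

section \<open>Differentiability of Lipschitz functions\<close>

text \<open>Disjointness is stated for half-open intervals, whose Stieltjes measure is an increment,
  and the covering for open ones, whose union is an open set to which the lemma can be applied
  again. The endpoints, in which the two differ, are countably many.\<close>

lemma Vitali_covering_intervals:
  fixes E U :: "real set" and Q :: "real \<Rightarrow> real \<Rightarrow> bool"
  assumes U: "open U" "E \<subseteq> U"
    and fr: "\<forall>x\<in>E. \<exists>\<^sub>F y in at x. Q (min x y) (max x y)"
  shows "\<exists>C. countable C \<and> (\<forall>i\<in>C. fst i < snd i \<and> {fst i..snd i} \<subseteq> U \<and> Q (fst i) (snd i))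
    \<and> disjoint_family_on (\<lambda>(a, b). {a<..b}) C \<and> negligible (E - (\<Union>(a, b)\<in>C. {a<..<b}))"
proof -
  define K where "K = {(a, b). a < b \<and> {a..b} \<subseteq> U \<and> Q a b}"
  let ?c = "\<lambda>i. (fst i + snd i) / 2 :: real" and ?r = "\<lambda>i. (snd i - fst i) / 2 :: real"
  have ball: "cball (?c i) (?r i) = {fst i..snd i}" for i
    by (auto simp: cball_eq_atLeastAtMost field_simps)
  have cov: "\<exists>i. i \<in> K \<and> x \<in> cball (?c i) (?r i) \<and> ?r i < d" if x: "x \<in> E" and d: "0 < d" for x d
  proof -
    obtain e where e: "e > 0" "ball x e \<subseteq> U" using U x by (meson openE subsetD)
    have "\<forall>\<^sub>F y in at x. dist y x < min d e \<and> y \<noteq> x"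
      using d e by (auto simp: eventually_at intro!: exI[of _ "min d e"])
    then have "\<exists>\<^sub>F y in at x. Q (min x y) (max x y) \<and> (dist y x < min d e \<and> y \<noteq> x)"
      by (rule frequently_rev_mp[OF bspec[OF fr x], OF eventually_mono]) auto
    then obtain y where y: "Q (min x y) (max x y)" "dist y x < min d e" "y \<noteq> x"
      using frequently_ex by blast
    have "{min x y..max x y} \<subseteq> ball x e"
      using y(2) by (auto simp: dist_real_def)
    with e y have "(min x y, max x y) \<in> K" by (auto simp: K_def)
    moreover have "x \<in> cball (?c (min x y, max x y)) (?r (min x y, max x y))"
      unfolding ball by auto
    moreover have "?r (min x y, max x y) < d" using y(2) by (auto simp: dist_real_def)
    ultimately show ?thesis by blast
  qed
  obtain C where C: "countable C" "C \<subseteq> K"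
     "pairwise (\<lambda>i j. disjnt (cball (?c i) (?r i)) (cball (?c j) (?r j))) C"
     "negligible(E - (\<Union>i \<in> C. cball (?c i) (?r i)))"
  proof (rule Vitali_covering_theorem_cballs[of K ?r E ?c])
    show "0 < ?r i" if "i \<in> K" for i using that by (auto simp: K_def)
    show "\<exists>i. i \<in> K \<and> x \<in> cball (?c i) (?r i) \<and> ?r i < d" if "x \<in> E" "0 < d" for x d
      using cov[OF that] .
  qed
  show ?thesis
  proof (intro exI[of _ C] conjI)
    show "countable C" by fact
    show "\<forall>i\<in>C. fst i < snd i \<and> {fst i..snd i} \<subseteq> U \<and> Q (fst i) (snd i)"
    proof
      fix i assume "i \<in> C"
      then have "i \<in> K" using C(2) by blast
      then show "fst i < snd i \<and> {fst i..snd i} \<subseteq> U \<and> Q (fst i) (snd i)"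
        by (simp add: K_def split_beta)
    qed
    show "disjoint_family_on (\<lambda>(a, b). {a<..b}) C"
      unfolding disjoint_family_on_def
    proof (intro ballI impI)
      fix i j assume "i \<in> C" "j \<in> C" "i \<noteq> j"
      then have "disjnt {fst i..snd i} {fst j..snd j}"
        using C(3) unfolding ball by (auto simp: pairwise_def)
      then show "(case i of (a, b) \<Rightarrow> {a<..b}) \<inter> (case j of (a, b) \<Rightarrow> {a<..b}) = {}"
        unfolding disjnt_def by (auto simp: split_beta disjoint_iff)
    qed
    have "E - (\<Union>(a, b)\<in>C. {a<..<b}) \<subseteq> (E - (\<Union>i \<in> C. cball (?c i) (?r i))) \<union> (fst ` C \<union> snd ` C)"
    proof
      fix x assume x: "x \<in> E - (\<Union>(a, b)\<in>C. {a<..<b})"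
      show "x \<in> (E - (\<Union>i \<in> C. cball (?c i) (?r i))) \<union> (fst ` C \<union> snd ` C)"
      proof (cases "x \<in> (\<Union>i \<in> C. cball (?c i) (?r i))")
        case True
        then obtain i where i: "i \<in> C" "fst i \<le> x" "x \<le> snd i" unfolding ball by auto
        then have "\<not> (fst i < x \<and> x < snd i)" using x by (auto simp: split_beta)
        with i have "x = fst i \<or> x = snd i" by linarith
        with i show ?thesis by blast
      qed (use x in blast)
    qed
    moreover have "negligible (fst ` C \<union> snd ` C)"
      using C(1) by (intro countable_imp_null_set_lborel[THEN null_sets_completionI, unfolded negligible_iff_null_sets[symmetric]]) auto
    ultimately show "negligible (E - (\<Union>(a, b)\<in>C. {a<..<b}))"
      using C(4) negligible_Un negligible_subset by blast
  qed
qed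

text \<open>Comparison on single intervals adds up over a disjoint family. It serves in both
  directions between Lebesgue measure and a Stieltjes measure.\<close>

lemma emeasure_Union_intervals_mono:
  fixes M N :: "real measure"
  assumes "countable C" "disjoint_family_on (\<lambda>(a, b). {a<..b}) C"
    and [simp]: "sets M = sets borel" "sets N = sets borel"
    and le: "\<And>a b. (a, b) \<in> C \<Longrightarrow> emeasure M {a<..b} \<le> c * emeasure N {a<..b}"
  shows "emeasure M (\<Union>(a, b)\<in>C. {a<..b}) \<le> c * emeasure N (\<Union>(a, b)\<in>C. {a<..b})"
proof -
  have "emeasure M (\<Union>(a, b)\<in>C. {a<..b}) = (\<integral>\<^sup>+i. emeasure M (case i of (a, b) \<Rightarrow> {a<..b}) \<partial>count_space C)"
    using assms(1,2) by (intro emeasure_UN_countable) auto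
  also have "\<dots> \<le> (\<integral>\<^sup>+i. c * emeasure N (case i of (a, b) \<Rightarrow> {a<..b}) \<partial>count_space C)"
    using le by (intro nn_integral_mono) (auto simp: split_beta)
  also have "\<dots> = c * (\<integral>\<^sup>+i. emeasure N (case i of (a, b) \<Rightarrow> {a<..b}) \<partial>count_space C)"
    by (rule nn_integral_cmult) auto
  also have "(\<integral>\<^sup>+i. emeasure N (case i of (a, b) \<Rightarrow> {a<..b}) \<partial>count_space C) = emeasure N (\<Union>(a, b)\<in>C. {a<..b})"
    using assms(1,2) by (intro emeasure_UN_countable[symmetric]) auto
  finally show ?thesis .
qed

text \<open>An open cover \<open>U\<close> of \<open>E\<close> can be replaced, up to a null set, by
  one of measure at most \<open>p / q\<close> times that of \<open>U\<close>: take intervals of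
  slope below \<open>p\<close> in \<open>U\<close>, and inside them intervals of slope above
  \<open>q\<close>. The increments of \<open>u\<close> over the inner intervals are at least
  \<open>q\<close> times their length and in total at most those over the outer ones, which are at
  most \<open>p\<close> times theirs. As \<open>p / q < 1\<close>, the outer measure of
  \<open>E\<close> is 0.\<close>

lemma negligible_mono_oscillation:
  fixes u :: "real \<Rightarrow> real"
  assumes mono: "\<And>x y. x \<le> y \<Longrightarrow> u x \<le> u y" and cont: "continuous_on UNIV u"
    and pq: "0 < p" "p < q" and E: "bounded E"
    and lo: "\<And>x. x \<in> E \<Longrightarrow> \<exists>\<^sub>F y in at x. (u y - u x) / (y - x) < p"
    and hi: "\<And>x. x \<in> E \<Longrightarrow> \<exists>\<^sub>F y in at x. (u y - u x) / (y - x) > q"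
  shows "negligible E"
proof -
  let ?I = "\<lambda>C. \<Union>(a, b)\<in>C. {a<..b::real}" and ?O = "\<lambda>C. \<Union>(a, b)\<in>C. {a<..<b::real}"
  let ?N = "interval_measure u"
  have N: "emeasure ?N {a<..b} = ennreal (u b - u a)" if "a \<le> b" for a b
  proof (rule emeasure_interval_measure_Ioc[OF that])
    show "u x \<le> u y" if "x \<le> y" for x y using mono[OF that] .
    show "continuous (at_right x) u" for x
      using continuous_on_imp_continuous_within[OF cont subset_UNIV UNIV_I] .
  qed
  have sym: "(u y - u x) / (y - x) = (u (max x y) - u (min x y)) / (max x y - min x y)" for x y
    using minus_divide_divide[of "u x - u y" "x - y"] by (cases "x \<le> y") (auto simp: max_def min_def)
  have shrink: "\<exists>W. open W \<and> W \<subseteq> U \<and> negligible (E - W) \<and> emeasure lborel W \<le> ennreal (p / q) * emeasure lborel U"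
    if U: "open U" "E \<subseteq> U" for U
  proof -
    have frp: "\<forall>x\<in>E. \<exists>\<^sub>F y in at x. (u (max x y) - u (min x y)) / (max x y - min x y) < p"
      unfolding sym[symmetric] using lo by (rule ballI)
    from Vitali_covering_intervals[OF U frp]
    obtain C where C: "countable C"
      "\<forall>i\<in>C. fst i < snd i \<and> {fst i..snd i} \<subseteq> U \<and> (u (snd i) - u (fst i)) / (snd i - fst i) < p"
      "disjoint_family_on (\<lambda>(a, b). {a<..b}) C" "negligible (E - ?O C)"
      by (elim exE conjE)
    have C2: "a < b \<and> {a..b} \<subseteq> U \<and> (u b - u a) / (b - a) < p" if "(a, b) \<in> C" for a b
      using bspec[OF C(2) that] by (simp only: fst_conv snd_conv)
    have O: "open (?O C)" by auto
    have frq: "\<forall>x\<in>E \<inter> ?O C. \<exists>\<^sub>F y in at x. q < (u (max x y) - u (min x y)) / (max x y - min x y)"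
      unfolding sym[symmetric] using hi[OF IntD1] by (rule ballI)
    from Vitali_covering_intervals[OF O Int_lower2 frq]
    obtain D where D: "countable D"
      "\<forall>i\<in>D. fst i < snd i \<and> {fst i..snd i} \<subseteq> ?O C \<and> q < (u (snd i) - u (fst i)) / (snd i - fst i)"
      "disjoint_family_on (\<lambda>(a, b). {a<..b}) D" "negligible (E \<inter> ?O C - ?O D)"
      by (elim exE conjE)
    have D2: "a < b \<and> {a..b} \<subseteq> ?O C \<and> q < (u b - u a) / (b - a)" if "(a, b) \<in> D" for a b
      using bspec[OF D(2) that] by (simp only: fst_conv snd_conv)
    have sets: "?I C \<in> sets borel" "?I D \<in> sets borel"       by (rule sets.countable_UN''[OF C(1)], simp add: split_beta)
         (rule sets.countable_UN''[OF D(1)], simp add: split_beta)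
    have sub2: "?I C \<subseteq> U" "?I D \<subseteq> ?O C"
    proof (safe)
      fix a b x assume "(a, b) \<in> C" "x \<in> {a<..b}"
      then have "x \<in> {a..b}" "{a..b} \<subseteq> U" using C2[of a b] by auto
      then show "x \<in> U" by (rule rev_subsetD)
    next
      fix a b x assume "(a, b) \<in> D" "x \<in> {a<..b}"
      then have "x \<in> {a..b}" "{a..b} \<subseteq> ?O C" using D2[of a b] by auto
      then show "x \<in> ?O C" by (rule rev_subsetD)
    qed
    have sub1: "?O C \<subseteq> ?I C" "?O D \<subseteq> ?I D"
      by (intro UN_mono order_refl; simp add: split_beta greaterThanLessThan_def greaterThanAtMost_def; blast intro: less_imp_le)+
    have "ennreal q * emeasure lborel (?I D) \<le> emeasure ?N (?I D)"
    proof -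
      have "emeasure lborel (?I D) \<le> ennreal (1 / q) * emeasure ?N (?I D)"
      proof (rule emeasure_Union_intervals_mono[OF D(1,3)])
        fix a b assume ab: "(a, b) \<in> D"
        have "a < b" "q < (u b - u a) / (b - a)" using D2[OF ab] by blast+
        then have "q * (b - a) < u b - u a" by (simp add: pos_less_divide_eq)
        then have "b - a \<le> (u b - u a) / q" using pq by (simp add: field_simps)
        with \<open>a < b\<close> show "emeasure lborel {a<..b} \<le> ennreal (1 / q) * emeasure ?N {a<..b}"
          using pq by (simp add: N ennreal_mult'[symmetric] ennreal_leI)
      qed auto
      then have "ennreal q * emeasure lborel (?I D) \<le> ennreal q * (ennreal (1 / q) * emeasure ?N (?I D))"
        by (intro mult_left_mono) auto
      also have "\<dots> = emeasure ?N (?I D)"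
        using pq by (simp add: mult.assoc[symmetric] ennreal_mult'[symmetric])
      finally show ?thesis .
    qed
    also have "\<dots> \<le> emeasure ?N (?I C)" using sub1 sub2 sets by (intro emeasure_mono) auto
    also have "\<dots> \<le> ennreal p * emeasure lborel (?I C)"
    proof (rule emeasure_Union_intervals_mono[OF C(1,3)])
      fix a b assume ab: "(a, b) \<in> C"
      have "a < b" "(u b - u a) / (b - a) < p" using C2[OF ab] by blast+
      moreover from this have "u b - u a < p * (b - a)" by (simp add: pos_divide_less_eq)
      ultimately show "emeasure ?N {a<..b} \<le> ennreal p * emeasure lborel {a<..b}"
        using pq by (simp add: N ennreal_mult'[symmetric])
    qed auto
    also have "\<dots> \<le> ennreal p * emeasure lborel U"
      using sub1 sub2 U by (intro mult_left_mono emeasure_mono) auto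
    finally have 1: "ennreal q * emeasure lborel (?I D) \<le> ennreal p * emeasure lborel U" .
    have "emeasure lborel (?O D) \<le> emeasure lborel (?I D)" using sub1 sub2 sets by (intro emeasure_mono) auto
    also have "\<dots> = ennreal (1 / q) * (ennreal q * emeasure lborel (?I D))"
      using pq by (simp add: mult.assoc[symmetric] ennreal_mult'[symmetric])
    also have "\<dots> \<le> ennreal (1 / q) * (ennreal p * emeasure lborel U)"
      using 1 by (intro mult_left_mono) auto
    also have "\<dots> = ennreal (p / q) * emeasure lborel U"
      using pq by (simp add: mult.assoc[symmetric] ennreal_mult'[symmetric])
    finally have 2: "emeasure lborel (?O D) \<le> ennreal (p / q) * emeasure lborel U" .
    have "negligible ((E - ?O C) \<union> (E \<inter> ?O C - ?O D))" using C(4) D(4) negligible_Un by blast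
    moreover have "E - P \<subseteq> (E - Q) \<union> (E \<inter> Q - P)" for P Q :: "real set" by blast
    ultimately have "negligible (E - ?O D)" by (rule negligible_subset)
    have "open (?O D)" by auto
    moreover have "?O D \<subseteq> U"
      by (rule order_trans[OF sub1(2) order_trans[OF sub2(2) order_trans[OF sub1(1) sub2(1)]]])
    ultimately show ?thesis using 2 \<open>negligible (E - ?O D)\<close> by (intro exI[of _ "?O D"] conjI)
  qed
  \<comment> \<open>\<open>Inf X\<close> is the outer measure of \<open>E\<close>; boundedness of
    \<open>E\<close> makes \<open>X\<close> nonempty.\<close>
  define X where "X = {measure lebesgue U |U. open U \<and> E \<subseteq> U \<and> U \<in> lmeasurable}"
  obtain R where R: "E \<subseteq> ball 0 R" using E bounded_subset_ballD by blast
  have X: "measure lebesgue (ball (0::real) R) \<in> X" unfolding X_def using R open_ball lmeasurable_ball by blast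
  have X0: "bdd_below X" by (intro bdd_belowI[of _ 0]) (auto simp: X_def)
  have "Inf X \<le> 0"
  proof (rule ccontr)
    assume "\<not> Inf X \<le> 0"
    then have m: "Inf X > 0" by simp
    \<comment> \<open>Since \<open>q / p > 1\<close>, some open cover has measure below this
      multiple of \<open>Inf X\<close>, and shrinking it by \<open>p / q\<close> brings it below
      \<open>Inf X\<close>.\<close>
    then have "Inf X * 1 < Inf X * (q / p)" using pq by (intro mult_strict_left_mono) auto
    then have "Inf X < Inf X * (q / p)" by simp
    then obtain U where U: "open U" "E \<subseteq> U" "U \<in> lmeasurable" "measure lebesgue U < Inf X * (q / p)"
      using cInf_lessD[of X "Inf X * (q / p)"] X unfolding X_def by blast
    obtain W where W: "open W" "W \<subseteq> U" "negligible (E - W)" "emeasure lborel W \<le> ennreal (p / q) * emeasure lborel U"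
      using shrink[OF U(1,2)] by blast
    have Wm: "W \<in> lmeasurable" using W U by (intro fmeasurableI2[OF U(3) W(2)]) auto
    have em: "emeasure lborel A = ennreal (measure lebesgue A)" if "open A" "A \<in> lmeasurable" for A
    proof -
      have "emeasure lebesgue A = emeasure lborel A" using that(1) by simp
      then show ?thesis using emeasure_eq_measure2[OF that(2)] by simp
    qed
    have "ennreal (measure lebesgue W) \<le> ennreal (p / q) * ennreal (measure lebesgue U)"
      using W(4) unfolding em[OF W(1) Wm] em[OF U(1,3)] .
    then have mW: "measure lebesgue W \<le> p / q * measure lebesgue U"
      using pq by (simp add: ennreal_mult'[symmetric])
    also have "\<dots> < p / q * (Inf X * (q / p))" using U(4) pq by (intro mult_strict_left_mono) auto
    also have "\<dots> = Inf X" using pq by simp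
    finally have "0 < Inf X - measure lebesgue W" by simp
    \<comment> \<open>\<open>W\<close> covers \<open>E\<close> only up to a null set;
      \<open>T\<close> is an open cover of the rest, small enough for the union to stay below
      \<open>Inf X\<close>.\<close>
    then obtain T where T: "open T" "E - W \<subseteq> T" "T - (E - W) \<in> lmeasurable"
      "emeasure lebesgue (T - (E - W)) < ennreal (Inf X - measure lebesgue W)"
      using sets_lebesgue_outer_open[OF negligible_imp_sets[OF W(3)]] by blast
    have N: "E - W \<in> lmeasurable" "measure lebesgue (E - W) = 0"
      using W(3) by (auto simp: negligible_iff_measure)
    have T_eq: "T = (T - (E - W)) \<union> (E - W)" using T(2) by blast
    have T3: "T \<in> lmeasurable" using T(3) N(1) by (subst T_eq) (rule fmeasurable.Un)
    have "measure lebesgue T \<le> measure lebesgue (T - (E - W)) + measure lebesgue (E - W)"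
      using T(3) N(1) by (subst T_eq) (rule measure_Un_le, auto)
    also have "\<dots> < Inf X - measure lebesgue W"
      using T(3,4) N(2) \<open>0 < Inf X - measure lebesgue W\<close>
      by (simp add: emeasure_eq_measure2 ennreal_less_iff)
    finally have T4: "measure lebesgue T < Inf X - measure lebesgue W" .
    have "W \<union> T \<in> lmeasurable" using Wm T3 by (rule fmeasurable.Un)
    then have "measure lebesgue (W \<union> T) \<in> X" unfolding X_def using W(1) T(1,2) by blast
    then have "Inf X \<le> measure lebesgue (W \<union> T)" using X0 by (rule cInf_lower)
    also have "\<dots> \<le> measure lebesgue W + measure lebesgue T"
      using Wm T3 by (intro measure_Un_le) auto
    finally show False using T4 by simp
  qed
  show ?thesis
    unfolding negligible_outer
  proof (intro allI impI)
    fix e :: real assume "e > 0"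
    then have "Inf X < e" using \<open>Inf X \<le> 0\<close> by simp
    then obtain U where "open U" "E \<subseteq> U" "U \<in> lmeasurable" "measure lebesgue U < e"
      using cInf_lessD[of X e] X unfolding X_def by blast
    then show "\<exists>T. E \<subseteq> T \<and> T \<in> lmeasurable \<and> measure lebesgue T < e" by blast
  qed
qed

text \<open>The limit is the lower limit, obtained as the supremum of the eventual lower bounds.
  Slightly above it lie two rationals \<open>p < q\<close>; values below \<open>p\<close> recur,
  hence values above \<open>q\<close> do not. Rational levels will leave only countably many
  exceptional sets.\<close>

lemma convergent_if_no_oscillation:
  fixes f :: "'b \<Rightarrow> real"
  assumes bd: "\<forall>\<^sub>F x in F. \<bar>f x\<bar> \<le> L" and nt: "F \<noteq> bot"
    and osc: "\<And>p q. p \<in> \<rat> \<Longrightarrow> q \<in> \<rat> \<Longrightarrow> p < q \<Longrightarrow> \<not> ((\<exists>\<^sub>F x in F. f x < p) \<and> (\<exists>\<^sub>F x in F. f x > q))"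
  shows "\<exists>l. (f \<longlongrightarrow> l) F"
proof -
  define S where "S = {r. \<forall>\<^sub>F x in F. r \<le> f x}"
  have S1: "- L \<in> S" unfolding S_def using bd by (auto elim!: eventually_mono)
  have S2: "r \<le> L" if "r \<in> S" for r
  proof -
    have "\<forall>\<^sub>F x in F. r \<le> L"
      using bd that unfolding S_def by (auto elim: eventually_elim2)
    then show ?thesis using nt by (simp add: eventually_const_iff)
  qed
  have bdd: "bdd_above S" using S2 by (rule bdd_aboveI)
  have "(f \<longlongrightarrow> Sup S) F"
  proof (rule tendstoI)
    fix e :: real assume e: "e > 0"
    obtain r where r: "r \<in> S" "Sup S - e < r" using less_cSupD[of S "Sup S - e"] S1 e by auto
    obtain p where p: "Sup S < p" "p < Sup S + e / 2" "p \<in> \<rat>" using Rats_dense_in_real[of "Sup S" "Sup S + e / 2"] e by auto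
    obtain q where q: "p < q" "q < Sup S + e / 2" "q \<in> \<rat>" using Rats_dense_in_real[OF p(2)] by auto
    have "p \<notin> S" using p bdd cSup_upper[of p S] by auto
    then have "\<exists>\<^sub>F x in F. f x < p"
      by (simp add: S_def frequently_def not_less)
    then have "\<not> (\<exists>\<^sub>F x in F. f x > q)" using osc[OF p(3) q(3) q(1)] by blast
    then have "\<forall>\<^sub>F x in F. f x \<le> q" by (simp add: frequently_def not_less)
    moreover have "\<forall>\<^sub>F x in F. r \<le> f x" using r by (simp add: S_def)
    ultimately show "\<forall>\<^sub>F x in F. dist (f x) (Sup S) < e"
    proof eventually_elim
      case (elim x)
      then show ?case using r(2) q(2) e by (simp add: dist_real_def abs_less_iff)
    qed
  qed
  then show ?thesis ..
qed

text \<open>The Lipschitz bound keeps the difference quotients bounded, so they can fail to converge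
  only by oscillating across a pair of rationals, and each pair contributes a null set in every
  ball.\<close>

lemma mono_lipschitz_differentiable_AE:
  fixes u :: "real \<Rightarrow> real"
  assumes lower: "\<And>x y. x \<le> y \<Longrightarrow> u x \<le> u y" and upper: "\<And>x y. x \<le> y \<Longrightarrow> u y - u x \<le> L * (y - x)"
  shows "AE x in lborel. \<exists>D. (u has_real_derivative D) (at x)"
proof -
  have L: "\<bar>u y - u x\<bar> \<le> L * \<bar>y - x\<bar>" for x y
    using lower[of x y] lower[of y x] upper[of x y] upper[of y x] by (cases "x \<le> y") auto
  have L0: "L \<ge> 0" using L[of 1 0] by simp
  have cont: "continuous_on UNIV u"
  proof (rule continuous_on_interior[where S=UNIV, THEN continuous_at_imp_continuous_on[OF ballI], rotated])
  qed (use L L0 in \<open>auto intro!: lipschitz_on_continuous_on[of L] lipschitz_onI simp: dist_real_def abs_minus_commute\<close>)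
  let ?q = "\<lambda>x y. (u y - u x) / (y - x)"
  define E where "E p q n = {x \<in> ball 0 (real n). (\<exists>\<^sub>F y in at x. ?q x y < p) \<and> (\<exists>\<^sub>F y in at x. ?q x y > q)}" for p q n
  have q0: "0 \<le> ?q x y" for x y
    using lower[of x y] lower[of y x] by (cases "x \<le> y") (auto simp: divide_simps)
  have neg: "negligible (E p q n)" if "p < q" for p q n
  proof (cases "p > 0")
    case True
    show ?thesis
      by (rule negligible_mono_oscillation[OF lower cont True that])
         (auto simp: E_def intro: bounded_subset[OF bounded_ball[of 0 "real n"]])
  next
    case False
    then have "\<not> ?q x y < p" for x y using q0[of y x] by linarith
    then have "E p q n = {}" by (simp add: E_def)
    then show ?thesis by simp
  qed
  define Z where "Z = (\<Union>(p, q, n)\<in>{(p, q, n). p \<in> \<rat> \<and> q \<in> \<rat> \<and> p < q}. E p q n)"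
  have "{(p::real, q, n::nat). p \<in> \<rat> \<and> q \<in> \<rat> \<and> p < q} \<subseteq> \<rat> \<times> \<rat> \<times> UNIV" by auto
  then have "countable {(p::real, q, n::nat). p \<in> \<rat> \<and> q \<in> \<rat> \<and> p < q}"
    by (rule countable_subset) (auto simp: countable_rat)
  then have "negligible Z"
    unfolding Z_def negligible_iff_null_sets
    by (intro null_sets_UN') (auto simp: negligible_iff_null_sets[symmetric] neg)
  then have "AE x in lebesgue. x \<notin> Z"
    by (simp add: negligible_iff_null_sets AE_not_in)
  moreover have "\<exists>D. (u has_real_derivative D) (at x)" if "x \<notin> Z" for x
  proof -
    have "\<exists>l. (?q x \<longlongrightarrow> l) (at x)"
    proof (rule convergent_if_no_oscillation)
      show "\<forall>\<^sub>F y in at x. \<bar>?q x y\<bar> \<le> L"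
        using L[of _ x] L0 by (auto simp: abs_divide divide_simps intro!: always_eventually)
      fix p q :: real assume pq: "p \<in> \<rat>" "q \<in> \<rat>" "p < q"
      obtain n where "\<bar>x\<bar> < real n" using reals_Archimedean2 by blast
      then have xb: "x \<in> ball 0 (real n)" by simp
      have "x \<notin> E p q n" using that pq by (auto simp: Z_def)
      then show "\<not> ((\<exists>\<^sub>F y in at x. ?q x y < p) \<and> (\<exists>\<^sub>F y in at x. ?q x y > q))"
        using xb by (simp add: E_def)
    qed simp
    then show ?thesis by (simp add: has_field_derivative_iff)
  qed
  ultimately have "AE x in lebesgue. \<exists>D. (u has_real_derivative D) (at x)"
    by (auto elim: eventually_mono)
  then show ?thesis by (simp add: AE_completion_iff)
qed

section \<open>Fatou's theorem\<close>

abbreviation upper_half_plane :: "complex set" where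
  "upper_half_plane \<equiv> {z. 0 < Im z}"

lemma AE_lborel_affine:
  fixes P :: "real \<Rightarrow> bool"
  assumes "AE t in lborel. P t" "c \<noteq> 0"
  shows "AE s in lborel. P (x + c * s)"
proof -
  obtain N where "{t \<in> space lborel. \<not> P t} \<subseteq> N" "emeasure lborel N = 0" "N \<in> sets lborel"
    by (rule AE_E[OF assms(1)])
  then have N: "{t. \<not> P t} \<subseteq> N" "N \<in> null_sets lborel" by (simp_all add: null_setsI)
  then have [measurable]: "N \<in> sets borel" by auto
  have "AE t in lborel. t \<notin> N" using N(2) by (rule AE_not_in)
  then have "AE t in density (distr lborel borel (\<lambda>s. x + c * s)) (\<lambda>_. ennreal \<bar>c\<bar>). t \<notin> N"
    by (subst lborel_real_affine[OF assms(2), of x, symmetric])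
  then have "AE s in lborel. x + c * s \<notin> N"
    using assms(2) by (simp add: AE_density AE_distr_iff)
  then show ?thesis
    using N(1) by (auto elim!: eventually_mono)
qed

text \<open>The weight \<open>2 * s / (1 + s\<^sup>2)\<close> is minus the logarithmic derivative of
  the Cauchy density. It appears when Poisson's formula is integrated by parts, and its decay
  compensates the linear growth of a Lipschitz primitive.\<close>

lemma weight_bound: "\<bar>2 * s / (1 + s\<^sup>2)\<bar> * \<bar>s\<bar> \<le> (2::real)"
proof -
  have "1 + s\<^sup>2 > 0" by (simp add: add_pos_nonneg)
  moreover have "2 * \<bar>s\<bar> * \<bar>s\<bar> = 2 * s\<^sup>2" by (simp add: power2_eq_square)
  ultimately show ?thesis by (simp add: abs_mult divide_simps)
qed

lemma norm_weight_le:
  fixes v :: "'a::real_normed_vector"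
  assumes "norm v \<le> M * \<bar>s\<bar>" "M \<ge> 0"
  shows "norm ((2 * s / (1 + s\<^sup>2)) *\<^sub>R v) \<le> 2 * M"
proof -
  have "norm ((2 * s / (1 + s\<^sup>2)) *\<^sub>R v) \<le> \<bar>2 * s / (1 + s\<^sup>2)\<bar> * (M * \<bar>s\<bar>)"
    unfolding norm_scaleR by (intro mult_left_mono assms) auto
  also have "\<dots> = M * (\<bar>2 * s / (1 + s\<^sup>2)\<bar> * \<bar>s\<bar>)" by simp
  also have "\<dots> \<le> M * 2" by (intro mult_left_mono weight_bound assms)
  finally show ?thesis by simp
qed

lemma Complex_eq_linear: "Complex (x + y * s) e = Complex x e + of_real y * of_real s"
  by (simp add: complex_eq_iff)

lemma lipschitz_primitive:
  assumes H: "\<And>z. Im z > 0 \<Longrightarrow> (H has_field_derivative h z) (at z)"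
    and bd: "\<And>z. Im z > 0 \<Longrightarrow> norm (h z) \<le> M" and "Im z > 0" "Im w > 0"
  shows "norm (H z - H w) \<le> M * norm (z - w)"
  using assms
  by (intro field_differentiable_bound[of upper_half_plane H h M])
     (auto simp: convex_halfspace_Im_gt intro: has_field_derivative_at_within)

text \<open>Integration by parts in Poisson's formula replaces \<open>h\<close> by increments of its
  primitive \<open>H\<close>. On the line at height \<open>e\<close> both functions are smooth, so
  the behaviour at the boundary does not enter yet; subtracting the value at \<open>s = 0\<close>
  gives the linear bound on the increments.\<close>

lemma poisson_primitive_shifted:
  fixes h H :: "complex \<Rightarrow> complex"
  assumes holo: "h holomorphic_on upper_half_plane"
    and H: "\<And>z. Im z > 0 \<Longrightarrow> (H has_field_derivative h z) (at z)"
    and bd: "\<And>z. Im z > 0 \<Longrightarrow> norm (h z) \<le> M"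
    and y: "y > 0" and e: "e > 0"
  shows "h (Complex x (y + e)) =
    (\<integral>s. (2 * s / (1 + s\<^sup>2)) *\<^sub>R ((H (Complex (x + y * s) e) - H (Complex x e)) / of_real y) \<partial>cauchy_law)"
proof -
  have M: "M \<ge> 0" using order_trans[OF norm_ge_zero bd[of \<i>]] by simp
  define g where "g w = h (Complex x e + of_real y * w)" for w
  define \<Phi> where "\<Phi> s = H (Complex (x + y * s) e) - H (Complex x e)" for s
  define p where "p s = 1 / (pi * (1 + s\<^sup>2))" for s :: real
  define k where "k s = 2 * s / (1 + s\<^sup>2)" for s :: real
  have pos: "1 + s\<^sup>2 > 0" for s :: real by (simp add: add_pos_nonneg)
  have dom: "Im (Complex x e + of_real y * w) > 0 \<longleftrightarrow> Im w > - (e / y)" for w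
    using y by (auto simp: field_simps)
  have gh: "g holomorphic_on {w. Im w > - (e / y)}"
    unfolding g_def
    by (rule holomorphic_on_compose_gen[OF _ holo, unfolded o_def])
       (use dom in \<open>auto intro!: holomorphic_intros\<close>)
  have gb: "norm (g w) \<le> M" if "Im w \<ge> 0" for w
    unfolding g_def using y e that by (intro bd) (simp add: add_pos_nonneg)
  have g_int: "(\<integral>s. g (of_real s) \<partial>cauchy_law) = h (Complex x (y + e))"
  proof -
    have "(\<integral>s. g (of_real s) \<partial>cauchy_law) = g \<i>"
      by (rule poisson_formula_ii[OF _ gh gb]) (use y e in auto)
    also have "g \<i> = h (Complex x (y + e))" unfolding g_def by (rule arg_cong[where f=h]) (simp add: complex_eq_iff)
    finally show ?thesis .
  qed
  have g_cont: "continuous_on UNIV (\<lambda>s. g (complex_of_real s))"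
    by (rule continuous_on_compose2[OF holomorphic_on_imp_continuous_on[OF gh]])
       (use y e in \<open>auto intro!: continuous_intros\<close>)
  have \<Phi>_bd: "norm (\<Phi> s) \<le> (M * y) * \<bar>s\<bar>" for s
  proof -
    have "norm (\<Phi> s) \<le> M * norm (Complex (x + y * s) e - Complex x e)"
      unfolding \<Phi>_def using e by (intro lipschitz_primitive[OF H bd]) auto
    also have "Complex (x + y * s) e - Complex x e = of_real (y * s)" by (simp add: complex_eq_iff)
    finally show ?thesis using y by (simp add: abs_mult norm_mult mult_ac)
  qed
  have \<Phi>_deriv: "(\<Phi> has_vector_derivative of_real y * g (of_real s)) (at s)" for s
  proof -
    have "((\<lambda>s. H (Complex x e + of_real y * of_real s)) has_vector_derivative (of_real y * g (of_real s))) (at s)"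
    proof -
      have l: "((\<lambda>s. Complex x e + of_real y * of_real s) has_vector_derivative of_real y) (at s)"
        by (auto intro!: derivative_eq_intros simp: has_vector_derivative_def scaleR_conv_of_real mult.commute)
      have "(H has_field_derivative g (of_real s)) (at (Complex x e + of_real y * of_real s))"
        unfolding g_def using e by (intro H) simp
      from field_vector_diff_chain_at[OF l this] show ?thesis by (simp add: o_def)
    qed
    then show ?thesis
      unfolding \<Phi>_def Complex_eq_linear by (auto intro!: derivative_eq_intros)
  qed
  have \<Phi>_cont: "continuous_on UNIV \<Phi>"
    using \<Phi>_deriv by (meson continuous_at_imp_continuous_on has_vector_derivative_continuous)
  have p_deriv: "(p has_real_derivative (- (p s * k s))) (at s)" for s
    unfolding p_def k_def using pos[of s]
    by (auto intro!: derivative_eq_intros simp: divide_simps power2_eq_square)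
  \<comment> \<open>\<open>p s *\<^sub>R f s\<close> is the derivative of
    \<open>p s *\<^sub>R \<Phi> s\<close>, which vanishes at infinity; hence \<open>f\<close> has
    mean 0 under the law.\<close>
  define f where "f s = of_real y * g (of_real s) - k s *\<^sub>R \<Phi> s" for s
  have k_cont: "continuous_on UNIV k"
    unfolding k_def using pos by (auto intro!: continuous_intros simp: less_imp_neq[THEN not_sym])
  have f_cont: "continuous_on UNIV f"
    unfolding f_def by (intro continuous_intros g_cont \<Phi>_cont k_cont)
  have f_meas[measurable]: "f \<in> borel_measurable borel"
    using f_cont by (rule borel_measurable_continuous_onI)
  have k\<Phi>_bd: "norm (k s *\<^sub>R \<Phi> s) \<le> 2 * (M * y)" for s
    unfolding k_def by (rule norm_weight_le[OF \<Phi>_bd]) (use M y in auto)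
  have k\<Phi>_int: "integrable cauchy_law (\<lambda>s. k s *\<^sub>R \<Phi> s)"
    using k\<Phi>_bd k_cont \<Phi>_cont
    by (intro cauchy_law.integrable_const_bound[where B="2 * (M * y)"])
       (auto intro!: borel_measurable_continuous_onI continuous_intros simp: measurable_cong_sets[OF sets_cauchy_law refl])
  have g_integrable: "integrable cauchy_law (\<lambda>s. of_real y * g (of_real s))"
    using gb g_cont M y
    by (intro integrable_mult_right cauchy_law.integrable_const_bound[where B=M])
       (auto intro!: borel_measurable_continuous_onI simp: measurable_cong_sets[OF sets_cauchy_law refl])
  have f_int: "integrable cauchy_law f"
    unfolding f_def by (intro Bochner_Integration.integrable_diff g_integrable k\<Phi>_int)
  have pf_int: "integrable lborel (\<lambda>s. p s *\<^sub>R f s)"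
    using f_int unfolding p_def by (simp only: integrable_cauchy_law_iff[OF f_meas])
  have pf_cont: "continuous_on UNIV (\<lambda>s. p s *\<^sub>R f s)"
    unfolding p_def using pos by (intro continuous_intros f_cont) (auto simp: less_imp_neq[THEN not_sym])
  have ftc: "integral {-real n..real n} (\<lambda>s. p s *\<^sub>R f s) = p (real n) *\<^sub>R \<Phi> (real n) - p (- real n) *\<^sub>R \<Phi> (- real n)" for n
  proof (rule integral_unique, rule fundamental_theorem_of_calculus)
    fix s :: real
    have "((\<lambda>s. p s *\<^sub>R \<Phi> s) has_vector_derivative p s *\<^sub>R (of_real y * g (of_real s)) + (- (p s * k s)) *\<^sub>R \<Phi> s) (at s)"
      by (rule has_vector_derivative_scaleR[OF p_deriv \<Phi>_deriv])
    also have "p s *\<^sub>R (of_real y * g (of_real s)) + (- (p s * k s)) *\<^sub>R \<Phi> s = p s *\<^sub>R f s"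
      by (simp add: f_def scaleR_diff_right)
    finally show "((\<lambda>s. p s *\<^sub>R \<Phi> s) has_vector_derivative p s *\<^sub>R f s) (at s within {-real n..real n})"
      by (rule has_vector_derivative_at_within)
  qed simp
  have pn: "norm (p s *\<^sub>R \<Phi> s) \<le> M * y * (\<bar>s\<bar> / (pi * (1 + s\<^sup>2)))" for s
  proof -
    have "norm (p s *\<^sub>R \<Phi> s) \<le> \<bar>p s\<bar> * ((M * y) * \<bar>s\<bar>)"
      unfolding norm_scaleR by (intro mult_left_mono \<Phi>_bd) auto
    also have "\<bar>p s\<bar> = 1 / (pi * (1 + s\<^sup>2))" using pos[of s] by (simp add: p_def)
    finally show ?thesis by simp
  qed
  have lim: "(\<lambda>n. M * y * (real n / (pi * (1 + (real n)\<^sup>2)))) \<longlonglongrightarrow> 0"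
  proof -
    have "(\<lambda>n. real n / (pi * (1 + (real n)\<^sup>2))) \<longlonglongrightarrow> 0" by real_asymp
    from tendsto_mult_right_zero[OF this] show ?thesis .
  qed
  have "(\<lambda>n. p (real n) *\<^sub>R \<Phi> (real n)) \<longlonglongrightarrow> 0"
    by (rule Lim_null_comparison[OF _ lim], rule always_eventually) (use pn[of "real _"] in auto)
  moreover have "(\<lambda>n. p (- real n) *\<^sub>R \<Phi> (- real n)) \<longlonglongrightarrow> 0"
    by (rule Lim_null_comparison[OF _ lim], rule always_eventually) (use pn[of "- real _"] in auto)
  ultimately have "(\<lambda>n. integral {-real n..real n} (\<lambda>s. p s *\<^sub>R f s)) \<longlonglongrightarrow> 0 - 0"
    unfolding ftc by (rule tendsto_diff)
  from LIMSEQ_unique[OF integral_eq_limit_truncated[OF pf_int pf_cont] this]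
  have "(\<integral>s. p s *\<^sub>R f s \<partial>lborel) = 0" by simp
  then have "(\<integral>s. f s \<partial>cauchy_law) = 0"
    unfolding p_def by (simp only: integral_cauchy_law[OF f_meas])
  then have "(\<integral>s. of_real y * g (of_real s) \<partial>cauchy_law) = (\<integral>s. k s *\<^sub>R \<Phi> s \<partial>cauchy_law)"
    unfolding f_def by (subst (asm) Bochner_Integration.integral_diff[OF g_integrable k\<Phi>_int]) simp
  then have "of_real y * h (Complex x (y + e)) = (\<integral>s. k s *\<^sub>R \<Phi> s \<partial>cauchy_law)"
    unfolding g_int[symmetric] by simp
  then have "h (Complex x (y + e)) = (\<integral>s. k s *\<^sub>R \<Phi> s \<partial>cauchy_law) / of_real y"
    using y by (simp add: field_simps)
  also have "\<dots> = (\<integral>s. (k s *\<^sub>R \<Phi> s) / of_real y \<partial>cauchy_law)" by simp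
  also have "\<dots> = (\<integral>s. k s *\<^sub>R (\<Phi> s / of_real y) \<partial>cauchy_law)"
    by (rule Bochner_Integration.integral_cong) (auto simp: scaleR_conv_of_real)
  finally show ?thesis unfolding k_def \<Phi>_def .
qed

text \<open>A primitive of a bounded function is Lipschitz and so has boundary values at every
  point, whereas those of \<open>h\<close> are still to be found: letting \<open>e\<close> tend to 0
  expresses \<open>h\<close> through the former alone.\<close>

lemma poisson_primitive:
  fixes h H :: "complex \<Rightarrow> complex"
  assumes holo: "h holomorphic_on upper_half_plane"
    and H: "\<And>z. Im z > 0 \<Longrightarrow> (H has_field_derivative h z) (at z)"
    and bd: "\<And>z. Im z > 0 \<Longrightarrow> norm (h z) \<le> M"
    and H0: "\<And>x e. e > 0 \<Longrightarrow> norm (H (Complex x e) - H0 x) \<le> M * e"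
    and y: "y > 0"
  shows "h (Complex x y) =
    (\<integral>s. (2 * s / (1 + s\<^sup>2)) *\<^sub>R ((H0 (x + y * s) - H0 x) / of_real y) \<partial>cauchy_law)"
proof -
  have M: "M \<ge> 0" using order_trans[OF norm_ge_zero bd[of \<i>]] by simp
  define e where "e n = inverse (real (Suc n))" for n
  have e: "e n > 0" for n by (simp add: e_def)
  have e0: "e \<longlonglongrightarrow> 0" unfolding e_def by (rule LIMSEQ_inverse_real_of_nat)
  have HL: "(\<lambda>n. H (Complex t (e n))) \<longlonglongrightarrow> H0 t" for t
  proof (rule LIM_zero_cancel, rule Lim_null_comparison)
    show "(\<lambda>n. M * e n) \<longlonglongrightarrow> 0" using tendsto_mult_right_zero[OF e0] .
  qed (use H0[OF e] in simp)
  have Hc: "continuous_on upper_half_plane H"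
    by (rule continuous_at_imp_continuous_on, rule ballI, rule DERIV_isCont, rule H) simp
  let ?f = "\<lambda>n s. (2 * s / (1 + s\<^sup>2)) *\<^sub>R ((H (Complex (x + y * s) (e n)) - H (Complex x (e n))) / of_real y)"
  let ?g = "\<lambda>s. (2 * s / (1 + s\<^sup>2)) *\<^sub>R ((H0 (x + y * s) - H0 x) / of_real y)"
  have meas: "?f n \<in> borel_measurable cauchy_law" for n
  proof -
    have "continuous_on UNIV (\<lambda>s. H (Complex (x + y * s) (e n)))"
      by (rule continuous_on_compose2[OF Hc]) (use e in \<open>auto simp: Complex_eq intro!: continuous_intros\<close>)
    then have "(\<lambda>s. H (Complex (x + y * s) (e n))) \<in> borel_measurable borel"
      by (rule borel_measurable_continuous_onI)
    then show ?thesis unfolding measurable_cong_sets[OF sets_cauchy_law refl] by measurable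
  qed
  have bound: "norm (?f n s) \<le> 2 * M" for n s
  proof (rule norm_weight_le[OF _ M])
    have "norm (H (Complex (x + y * s) (e n)) - H (Complex x (e n))) \<le> M * norm (Complex (x + y * s) (e n) - Complex x (e n))"
      using e by (intro lipschitz_primitive[OF H bd]) auto
    also have "Complex (x + y * s) (e n) - Complex x (e n) = of_real (y * s)" by (simp add: complex_eq_iff)
    finally show "norm ((H (Complex (x + y * s) (e n)) - H (Complex x (e n))) / of_real y) \<le> M * \<bar>s\<bar>"
      using y by (simp add: norm_divide abs_mult divide_simps mult_ac norm_mult)
  qed
  have lim: "(\<lambda>n. ?f n s) \<longlonglongrightarrow> ?g s" for s
    by (intro tendsto_intros HL) (use y in simp)
  have "?g \<in> borel_measurable cauchy_law"
    by (rule borel_measurable_LIMSEQ_metric[OF meas lim])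
  then have "(\<lambda>n. \<integral>s. ?f n s \<partial>cauchy_law) \<longlonglongrightarrow> (\<integral>s. ?g s \<partial>cauchy_law)"
    by (rule integral_dominated_convergence[where w="\<lambda>_. 2 * M"])
       (rule meas, simp, rule AE_I2, rule lim, rule AE_I2, rule bound)
  moreover have "(\<integral>s. ?f n s \<partial>cauchy_law) = h (Complex x (y + e n))" for n
    by (rule poisson_primitive_shifted[OF holo H bd y e, symmetric])
  ultimately have "(\<lambda>n. h (Complex x (y + e n))) \<longlonglongrightarrow> (\<integral>s. ?g s \<partial>cauchy_law)"
    by (simp only:)
  moreover have "(\<lambda>n. h (Complex x (y + e n))) \<longlonglongrightarrow> h (Complex x y)"
  proof (rule isCont_tendsto_compose[where g=h])
    show "isCont h (Complex x y)"
      using holomorphic_on_imp_continuous_on[OF holo] y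
      by (subst (asm) continuous_on_eq_continuous_at) (auto simp: open_halfspace_Im_gt)
    show "(\<lambda>n. Complex x (y + e n)) \<longlonglongrightarrow> Complex x y"
      using tendsto_Complex[OF tendsto_const tendsto_add[OF tendsto_const e0], of x y] by simp
  qed
  ultimately show ?thesis by (rule LIMSEQ_unique[rotated])
qed

text \<open>The case \<open>h = 1\<close>, \<open>H z = z\<close> of the preceding formula. It is
  the normalisation by which the weight turns a difference quotient into a derivative.\<close>

lemma integral_weight: "(\<integral>s. (2 * s / (1 + s\<^sup>2)) * s \<partial>cauchy_law) = 1"
proof -
  have "(1::complex) = (\<integral>s. (2 * s / (1 + s\<^sup>2)) *\<^sub>R ((of_real (0 + 1 * s) - of_real 0) / of_real 1) \<partial>cauchy_law)"
    by (rule poisson_primitive[of "\<lambda>_. 1" "\<lambda>z. z" 1])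
       (auto intro!: derivative_eq_intros simp: cmod_def)
  also have "\<dots> = (\<integral>s. of_real ((2 * s / (1 + s\<^sup>2)) * s) \<partial>cauchy_law)"
    by (rule Bochner_Integration.integral_cong) (auto simp: scaleR_conv_of_real)
  also have "\<dots> = of_real (\<integral>s. (2 * s / (1 + s\<^sup>2)) * s \<partial>cauchy_law)"
    by (rule integral_complex_of_real)
  finally show ?thesis by (simp add: complex_eq_iff)
qed

lemma boundary_primitive_exists:
  fixes H :: "complex \<Rightarrow> complex"
  assumes lip: "\<And>z w. Im z > 0 \<Longrightarrow> Im w > 0 \<Longrightarrow> norm (H z - H w) \<le> M * norm (z - w)"
  obtains H0 where "\<And>x e. e > 0 \<Longrightarrow> norm (H (Complex x e) - H0 x) \<le> M * e"
    "\<And>x y. norm (H0 x - H0 y) \<le> M * \<bar>x - y\<bar>"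
proof -
  define e where "e n = inverse (real (Suc n))" for n
  have e: "e n > 0" for n by (simp add: e_def)
  have e0: "e \<longlonglongrightarrow> 0" unfolding e_def by (rule LIMSEQ_inverse_real_of_nat)
  have M: "M \<ge> 0"
    using order_trans[OF norm_ge_zero lip[of "2 * \<i>" \<i>]] by (simp add: norm_mult)
  have lipC: "norm (H (Complex x a) - H (Complex x b)) \<le> M * \<bar>a - b\<bar>" if "a > 0" "b > 0" for x a b
    using lip[of "Complex x a" "Complex x b"] that by (simp add: complex_norm minus_complex.code)
  have "Cauchy (\<lambda>n. H (Complex x (e n)))" for x
  proof (rule metric_CauchyI)
    fix r :: real assume r: "r > 0"
    have "Cauchy e" using e0 by (rule LIMSEQ_imp_Cauchy)
    then obtain N where N: "\<And>m n. m \<ge> N \<Longrightarrow> n \<ge> N \<Longrightarrow> dist (e m) (e n) < r / (M + 1)"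
      using metric_CauchyD[of e "r / (M + 1)"] r M by auto
    have "dist (H (Complex x (e m))) (H (Complex x (e n))) < r" if "m \<ge> N" "n \<ge> N" for m n
    proof -
      have "dist (H (Complex x (e m))) (H (Complex x (e n))) \<le> M * \<bar>e m - e n\<bar>"
        unfolding dist_norm by (intro lipC e)
      also have "\<dots> \<le> (M + 1) * \<bar>e m - e n\<bar>" by (intro mult_right_mono) auto
      also have "\<dots> < (M + 1) * (r / (M + 1))"
        using N[OF that] M by (intro mult_strict_left_mono) (auto simp: dist_real_def)
      finally show ?thesis using M by simp
    qed
    then show "\<exists>N. \<forall>m\<ge>N. \<forall>n\<ge>N. dist (H (Complex x (e m))) (H (Complex x (e n))) < r" by blast
  qed
  then have "\<forall>x. \<exists>l. (\<lambda>n. H (Complex x (e n))) \<longlonglongrightarrow> l"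
    by (auto simp: convergent_eq_Cauchy[symmetric] convergent_def)
  then obtain H0 where L: "\<And>x. (\<lambda>n. H (Complex x (e n))) \<longlonglongrightarrow> H0 x" by metis
  show ?thesis
  proof
    fix x a :: real assume a: "a > 0"
    have l1: "(\<lambda>n. norm (H (Complex x a) - H (Complex x (e n)))) \<longlonglongrightarrow> norm (H (Complex x a) - H0 x)"
      by (intro tendsto_intros L)
    have l2: "(\<lambda>n. M * \<bar>a - e n\<bar>) \<longlonglongrightarrow> M * \<bar>a - 0\<bar>" by (intro tendsto_intros e0)
    have "norm (H (Complex x a) - H0 x) \<le> M * \<bar>a - 0\<bar>"
      by (rule LIMSEQ_le[OF l1 l2]) (use lipC[OF a e] in auto)
    then show "norm (H (Complex x a) - H0 x) \<le> M * a" using a by simp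
  next
    fix x y :: real
    have l1: "(\<lambda>n. norm (H (Complex x (e n)) - H (Complex y (e n)))) \<longlonglongrightarrow> norm (H0 x - H0 y)"
      by (intro tendsto_intros L)
    have "norm (H (Complex x (e n)) - H (Complex y (e n))) \<le> M * \<bar>x - y\<bar>" for n
      using lip[of "Complex x (e n)" "Complex y (e n)"] e by (simp add: complex_norm minus_complex.code)
    then show "norm (H0 x - H0 y) \<le> M * \<bar>x - y\<bar>"
      by (intro LIMSEQ_le_const2[OF l1]) auto
  qed
qed

text \<open>Adding \<open>M * x\<close> makes \<open>f\<close> increasing with Lipschitz constant
  \<open>2 * M\<close>.\<close>

lemma lipschitz_differentiable_AE:
  fixes f :: "real \<Rightarrow> real"
  assumes lip: "\<And>x y. \<bar>f x - f y\<bar> \<le> M * \<bar>x - y\<bar>"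
  shows "AE x in lborel. \<exists>D. (f has_real_derivative D) (at x)"
proof -
  have b: "- (M * (y - x)) \<le> f y - f x \<and> f y - f x \<le> M * (y - x)" if "x \<le> y" for x y
    using lip[of y x] that by (auto simp: abs_le_iff)
  have "AE x in lborel. \<exists>D. ((\<lambda>x. f x + M * x) has_real_derivative D) (at x)"
  proof (rule mono_lipschitz_differentiable_AE[where L="2 * M"])
    show "f x + M * x \<le> f y + M * y" if "x \<le> y" for x y using b[OF that] by (simp add: algebra_simps)
    show "f y + M * y - (f x + M * x) \<le> 2 * M * (y - x)" if "x \<le> y" for x y using b[OF that] by (simp add: algebra_simps)
  qed
  then show ?thesis
  proof eventually_elim
    case (elim x)
    then obtain D where "((\<lambda>x. f x + M * x) has_real_derivative D) (at x)" by blast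
    then have "((\<lambda>x. (f x + M * x) - M * x) has_real_derivative D - M) (at x)"
      by (rule DERIV_diff) (auto intro!: derivative_eq_intros)
    then show ?case by auto
  qed
qed

text \<open>Fatou's theorem: where the boundary values of a primitive are differentiable, the Poisson
  kernel differentiates them.\<close>

theorem fatou_bounded:
  fixes h :: "complex \<Rightarrow> complex"
  assumes holo: "h holomorphic_on upper_half_plane" and bd: "\<And>z. Im z > 0 \<Longrightarrow> norm (h z) \<le> M"
  shows "AE x in lborel. \<exists>l. ((\<lambda>y. h (Complex x y)) \<longlongrightarrow> l) (at_right 0)"
proof -
  have M: "M \<ge> 0" using order_trans[OF norm_ge_zero bd[of \<i>]] by simp
  have op: "open upper_half_plane" by (rule open_halfspace_Im_gt)
  obtain H where "\<And>z. z \<in> upper_half_plane \<Longrightarrow> (H has_field_derivative h z) (at z within upper_half_plane)"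
    using holomorphic_convex_primitive[of upper_half_plane "{}" h] holo op
    by (auto simp: convex_halfspace_Im_gt holomorphic_on_imp_continuous_on interior_open holomorphic_on_open
      field_differentiable_def)
  then have H: "(H has_field_derivative h z) (at z)" if "Im z > 0" for z
    using \<open>\<And>z. z \<in> upper_half_plane \<Longrightarrow> _\<close>[of z] that op at_within_open[of z upper_half_plane] by simp
  obtain H0 where H0: "\<And>x e. e > 0 \<Longrightarrow> norm (H (Complex x e) - H0 x) \<le> M * e"
    and lip: "\<And>x y. norm (H0 x - H0 y) \<le> M * \<bar>x - y\<bar>"
    using boundary_primitive_exists[OF lipschitz_primitive[OF H bd]] by blast
  have "AE x in lborel. \<exists>D. ((\<lambda>x. Re (H0 x)) has_real_derivative D) (at x)"
    by (rule lipschitz_differentiable_AE[where M=M])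
       (rule order_trans[OF _ lip], simp flip: minus_complex.sel add: abs_Re_le_cmod)
  moreover have "AE x in lborel. \<exists>D. ((\<lambda>x. Im (H0 x)) has_real_derivative D) (at x)"
    by (rule lipschitz_differentiable_AE[where M=M])
       (rule order_trans[OF _ lip], simp flip: minus_complex.sel add: abs_Im_le_cmod)
  ultimately show ?thesis
  proof eventually_elim
    case (elim x)
    then obtain a b where ab: "((\<lambda>x. Re (H0 x)) has_real_derivative a) (at x)" "((\<lambda>x. Im (H0 x)) has_real_derivative b) (at x)"
      by blast
    define D' where "D' = Complex a b"
    have Dq: "((\<lambda>y. (H0 y - H0 x) /\<^sub>R (y - x)) \<longlongrightarrow> D') (at x)"
      using ab unfolding tendsto_complex_iff D'_def has_field_derivative_iff
      by (simp add: divide_inverse mult.commute)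
    have "((\<lambda>y. h (Complex x y)) \<longlongrightarrow> D') (at_right 0)"
      unfolding tendsto_at_iff_sequentially o_def
    proof (intro allI impI)
      fix Y :: "nat \<Rightarrow> real" assume "\<forall>i. Y i \<in> {0<..} - {0}" and Y0: "Y \<longlonglongrightarrow> 0"
      then have Y: "Y i > 0" for i by auto
      let ?f = "\<lambda>n s. (2 * s / (1 + s\<^sup>2)) *\<^sub>R ((H0 (x + Y n * s) - H0 x) / of_real (Y n))"
      let ?g = "\<lambda>s. (2 * s / (1 + s\<^sup>2)) *\<^sub>R (s *\<^sub>R D')"
      have c0: "continuous_on UNIV H0"
        by (rule lipschitz_on_continuous_on[of M]) (use lip M in \<open>auto intro!: lipschitz_onI simp: dist_norm\<close>)
      have meas: "?f n \<in> borel_measurable cauchy_law" for n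
      proof -
        have "continuous_on UNIV (\<lambda>s. H0 (x + Y n * s))"
          by (rule continuous_on_compose2[OF c0]) (auto intro!: continuous_intros)
        then have "(\<lambda>s. H0 (x + Y n * s)) \<in> borel_measurable borel"
          by (rule borel_measurable_continuous_onI)
        then show ?thesis unfolding measurable_cong_sets[OF sets_cauchy_law refl] by measurable
      qed
      have bound: "norm (?f n s) \<le> 2 * M" for n s
      proof (rule norm_weight_le[OF _ M])
        have "norm (H0 (x + Y n * s) - H0 x) \<le> M * \<bar>Y n * s\<bar>"
          using lip[of "x + Y n * s" x] by simp
        then show "norm ((H0 (x + Y n * s) - H0 x) / of_real (Y n)) \<le> M * \<bar>s\<bar>"
          using Y[of n] by (simp add: norm_divide abs_mult divide_simps mult_ac)
      qed
      have lim: "(\<lambda>n. ?f n s) \<longlonglongrightarrow> ?g s" for s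
      proof (cases "s = 0")
        case False
        have "(\<lambda>n. x + Y n * s) \<longlonglongrightarrow> x + 0 * s" by (intro tendsto_intros Y0)
        moreover have "x + Y n * s \<noteq> x" for n using Y[of n] False by simp
        ultimately have "filterlim (\<lambda>n. x + Y n * s) (at x) sequentially"
          by (simp add: filterlim_at)
        from filterlim_compose[OF Dq this]
        have "(\<lambda>n. (H0 (x + Y n * s) - H0 x) /\<^sub>R (Y n * s)) \<longlonglongrightarrow> D'" by simp
        then have "(\<lambda>n. (2 * s / (1 + s\<^sup>2)) *\<^sub>R (s *\<^sub>R ((H0 (x + Y n * s) - H0 x) /\<^sub>R (Y n * s)))) \<longlonglongrightarrow> ?g s"
          by (intro tendsto_intros)
        moreover have "s *\<^sub>R ((H0 (x + Y n * s) - H0 x) /\<^sub>R (Y n * s)) = (H0 (x + Y n * s) - H0 x) / of_real (Y n)" for n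
          using Y[of n] False by (simp add: scaleR_conv_of_real divide_simps)
        ultimately show ?thesis by (simp only:)
      qed simp
      have "(\<lambda>n. \<integral>s. ?f n s \<partial>cauchy_law) \<longlonglongrightarrow> (\<integral>s. ?g s \<partial>cauchy_law)"
        by (rule integral_dominated_convergence[where w="\<lambda>_. 2 * M"])
           (rule borel_measurable_LIMSEQ_metric[OF meas lim], rule meas, simp, rule AE_I2, rule lim, rule AE_I2, rule bound)
      moreover have "(\<integral>s. ?f n s \<partial>cauchy_law) = h (Complex x (Y n))" for n
        by (rule poisson_primitive[OF holo H bd H0 Y, symmetric])
      moreover have "(\<integral>s. ?g s \<partial>cauchy_law) = D'"
      proof -
        have "(\<integral>s. ?g s \<partial>cauchy_law) = (\<integral>s. ((2 * s / (1 + s\<^sup>2)) * s) *\<^sub>R D' \<partial>cauchy_law)" by simp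
        also have "\<dots> = (\<integral>s. (2 * s / (1 + s\<^sup>2)) * s \<partial>cauchy_law) *\<^sub>R D'"
        proof (rule integral_scaleR_left)
          \<comment> \<open>A function that is not integrable has integral 0 by convention, but this
            one has integral 1.\<close>
          show "integrable cauchy_law (\<lambda>s. (2 * s / (1 + s\<^sup>2)) * s)"
            by (rule ccontr, drule not_integrable_integral_eq) (simp only: integral_weight one_neq_zero)
        qed
        finally show ?thesis by (simp only: integral_weight scaleR_one)
      qed
      ultimately show "(\<lambda>n. h (Complex x (Y n))) \<longlonglongrightarrow> D'" by simp
    qed
    then show ?case by blast
  qed
qed

text \<open>Poisson's formula holds exactly on each line above the axis; boundedness of
  \<open>h\<close> allows dominated convergence as the line descends.\<close>

lemma poisson_boundary_values:
  fixes h :: "complex \<Rightarrow> complex" and g :: "real \<Rightarrow> complex"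
  assumes holo: "h holomorphic_on upper_half_plane" and bd: "\<And>z. Im z > 0 \<Longrightarrow> norm (h z) \<le> M"
    and g: "AE x in lborel. ((\<lambda>y. h (Complex x y)) \<longlongrightarrow> g x) (at_right 0)"
    and [measurable]: "g \<in> borel_measurable borel" and z: "Im z > 0"
  shows "h z = (\<integral>s. g (Re z + Im z * s) \<partial>cauchy_law)"
proof -
  define e where "e n = inverse (real (Suc n))" for n
  have e: "e n > 0" for n by (simp add: e_def)
  have e0: "e \<longlonglongrightarrow> 0" unfolding e_def by (rule LIMSEQ_inverse_real_of_nat)
  have er: "filterlim e (at_right 0) sequentially"
    using e e0 by (intro tendsto_imp_filterlim_at_right) auto
  let ?f = "\<lambda>n s. h (Complex (Re z + Im z * s) (e n))"
  have cont: "continuous_on UNIV (?f n)" for n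
    by (rule continuous_on_compose2[OF holomorphic_on_imp_continuous_on[OF holo]])
       (use e in \<open>auto simp: Complex_eq intro!: continuous_intros\<close>)
  have pois: "(\<integral>s. ?f n s \<partial>cauchy_law) = h (z + \<i> * of_real (e n))" for n
  proof -
    define k where "k w = h (Complex (Re z) (e n) + of_real (Im z) * w)" for w
    have dom: "Im (Complex (Re z) (e n) + of_real (Im z) * w) > 0 \<longleftrightarrow> Im w > - (e n / Im z)" for w
      using z by (auto simp: field_simps)
    have kh: "k holomorphic_on {w. Im w > - (e n / Im z)}"
      unfolding k_def
      by (rule holomorphic_on_compose_gen[OF _ holo, unfolded o_def])
         (use dom in \<open>auto intro!: holomorphic_intros\<close>)
    have "(\<integral>s. k (of_real s) \<partial>cauchy_law) = k \<i>"
    proof (rule poisson_formula_ii[OF _ kh])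
      show "norm (k w) \<le> M" if "Im w \<ge> 0" for w
        unfolding k_def using z e[of n] that by (intro bd) (simp add: add_pos_nonneg)
    qed (use z e[of n] in auto)
    also have "k \<i> = h (z + \<i> * of_real (e n))"
      unfolding k_def by (rule arg_cong[where f=h]) (simp add: complex_eq_iff)
    finally show ?thesis by (simp add: k_def Complex_eq_linear)
  qed
  have "(\<lambda>n. \<integral>s. ?f n s \<partial>cauchy_law) \<longlonglongrightarrow> (\<integral>s. g (Re z + Im z * s) \<partial>cauchy_law)"
  proof (rule integral_dominated_convergence[where w="\<lambda>_. M"])
    show "?f n \<in> borel_measurable cauchy_law" for n
      using cont[of n] by (auto simp: measurable_cong_sets[OF sets_cauchy_law refl] intro: borel_measurable_continuous_onI)
    have "AE s in lborel. ((\<lambda>y. h (Complex (Re z + Im z * s) y)) \<longlongrightarrow> g (Re z + Im z * s)) (at_right 0)"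
      by (rule AE_lborel_affine[OF g]) (use z in auto)
    then show "AE s in cauchy_law. (\<lambda>n. ?f n s) \<longlonglongrightarrow> g (Re z + Im z * s)"
      unfolding AE_cauchy_law by eventually_elim (rule filterlim_compose[OF _ er])
    show "AE s in cauchy_law. norm (?f n s) \<le> M" for n
      using e by (intro AE_I2 bd) auto
  qed auto
  moreover have "(\<lambda>n. h (z + \<i> * of_real (e n))) \<longlonglongrightarrow> h z"
  proof (rule isCont_tendsto_compose[where g=h])
    show "isCont h z"
      using holomorphic_on_imp_continuous_on[OF holo] z
      by (subst (asm) continuous_on_eq_continuous_at) (auto simp: open_halfspace_Im_gt)
    show "(\<lambda>n. z + \<i> * of_real (e n)) \<longlonglongrightarrow> z"
      using tendsto_add[OF tendsto_const tendsto_mult[OF tendsto_const tendsto_of_real[OF e0]], of z \<i>] by simp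
  qed
  ultimately show ?thesis unfolding pois by (rule LIMSEQ_unique[rotated])
qed

text \<open>The limit along one fixed sequence is Borel measurable for continuous \<open>h\<close>
  and agrees with the vertical limit wherever that exists.\<close>

definition boundary_value :: "(complex \<Rightarrow> complex) \<Rightarrow> real \<Rightarrow> complex" where
  "boundary_value h x = lim (\<lambda>n. h (Complex x (inverse (real (Suc n)))))"

lemma boundary_value_eqI:
  assumes "((\<lambda>y. h (Complex x y)) \<longlongrightarrow> l) (at_right 0)"
  shows "boundary_value h x = l"
proof -
  have "filterlim (\<lambda>n. inverse (real (Suc n))) (at_right 0) sequentially"
    using LIMSEQ_inverse_real_of_nat by (intro tendsto_imp_filterlim_at_right) auto
  from filterlim_compose[OF assms this] show ?thesis
    unfolding boundary_value_def by (rule limI)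
qed

lemma boundary_value_measurable:
  assumes "continuous_on upper_half_plane h"
  shows "boundary_value h \<in> borel_measurable borel"
  unfolding boundary_value_def
proof (rule borel_measurable_lim_metric)
  fix n
  have "continuous_on UNIV (\<lambda>x. h (Complex x (inverse (real (Suc n)))))"
    by (rule continuous_on_compose2[OF assms]) (auto simp: Complex_eq intro!: continuous_intros)
  then show "(\<lambda>x. h (Complex x (inverse (real (Suc n))))) \<in> borel_measurable borel"
    by (rule borel_measurable_continuous_onI)
qed

lemma fatou_boundary_value:
  assumes "h holomorphic_on upper_half_plane" "\<And>z. Im z > 0 \<Longrightarrow> norm (h z) \<le> M"
  shows "AE x in lborel. ((\<lambda>y. h (Complex x y)) \<longlongrightarrow> boundary_value h x) (at_right 0)"
proof -
  have "AE x in lborel. \<exists>l. ((\<lambda>y. h (Complex x y)) \<longlongrightarrow> l) (at_right 0)"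
    by (rule fatou_bounded[OF assms])
  then show ?thesis
  proof eventually_elim
    case (elim x)
    then show ?case using boundary_value_eqI by metis
  qed
qed

section \<open>Herglotz functions and value distribution\<close>

definition herglotz :: "(complex \<Rightarrow> complex) \<Rightarrow> bool" where
  "herglotz F \<longleftrightarrow> F holomorphic_on upper_half_plane \<and> (\<forall>z. Im z > 0 \<longrightarrow> Im (F z) > 0)"

lemma herglotz_nonzero:
  assumes "herglotz F" "Im z > 0" "L > 0"
  shows "F z + \<i> * of_real L \<noteq> 0"
proof -
  have "Im (F z + \<i> * of_real L) > 0" using assms by (simp add: herglotz_def add_pos_pos)
  then show ?thesis by (metis less_irrefl zero_complex.simps(2))
qed

text \<open>The function \<open>\<i> L / (F + \<i> L)\<close> is bounded by 1 and tends to 1 as \<open>L \<longlongrightarrow> \<infinity>\<close>, while its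
  boundary value is 0 wherever \<open>F\<close> has the boundary value \<open>\<infinity>\<close>; so the latter happens only on a
  null set.\<close>

theorem herglotz_boundary_value:
  assumes F: "herglotz F"
  shows "AE x in lborel. ((\<lambda>y. F (Complex x y)) \<longlongrightarrow> boundary_value F x) (at_right 0)"
proof -
  define h where "h L z = \<i> * of_real L / (F z + \<i> * of_real L)" for L :: real and z
  have holo: "h L holomorphic_on upper_half_plane" if "L > 0" for L
    unfolding h_def using F herglotz_nonzero[OF F _ that]
    by (intro holomorphic_intros) (auto simp: herglotz_def)
  have bd: "norm (h L z) \<le> 1" if "L > 0" "Im z > 0" for L z
  proof -
    have "L \<le> Im (F z + \<i> * of_real L)" using F that by (simp add: herglotz_def less_imp_le)
    also have "\<dots> \<le> norm (F z + \<i> * of_real L)" by (rule order_trans[OF abs_ge_self abs_Im_le_cmod])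
    finally show ?thesis
      using that herglotz_nonzero[OF F that(2,1)] by (simp add: h_def norm_divide norm_mult divide_simps)
  qed
  \<comment> \<open>All \<open>h L\<close> are Moebius functions of \<open>h 1\<close> that fix 0,
    so a zero boundary value of \<open>h 1\<close> forces one of \<open>h L\<close> for every
    \<open>L\<close>.\<close>
  have relL: "h L z = of_real L * h 1 z / (1 + of_real (L - 1) * h 1 z)" if "L > 0" "Im z > 0" for L z
  proof -
    have "1 + of_real (L - 1) * h 1 z = (F z + \<i> * of_real L) / (F z + \<i>)"
      using herglotz_nonzero[OF F that(2), of 1] by (simp add: h_def field_simps)
    then show ?thesis using herglotz_nonzero[OF F that(2), of 1]
      by (simp add: h_def)
  qed
  have lim: "AE x in lborel. ((\<lambda>y. h L (Complex x y)) \<longlongrightarrow> boundary_value (h L) x) (at_right 0)" if "L > 0" for L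
    by (rule fatou_boundary_value[OF holo bd]) (use that in auto)
  have [measurable]: "boundary_value (h L) \<in> borel_measurable borel" if "L > 0" for L
    by (intro boundary_value_measurable holomorphic_on_imp_continuous_on holo that)
  define E where "E = {x. boundary_value (h 1) x = 0}"
  have "boundary_value (h 1) \<in> borel_measurable borel" by simp
  then have E[measurable]: "E \<in> sets borel" unfolding E_def by measurable
  have pos: "\<forall>\<^sub>F y in at_right (0::real). 0 < y" by (rule eventually_at_right_less)
  \<comment> \<open>Poisson's formula at \<open>\<i>\<close>: the boundary values are at most 1 in
    modulus and vanish on \<open>E\<close>. As \<open>L\<close> grows the left-hand side tends to 1,
    so \<open>E\<close> is null.\<close>
  have bnd: "norm (h L \<i>) \<le> 1 - measure cauchy_law E" if L: "L > 0" for L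
  proof -
    have "AE x in lborel. norm (boundary_value (h L) x) \<le> indicator (- E) x"
      using lim[OF L] lim[of 1, simplified]
    proof eventually_elim
      case (elim x)
      show ?case
      proof (cases "x \<in> E")
        case True
        then have h1: "((\<lambda>y. h 1 (Complex x y)) \<longlongrightarrow> 0) (at_right 0)" using elim(2) by (simp add: E_def)
        have "((\<lambda>y. of_real L * h 1 (Complex x y) / (1 + of_real (L - 1) * h 1 (Complex x y))) \<longlongrightarrow>
            of_real L * 0 / (1 + of_real (L - 1) * 0)) (at_right 0)"
          by (intro tendsto_intros h1) auto
        moreover have "\<forall>\<^sub>F y in at_right 0. of_real L * h 1 (Complex x y) / (1 + of_real (L - 1) * h 1 (Complex x y)) = h L (Complex x y)"
          using pos by eventually_elim (rule relL[symmetric], use L in auto)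
        ultimately have "((\<lambda>y. h L (Complex x y)) \<longlongrightarrow> 0) (at_right 0)"
          by (simp add: filterlim_cong)
        then have "boundary_value (h L) x = 0" by (rule boundary_value_eqI)
        then show ?thesis by simp
      next
        case False
        have "norm (boundary_value (h L) x) \<le> 1"
          by (rule tendsto_upperbound[OF tendsto_norm[OF elim(1)]])
             (use pos in \<open>auto elim!: eventually_mono intro!: bd L\<close>)
        then show ?thesis using False by simp
      qed
    qed
    then have ae: "AE s in cauchy_law. norm (boundary_value (h L) s) \<le> indicator (- E) s"
      by (simp only: AE_cauchy_law)
    have "h L \<i> = (\<integral>s. boundary_value (h L) (Re \<i> + Im \<i> * s) \<partial>cauchy_law)"
      by (rule poisson_boundary_values[OF holo[OF L] bd[OF L] lim[OF L]]) (use L in measurable)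
    then have "h L \<i> = (\<integral>s. boundary_value (h L) s \<partial>cauchy_law)" by simp
    also have "norm \<dots> \<le> (\<integral>s. norm (boundary_value (h L) s) \<partial>cauchy_law)" by (rule integral_norm_bound)
    also have "\<dots> \<le> (\<integral>s. indicator (- E) s \<partial>cauchy_law)"
    proof (rule integral_mono_AE')
      show "integrable cauchy_law (indicat_real (- E))"
        by (rule cauchy_law.integrable_const_bound[where B=1]) auto
    qed (use ae in auto)
    also have "\<dots> = measure cauchy_law (- E)" by simp
    also have "\<dots> = 1 - measure cauchy_law E"
      using cauchy_law.prob_compl[of E] by (simp add: Compl_eq_Diff_UNIV)
    finally show ?thesis .
  qed
  have "(\<lambda>n. norm (h (real (Suc n)) \<i>)) \<longlonglongrightarrow> 1"
  proof -
    have "(\<lambda>n. \<i> / (F \<i> * of_real (inverse (real (Suc n))) + \<i>)) \<longlonglongrightarrow> \<i> / (F \<i> * of_real 0 + \<i>)"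
      by (intro tendsto_intros LIMSEQ_inverse_real_of_nat) auto
    moreover have "\<i> / (F \<i> * of_real (inverse (real (Suc n))) + \<i>) = h (real (Suc n)) \<i>" for n
    proof -
      define L where "L = real (Suc n)"
      have "L > 0" by (simp add: L_def)
      then have "F \<i> * of_real (inverse L) + \<i> = (F \<i> + \<i> * of_real L) / of_real L"
        by (simp add: field_simps)
      then show ?thesis unfolding L_def[symmetric] h_def by simp
    qed
    ultimately have "(\<lambda>n. h (real (Suc n)) \<i>) \<longlonglongrightarrow> 1" by simp
    from tendsto_norm[OF this] show ?thesis by simp
  qed
  then have "1 \<le> 1 - measure cauchy_law E"
    by (rule LIMSEQ_le_const2) (use bnd in auto)
  then have "measure cauchy_law E = 0" using measure_nonneg[of cauchy_law E] by linarith
  then have "emeasure cauchy_law E = 0" by (simp add: cauchy_law.emeasure_eq_measure)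
  then have "AE s in cauchy_law. s \<notin> E" by (intro AE_not_in null_setsI) auto
  then have "AE s in lborel. s \<notin> E" by (simp only: AE_cauchy_law)
  with lim[of 1, simplified] show ?thesis
  proof eventually_elim
    case (elim x)
    then have ne: "boundary_value (h 1) x \<noteq> 0" by (simp add: E_def)
    have "((\<lambda>y. \<i> / h 1 (Complex x y) - \<i>) \<longlongrightarrow> \<i> / boundary_value (h 1) x - \<i>) (at_right 0)"
      by (intro tendsto_intros elim(1) ne)
    moreover have "\<forall>\<^sub>F y in at_right 0. \<i> / h 1 (Complex x y) - \<i> = F (Complex x y)"
      using pos
    proof eventually_elim
      case (elim y)
      then show ?case using herglotz_nonzero[OF F, of "Complex x y" 1] by (simp add: h_def)
    qed
    ultimately have "((\<lambda>y. F (Complex x y)) \<longlongrightarrow> \<i> / boundary_value (h 1) x - \<i>) (at_right 0)"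
      by (simp add: filterlim_cong)
    then show ?case using boundary_value_eqI by metis
  qed
qed

text \<open>The angle subtended at \<open>w\<close> by \<open>S\<close>, divided by \<open>\<pi>\<close>, for real \<open>w\<close> as well.\<close>

definition harmonic_measure :: "complex \<Rightarrow> real set \<Rightarrow> real" where
  "harmonic_measure w S = measure cauchy_law {s. Re w + Im w * s \<in> S}"

text \<open>For nonnegative \<open>t\<close> the exponential is bounded in the upper half-plane, as
  Poisson's formula demands. For \<open>Im w = 0\<close> both sides are the characteristic function
  of a point mass.\<close>

lemma char_cauchy_affine:
  assumes w: "Im w \<ge> 0" and t: "t \<ge> 0"
  shows "(\<integral>s. iexp (t * (Re w + Im w * s)) \<partial>cauchy_law) = exp (\<i> * of_real t * w)"
proof -
  define h where "h z = exp (\<i> * of_real t * (of_real (Re w) + of_real (Im w) * z))" for z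
  have "(\<integral>s. h (of_real s) \<partial>cauchy_law) = h \<i>"
  proof (rule poisson_formula_ii[where e=1 and M=1])
    show "norm (h z) \<le> 1" if "Im z \<ge> 0" for z
      using w t that by (simp add: h_def)
    show "h holomorphic_on {z. - 1 < Im z}" unfolding h_def by (intro holomorphic_intros)
  qed simp
  also have "h \<i> = exp (\<i> * of_real t * w)"
    unfolding h_def by (rule arg_cong[where f=exp]) (simp add: complex_eq_iff)
  finally show ?thesis by (simp add: h_def mult.assoc)
qed

lemma char_cnj: "char M (- t) = cnj (char M t)"
proof -
  have "cnj (char M t) = (\<integral>x. cnj (iexp (t * x)) \<partial>M)"
    unfolding char_def by (simp only: Bochner_Integration.integral_cnj)
  also have "\<dots> = char M (- t)"
    unfolding char_def by (rule Bochner_Integration.integral_cong) (auto simp: exp_cnj)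
  finally show ?thesis ..
qed

text \<open>A characteristic function at \<open>- t\<close> is the conjugate of that at
  \<open>t\<close>, and Poisson's formula supplies nonnegative \<open>t\<close> only.\<close>

lemma real_distribution_eqI_char_nonneg:
  assumes "real_distribution M" "real_distribution N" "\<And>t. t \<ge> 0 \<Longrightarrow> char M t = char N t"
  shows "M = N"
proof (rule Levy_uniqueness[OF assms(1,2)], rule ext)
  fix t :: real
  show "char M t = char N t"
    using assms(3)[of t] assms(3)[of "- t"] char_cnj[of M "- t"] char_cnj[of N "- t"] by (cases "t \<ge> 0") auto
qed

lemma harmonic_measure_range: "0 \<le> harmonic_measure w S" "harmonic_measure w S \<le> 1"
  unfolding harmonic_measure_def by (simp_all add: cauchy_law.prob_le_1)

lemma harmonic_measure_eq_integral:
  assumes [measurable]: "S \<in> sets borel"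
  shows "harmonic_measure w S = (\<integral>s. indicator S (Re w + Im w * s) \<partial>cauchy_law)"
proof -
  have "(\<integral>s. indicat_real S (Re w + Im w * s) \<partial>cauchy_law) = (\<integral>s. indicat_real {s. Re w + Im w * s \<in> S} s \<partial>cauchy_law)"
    by (rule Bochner_Integration.integral_cong) (auto simp: indicator_def)
  then show ?thesis by (simp add: harmonic_measure_def)
qed

lemma harmonic_measure_measurable:
  assumes [measurable]: "S \<in> sets borel" "G \<in> borel_measurable M"
  shows "(\<lambda>x. harmonic_measure (G x) S) \<in> borel_measurable M"
proof -
  have "(\<lambda>x. \<integral>s. indicat_real S (Re (G x) + Im (G x) * s) \<partial>cauchy_law) \<in> borel_measurable M"
    by measurable
  then show ?thesis by (simp add: harmonic_measure_eq_integral)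
qed

text \<open>The value distribution identity: both sides are the laws of real random variables with the
  same characteristic function, by Poisson's formula for \<open>exp (\<i> t F)\<close>.\<close>

theorem harmonic_measure_herglotz:
  assumes F: "herglotz F" and [measurable]: "G \<in> borel_measurable borel" "S \<in> sets borel"
    and G: "\<And>x. Im (G x) \<ge> 0"
    and lim: "AE x in lborel. ((\<lambda>y. F (Complex x y)) \<longlongrightarrow> G x) (at_right 0)"
    and z: "Im z > 0"
  shows "harmonic_measure (F z) S = (\<integral>s. harmonic_measure (G (Re z + Im z * s)) S \<partial>cauchy_law)"
proof -
  interpret P: pair_prob_space cauchy_law cauchy_law ..
  let ?g = "\<lambda>s. G (Re z + Im z * s)"
  let ?\<phi> = "\<lambda>(s, r). Re (?g s) + Im (?g s) * r"
  define M1 where "M1 = distr (cauchy_law \<Otimes>\<^sub>M cauchy_law) borel ?\<phi>"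
  define M2 where "M2 = distr cauchy_law borel (\<lambda>r. Re (F z) + Im (F z) * r)"
  have [measurable]: "?\<phi> \<in> borel_measurable (cauchy_law \<Otimes>\<^sub>M cauchy_law)" by measurable
  have ImF: "Im (F z) > 0" using F z by (simp add: herglotz_def)
  have "M1 = M2"
  proof (rule real_distribution_eqI_char_nonneg)
    show "real_distribution M1" unfolding M1_def real_distribution_def real_distribution_axioms_def
      using P.prob_space_distr[of ?\<phi> borel] by simp
    show "real_distribution M2" unfolding M2_def real_distribution_def real_distribution_axioms_def
      using cauchy_law.prob_space_distr[of "\<lambda>r. Re (F z) + Im (F z) * r" borel] by simp
    fix t :: real assume t: "t \<ge> 0"
    have int: "integrable (cauchy_law \<Otimes>\<^sub>M cauchy_law) (\<lambda>p. iexp (t * ?\<phi> p))"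
      by (rule P.integrable_const_bound[where B=1]) (auto intro!: AE_I2)
    have "char M1 t = (\<integral>p. iexp (t * ?\<phi> p) \<partial>(cauchy_law \<Otimes>\<^sub>M cauchy_law))"
      unfolding char_def M1_def by (subst integral_distr) auto
    also have "\<dots> = (\<integral>s. \<integral>r. iexp (t * ?\<phi> (s, r)) \<partial>cauchy_law \<partial>cauchy_law)"
      by (rule P.integral_fst'[OF int, symmetric])
    also have "\<dots> = (\<integral>s. exp (\<i> * of_real t * ?g s) \<partial>cauchy_law)"
      by (rule Bochner_Integration.integral_cong[OF refl]) (simp only: prod.case char_cauchy_affine[OF G t])
    also have "\<dots> = exp (\<i> * of_real t * F z)"
    proof (rule poisson_boundary_values[symmetric, where h="\<lambda>z. exp (\<i> * of_real t * F z)" and g="\<lambda>x. exp (\<i> * of_real t * G x)" and M=1])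
      show "(\<lambda>z. exp (\<i> * of_real t * F z)) holomorphic_on upper_half_plane"
        using F by (intro holomorphic_intros) (auto simp: herglotz_def)
      show "norm (exp (\<i> * of_real t * F w)) \<le> 1" if "Im w > 0" for w
        using F t that by (simp add: herglotz_def less_imp_le)
      show "AE x in lborel. ((\<lambda>y. exp (\<i> * of_real t * F (Complex x y))) \<longlongrightarrow> exp (\<i> * of_real t * G x)) (at_right 0)"
        using lim by eventually_elim (intro tendsto_intros)
    qed (use z in measurable)
    also have "\<dots> = (\<integral>s. iexp (t * (Re (F z) + Im (F z) * s)) \<partial>cauchy_law)"
      by (rule char_cauchy_affine[symmetric]) (use ImF t in auto)
    also have "\<dots> = char M2 t"
      unfolding char_def M2_def by (subst integral_distr) auto
    finally show "char M1 t = char M2 t" .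
  qed
  have int: "integrable (cauchy_law \<Otimes>\<^sub>M cauchy_law) (\<lambda>p. indicator S (?\<phi> p) :: real)"
    by (rule P.integrable_const_bound[where B=1]) (auto intro!: AE_I2)
  have "harmonic_measure (F z) S = measure M2 S"
    unfolding harmonic_measure_def M2_def by (subst measure_distr) (auto simp: vimage_def)
  also have "\<dots> = measure M1 S" by (simp only: \<open>M1 = M2\<close>)
  also have "\<dots> = (\<integral>x. indicator S x \<partial>M1)" by (simp add: M1_def)
  also have "\<dots> = (\<integral>p. indicator S (?\<phi> p) \<partial>(cauchy_law \<Otimes>\<^sub>M cauchy_law))"
    unfolding M1_def by (subst integral_distr) auto
  also have "\<dots> = (\<integral>s. \<integral>r. indicator S (?\<phi> (s, r)) \<partial>cauchy_law \<partial>cauchy_law)"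
    by (rule P.integral_fst'[OF int, symmetric])
  also have "\<dots> = (\<integral>s. harmonic_measure (?g s) S \<partial>cauchy_law)"
    by (simp add: harmonic_measure_eq_integral)
  finally show ?thesis .
qed

section \<open>Continuity of translations in L^1 and averages over a set\<close>

definition translation_diff :: "real set \<Rightarrow> real \<Rightarrow> real" where
  "translation_diff A t = (\<integral>x. \<bar>indicat_real A (x + t) - indicat_real A x\<bar> \<partial>lborel)"

context
  fixes A :: "real set"
  assumes A[measurable]: "A \<in> sets borel" and A_fin: "emeasure lborel A < \<infinity>"
begin

lemma integrable_indicator_translate: "integrable lborel (\<lambda>x. indicat_real A (x + t))"
  and integral_indicator_translate: "(\<integral>x. indicat_real A (x + t) \<partial>lborel) = measure lborel A"
proof -
  have i: "integrable lborel (indicat_real A)" using A_fin by simp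
  show "integrable lborel (\<lambda>x. indicat_real A (x + t))"
    using lborel_integrable_real_affine[OF i, of 1 t] by (simp add: add.commute)
  show "(\<integral>x. indicat_real A (x + t) \<partial>lborel) = measure lborel A"
    using lborel_integral_real_affine[of 1 "indicat_real A" t] by (simp add: add.commute)
qed

lemmas integrable_indicator_self = integrable_indicator_translate[of 0, simplified]

lemma translation_diff_integrable:
  "integrable lborel (\<lambda>x. \<bar>indicat_real A (x + t) - indicat_real A x\<bar>)"
  by (intro integrable_abs Bochner_Integration.integrable_diff integrable_indicator_translate integrable_indicator_self)

lemma translation_diff_bounds: "0 \<le> translation_diff A t" "translation_diff A t \<le> 2 * measure lborel A"
proof -
  show "0 \<le> translation_diff A t" unfolding translation_diff_def by simp
  have "translation_diff A t \<le> (\<integral>x. indicat_real A (x + t) + indicat_real A x \<partial>lborel)"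
    unfolding translation_diff_def
    by (intro integral_mono translation_diff_integrable Bochner_Integration.integrable_add
        integrable_indicator_translate integrable_indicator_self) (simp split: split_indicator)
  also have "\<dots> = 2 * measure lborel A"
    by (subst Bochner_Integration.integral_add[OF integrable_indicator_translate integrable_indicator_self])
       (simp add: integral_indicator_translate)
  finally show "translation_diff A t \<le> 2 * measure lborel A" .
qed

lemma translation_diff_measurable: "translation_diff A \<in> borel_measurable borel"
  unfolding translation_diff_def by measurable

end

text \<open>The signed difference of indicators has integral 0 by translation invariance, so its L^1
  norm is twice the integral of its negative part. That part lives on \<open>U\<close>, where
  openness makes it vanish eventually at each point and the indicator of \<open>U\<close> dominates
  it.\<close>

lemma translation_diff_open_tendsto_0:
  assumes U: "open U" "emeasure lborel U < \<infinity>" and t: "t \<longlonglongrightarrow> 0"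
  shows "(\<lambda>n. translation_diff U (t n)) \<longlonglongrightarrow> 0"
proof -
  have [measurable]: "U \<in> sets borel" using U by simp
  note I = integrable_indicator_translate[OF \<open>U \<in> sets borel\<close> U(2)] integrable_indicator_self[OF \<open>U \<in> sets borel\<close> U(2)]
  let ?p = "\<lambda>n x. max 0 (indicat_real U x - indicat_real U (x + t n))"
  have p_int: "integrable lborel (?p n)" for n
    by (intro integrable_max integrable_zero Bochner_Integration.integrable_diff I)
  have eq: "translation_diff U (t n) = 2 * (\<integral>x. ?p n x \<partial>lborel)" for n
  proof -
    have "translation_diff U (t n) = (\<integral>x. 2 * ?p n x + (indicat_real U (x + t n) - indicat_real U x) \<partial>lborel)"
      unfolding translation_diff_def by (rule Bochner_Integration.integral_cong) (auto simp: max_def)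
    also have "\<dots> = 2 * (\<integral>x. ?p n x \<partial>lborel) + (measure lborel U - measure lborel U)"
      using p_int[of n] I integral_indicator_translate[OF \<open>U \<in> sets borel\<close> U(2), of "t n"] by simp
    finally show ?thesis by simp
  qed
  have "(\<lambda>n. \<integral>x. ?p n x \<partial>lborel) \<longlonglongrightarrow> (\<integral>x. 0 \<partial>(lborel :: real measure))"
  proof (rule integral_dominated_convergence[where w="indicat_real U"])
    show "AE x in lborel. (\<lambda>n. ?p n x) \<longlonglongrightarrow> 0"
    proof (rule AE_I2)
      fix x
      show "(\<lambda>n. ?p n x) \<longlonglongrightarrow> 0"
      proof (cases "x \<in> U")
        case True
        have "(\<lambda>n. x + t n) \<longlonglongrightarrow> x" using tendsto_add[OF tendsto_const t, of x] by simp
        from topological_tendstoD[OF this U(1) True]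
        have "\<forall>\<^sub>F n in sequentially. ?p n x = 0" by eventually_elim simp
        then show ?thesis by (rule tendsto_eventually)
      next
        case False
        then have "?p n x = 0" for n by (simp split: split_indicator)
        then show ?thesis by simp
      qed
    qed
    show "AE x in lborel. norm (?p n x) \<le> indicat_real U x" for n
      by (rule AE_I2) (simp split: split_indicator)
  qed (use I in \<open>auto\<close>)
  then have "(\<lambda>n. \<integral>x. ?p n x \<partial>lborel) \<longlonglongrightarrow> 0" by simp
  from tendsto_mult_right_zero[OF this] show ?thesis unfolding eq .
qed

text \<open>Outer regularity: an open \<open>U\<close> containing \<open>A\<close> with
  \<open>U - A\<close> of measure below \<open>r / 4\<close> changes the modulus by at most
  \<open>r / 2\<close>, since the excess is counted at \<open>x\<close> and at
  \<open>x + s\<close>.\<close>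

lemma translation_diff_tendsto_0:
  assumes A[measurable]: "A \<in> sets borel" and A_fin: "emeasure lborel A < \<infinity>" and t: "t \<longlonglongrightarrow> 0"
  shows "(\<lambda>n. translation_diff A (t n)) \<longlonglongrightarrow> 0"
proof (rule LIMSEQ_I)
  fix r :: real assume r: "r > 0"
  have "A \<in> sets lebesgue" using A by simp
  then obtain U where U: "open U" "A \<subseteq> U" "U - A \<in> lmeasurable" "emeasure lebesgue (U - A) < ennreal (r / 4)"
    using sets_lebesgue_outer_open[of A "r / 4"] r by auto
  have [measurable]: "U \<in> sets borel" using U by simp
  have B: "U - A \<in> sets borel" by measurable
  have eB: "emeasure lborel (U - A) < ennreal (r / 4)" using U(4) by simp
  then have B_fin: "emeasure lborel (U - A) < \<infinity>" by (metis ennreal_less_top infinity_ennreal_def less_trans)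
  have mB: "measure lborel (U - A) < r / 4"
    using eB B_fin r by (simp add: emeasure_eq_ennreal_measure ennreal_less_iff)
  have "U = A \<union> (U - A)" using U(2) by blast
  then have "emeasure lborel U = emeasure lborel (A \<union> (U - A))" by simp
  also have "\<dots> \<le> emeasure lborel A + emeasure lborel (U - A)" by (rule emeasure_subadditive) (use A B in auto)
  also have "\<dots> < \<infinity>" using A_fin B_fin by (simp add: ennreal_add_less_top)
  finally have U_fin: "emeasure lborel U < \<infinity>" .
  have le: "translation_diff A s \<le> translation_diff U s + r / 2" for s
  proof -
    let ?f = "\<lambda>x. \<bar>indicat_real U (x + s) - indicat_real U x\<bar> + (indicat_real (U - A) (x + s) + indicat_real (U - A) x)"
    have "translation_diff A s \<le> (\<integral>x. ?f x \<partial>lborel)"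
      unfolding translation_diff_def
    proof (intro integral_mono Bochner_Integration.integrable_add translation_diff_integrable
        integrable_indicator_translate integrable_indicator_self A A_fin B B_fin U_fin)
      show "\<bar>indicat_real A (x + s) - indicat_real A x\<bar> \<le> ?f x" for x
        using U(2) by (auto split: split_indicator)
    qed simp
    also have "\<dots> = translation_diff U s + (measure lborel (U - A) + measure lborel (U - A))"
      unfolding translation_diff_def
      using translation_diff_integrable[OF \<open>U \<in> sets borel\<close> U_fin, of s] integrable_indicator_translate[OF B B_fin, of s]
        integrable_indicator_self[OF B B_fin] integral_indicator_translate[OF B B_fin, of s] by simp
    finally show ?thesis using mB by simp
  qed
  from LIMSEQ_D[OF translation_diff_open_tendsto_0[OF U(1) U_fin t], of "r / 2"] r
  obtain N where "\<forall>n\<ge>N. norm (translation_diff U (t n) - 0) < r / 2" by auto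
  then have "norm (translation_diff A (t n) - 0) < r" if "n \<ge> N" for n
    using le[of "t n"] that translation_diff_bounds(1)[OF A A_fin, of "t n"]
      translation_diff_bounds(1)[OF \<open>U \<in> sets borel\<close> U_fin, of "t n"] by force
  then show "\<exists>N. \<forall>n\<ge>N. norm (translation_diff A (t n) - 0) < r" by blast
qed

text \<open>Fubini and a translation in \<open>x\<close> move the shift from \<open>\<phi>\<close>
  to the indicator of \<open>A\<close>, so the error is governed by \<open>A\<close> alone, for
  every measurable \<open>\<phi>\<close> with values in [0, 1].\<close>

lemma poisson_average_diff:
  fixes \<phi> :: "real \<Rightarrow> real"
  assumes A[measurable]: "A \<in> sets borel" and A_fin: "emeasure lborel A < \<infinity>"
    and \<phi>[measurable]: "\<phi> \<in> borel_measurable borel" and r: "\<And>x. 0 \<le> \<phi> x" "\<And>x. \<phi> x \<le> 1"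
  shows "\<bar>(\<integral>x. indicator A x * (\<integral>s. \<phi> (x + d * s) \<partial>cauchy_law) \<partial>lborel) - (\<integral>x. indicator A x * \<phi> x \<partial>lborel)\<bar>
    \<le> (\<integral>s. translation_diff A (- d * s) \<partial>cauchy_law)"
proof -
  interpret P: pair_sigma_finite cauchy_law lborel ..
  have iA: "integrable lborel (indicat_real A)" using A_fin by simp
  have iAt: "integrable lborel (\<lambda>x. indicat_real A (x + t))" for t by (rule integrable_indicator_translate[OF A A_fin])
  have b: "norm (indicat_real B x * \<phi> y) \<le> norm (indicat_real B x)" for B :: "real set" and x y
    using r[of y] by (simp split: split_indicator)
  have i1: "integrable lborel (\<lambda>x. indicat_real A x * \<phi> (x + t))" for t
    by (rule Bochner_Integration.integrable_bound[OF iA]) (use b in auto)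
  have i2: "integrable lborel (\<lambda>x. indicat_real A (x + t) * \<phi> x)" for t
    by (rule Bochner_Integration.integrable_bound[OF iAt[of t]]) (use b in auto)
  have Ib: "\<bar>\<integral>x. indicat_real A x * \<phi> (x + t) \<partial>lborel\<bar> \<le> measure lborel A" for t
  proof -
    have "0 \<le> (\<integral>x. indicat_real A x * \<phi> (x + t) \<partial>lborel)" using r by (intro integral_nonneg_AE AE_I2) simp
    moreover have "(\<integral>x. indicat_real A x * \<phi> (x + t) \<partial>lborel) \<le> (\<integral>x. indicat_real A x \<partial>lborel)"
      using r by (intro integral_mono i1 iA) (simp split: split_indicator)
    ultimately show ?thesis by simp
  qed
  have int: "integrable (cauchy_law \<Otimes>\<^sub>M lborel) (\<lambda>(s, x). indicat_real A x * \<phi> (x + d * s))"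
  proof (rule P.Fubini_integrable)
    have "norm (indicat_real A x * \<phi> (x + d * s)) = indicat_real A x * \<phi> (x + d * s)" for s x
      using r[of "x + d * s"] by simp
    then have "integrable cauchy_law (\<lambda>s. \<integral>x. norm (indicat_real A x * \<phi> (x + d * s)) \<partial>lborel)"
      using Ib by (intro cauchy_law.integrable_const_bound[where B="measure lborel A"]) (auto intro!: AE_I2)
    then show "integrable cauchy_law (\<lambda>s. \<integral>x. norm ((\<lambda>(s, x). indicat_real A x * \<phi> (x + d * s)) (s, x)) \<partial>lborel)"
      by simp
  qed (use i1 in auto)
  have "(\<integral>x. indicator A x * (\<integral>s. \<phi> (x + d * s) \<partial>cauchy_law) \<partial>lborel)
      = (\<integral>x. \<integral>s. indicat_real A x * \<phi> (x + d * s) \<partial>cauchy_law \<partial>lborel)" by simp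
  also have "\<dots> = (\<integral>s. \<integral>x. indicat_real A x * \<phi> (x + d * s) \<partial>lborel \<partial>cauchy_law)"
    by (rule P.Fubini_integral[OF int])
  also have "\<dots> = (\<integral>s. \<integral>x. indicat_real A (x + - d * s) * \<phi> x \<partial>lborel \<partial>cauchy_law)"
  proof (rule Bochner_Integration.integral_cong[OF refl])
    fix s
    show "(\<integral>x. indicat_real A x * \<phi> (x + d * s) \<partial>lborel) = (\<integral>x. indicat_real A (x + - d * s) * \<phi> x \<partial>lborel)"
      using lborel_integral_real_affine[of 1 "\<lambda>x. indicat_real A x * \<phi> (x + d * s)" "- d * s"] by (simp add: add.commute)
  qed
  finally have 1: "(\<integral>x. indicator A x * (\<integral>s. \<phi> (x + d * s) \<partial>cauchy_law) \<partial>lborel)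
      = (\<integral>s. \<integral>x. indicat_real A (x + - d * s) * \<phi> x \<partial>lborel \<partial>cauchy_law)" .
  have 2: "(\<integral>x. indicator A x * \<phi> x \<partial>lborel) = (\<integral>s. \<integral>x. indicat_real A x * \<phi> x \<partial>lborel \<partial>cauchy_law)"
    using cauchy_law.prob_space by simp
  have j1: "integrable cauchy_law (\<lambda>s. \<integral>x. indicat_real A (x + - d * s) * \<phi> x \<partial>lborel)"
  proof (rule cauchy_law.integrable_const_bound[where B="measure lborel A"])
    have "\<bar>\<integral>x. indicat_real A (x + t) * \<phi> x \<partial>lborel\<bar> \<le> measure lborel A" for t
    proof -
      have "0 \<le> (\<integral>x. indicat_real A (x + t) * \<phi> x \<partial>lborel)" using r by (intro integral_nonneg_AE AE_I2) simp
      moreover have "(\<integral>x. indicat_real A (x + t) * \<phi> x \<partial>lborel) \<le> (\<integral>x. indicat_real A (x + t) \<partial>lborel)"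
        using r by (intro integral_mono i2 iAt) (simp split: split_indicator)
      ultimately show ?thesis using integral_indicator_translate[OF A A_fin, of t] by simp
    qed
    from this[of "- d * _"]
    show "AE s in cauchy_law. norm (\<integral>x. indicat_real A (x + - d * s) * \<phi> x \<partial>lborel) \<le> measure lborel A"
      unfolding real_norm_def by (intro AE_I2)
  qed measurable
  have [measurable]: "translation_diff A \<in> borel_measurable borel"
    by (rule translation_diff_measurable[OF A A_fin])
  have j2: "integrable cauchy_law (\<lambda>s. translation_diff A (- d * s))"
    by (rule cauchy_law.integrable_const_bound[where B="2 * measure lborel A"])
       (use translation_diff_bounds[OF A A_fin] in \<open>auto intro!: AE_I2\<close>)
  have "(\<integral>s. \<integral>x. indicat_real A (x + - d * s) * \<phi> x \<partial>lborel \<partial>cauchy_law)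
      - (\<integral>s. \<integral>x. indicat_real A x * \<phi> x \<partial>lborel \<partial>cauchy_law)
    = (\<integral>s. (\<integral>x. indicat_real A (x + - d * s) * \<phi> x \<partial>lborel) - (\<integral>x. indicat_real A x * \<phi> x \<partial>lborel) \<partial>cauchy_law)"
    by (rule Bochner_Integration.integral_diff[symmetric, OF j1 cauchy_law.integrable_const])
  also have "\<bar>\<dots>\<bar> \<le> (\<integral>s. \<bar>(\<integral>x. indicat_real A (x + - d * s) * \<phi> x \<partial>lborel) - (\<integral>x. indicat_real A x * \<phi> x \<partial>lborel)\<bar> \<partial>cauchy_law)"
    by (rule integral_abs_bound)
  also have "\<dots> \<le> (\<integral>s. translation_diff A (- d * s) \<partial>cauchy_law)"
  proof (intro integral_mono j2 integrable_abs Bochner_Integration.integrable_diff j1 cauchy_law.integrable_const)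
    fix s
    have "(\<integral>x. indicat_real A (x + - d * s) * \<phi> x \<partial>lborel) - (\<integral>x. indicat_real A x * \<phi> x \<partial>lborel)
        = (\<integral>x. indicat_real A (x + - d * s) * \<phi> x - indicat_real A x * \<phi> x \<partial>lborel)"
      by (rule Bochner_Integration.integral_diff[symmetric, OF i2 i2[of 0, simplified]])
    also have "\<bar>\<dots>\<bar> \<le> (\<integral>x. \<bar>indicat_real A (x + - d * s) * \<phi> x - indicat_real A x * \<phi> x\<bar> \<partial>lborel)"
      by (rule integral_abs_bound)
    also have "\<dots> \<le> translation_diff A (- d * s)"
      unfolding translation_diff_def
    proof (intro integral_mono integrable_abs Bochner_Integration.integrable_diff i2 i2[of 0, simplified] iAt iA)
      show "\<bar>indicat_real A (x + - d * s) * \<phi> x - indicat_real A x * \<phi> x\<bar> \<le> \<bar>indicat_real A (x + - d * s) - indicat_real A x\<bar>" for x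
        using r[of x] by (simp split: split_indicator)
    qed
    finally show "\<bar>(\<integral>x. indicat_real A (x + - d * s) * \<phi> x \<partial>lborel) - (\<integral>x. indicat_real A x * \<phi> x \<partial>lborel)\<bar>
      \<le> translation_diff A (- d * s)" .
  qed
  finally show ?thesis unfolding 1 2[symmetric] .
qed

section \<open>Harmonic measure as a Poisson integral and its continuity\<close>

lemma cmod_affine_minus: "(cmod (of_real (Re w + Im w * s) - w))\<^sup>2 = (Im w)\<^sup>2 * (1 + s\<^sup>2)"
proof -
  have "of_real (Re w + Im w * s) - w = of_real (Im w) * Complex s (-1)"
    by (simp add: complex_eq_iff)
  then show ?thesis
    by (simp add: norm_mult power_mult_distrib cmod_power2 add.commute)
qed

lemma harmonic_measure_density:
  assumes S[measurable]: "S \<in> sets borel" and w: "Im w > 0"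
  shows "harmonic_measure w S = (\<integral>t. indicat_real S t * (Im w / (cmod (of_real t - w))\<^sup>2 / pi) \<partial>lborel)"
proof -
  have n: "(cmod (of_real (Re w + Im w * s) - w))\<^sup>2 = (Im w)\<^sup>2 * (1 + s\<^sup>2)" for s
    by (rule cmod_affine_minus)
  have "(\<integral>t. indicat_real S t * (Im w / (cmod (of_real t - w))\<^sup>2 / pi) \<partial>lborel)
    = \<bar>Im w\<bar> *\<^sub>R (\<integral>s. indicat_real S (Re w + Im w * s) * (Im w / (cmod (of_real (Re w + Im w * s) - w))\<^sup>2 / pi) \<partial>lborel)"
    using w by (intro lborel_integral_real_affine) simp
  also have "\<dots> = (\<integral>s. \<bar>Im w\<bar> * (indicat_real S (Re w + Im w * s) * (Im w / (cmod (of_real (Re w + Im w * s) - w))\<^sup>2 / pi)) \<partial>lborel)"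
    by (simp only: integral_mult_right_zero real_scaleR_def)
  also have "\<dots> = (\<integral>s. (1 / (pi * (1 + s\<^sup>2))) *\<^sub>R indicat_real S (Re w + Im w * s) \<partial>lborel)"
  proof (rule Bochner_Integration.integral_cong[OF refl])
    fix s :: real
    have "1 + s\<^sup>2 > 0" by (simp add: add_pos_nonneg)
    then show "\<bar>Im w\<bar> * (indicat_real S (Re w + Im w * s) * (Im w / (cmod (of_real (Re w + Im w * s) - w))\<^sup>2 / pi))
      = (1 / (pi * (1 + s\<^sup>2))) *\<^sub>R indicat_real S (Re w + Im w * s)"
      using w unfolding n by (simp add: power2_eq_square[of "Im w"] mult.commute)
  qed
  also have "\<dots> = harmonic_measure w S"
    by (simp add: harmonic_measure_eq_integral integral_cauchy_law)
  finally show ?thesis ..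
qed

lemma angle_subtended_eq_harmonic_measure:
  assumes S[measurable]: "S \<in> sets borel" and w: "Im w \<ge> 0"
  shows "angle_subtended w S = pi * harmonic_measure w S"
proof (cases "Im w = 0")
  case True
  then have "harmonic_measure w S = indicator S (Re w)"
    using cauchy_law.prob_space by (simp add: harmonic_measure_eq_integral)
  then show ?thesis using True by (simp add: angle_subtended_def)
next
  case False
  then have w: "Im w > 0" using w by simp
  have "(LINT t:S|lebesgue. Im w / (cmod (of_real t - w))\<^sup>2) = (\<integral>t. indicat_real S t * (Im w / (cmod (of_real t - w))\<^sup>2) \<partial>lebesgue)"
    by (simp add: set_lebesgue_integral_def)
  also have "\<dots> = (\<integral>t. indicat_real S t * (Im w / (cmod (of_real t - w))\<^sup>2) \<partial>lborel)"
    by (rule integral_completion) measurable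
  also have "\<dots> = (\<integral>t. pi * (indicat_real S t * (Im w / (cmod (of_real t - w))\<^sup>2 / pi)) \<partial>lborel)"
    by (rule Bochner_Integration.integral_cong) auto
  also have "\<dots> = pi * (\<integral>t. indicat_real S t * (Im w / (cmod (of_real t - w))\<^sup>2 / pi) \<partial>lborel)"
    by (rule integral_mult_right_zero)
  also have "\<dots> = pi * harmonic_measure w S"
    by (simp only: harmonic_measure_density[OF S w])
  finally show ?thesis using False by (simp add: angle_subtended_def)
qed

text \<open>At a point inside the half-plane the Poisson kernel depends continuously on the point
  and stays, nearby, below an integrable multiple of the kernel at \<open>w\<close>.\<close>

lemma harmonic_measure_tendsto:
  assumes S[measurable]: "S \<in> sets borel" and w: "Im w > 0" and lim: "u \<longlonglongrightarrow> w"
  shows "(\<lambda>n. harmonic_measure (u n) S) \<longlonglongrightarrow> harmonic_measure w S"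
proof -
  obtain N where N: "\<And>n. n \<ge> N \<Longrightarrow> norm (u n - w) < Im w / 2"
    using LIMSEQ_D[OF lim, of "Im w / 2"] w by auto
  define v where "v n = u (n + N)" for n
  have vl: "v \<longlonglongrightarrow> w" unfolding v_def by (rule LIMSEQ_ignore_initial_segment[OF lim])
  have v: "norm (v n - w) < Im w / 2" for n using N by (simp add: v_def)
  have Imv: "Im w / 2 < Im (v n)" "Im (v n) < 2 * Im w" for n
    using v[of n] abs_Im_le_cmod[of "v n - w"] by (auto simp: abs_le_iff)
  have "(\<lambda>n. harmonic_measure (v n) S) \<longlonglongrightarrow> harmonic_measure w S"
    unfolding harmonic_measure_density[OF S w]
  proof (subst harmonic_measure_density[OF S])
    show "0 < Im (v n)" for n using Imv(1)[of n] w by simp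
    let ?g = "\<lambda>w t. indicat_real S t * (Im w / (cmod (of_real t - w))\<^sup>2 / pi)"
    have nz: "of_real t - w \<noteq> 0" for t using w by (auto simp: complex_eq_iff)
    have int: "integrable lborel (\<lambda>t. Im w / (cmod (of_real t - w))\<^sup>2 / pi)"
    proof -
      have n: "(cmod (of_real (Re w + Im w * s) - w))\<^sup>2 = (Im w)\<^sup>2 * (1 + s\<^sup>2)" for s
        by (rule cmod_affine_minus)
      have "integrable lborel (\<lambda>s. Im w / (cmod (of_real (Re w + Im w * s) - w))\<^sup>2 / pi)"
        unfolding n using integrable_mult_right[OF integrable_cauchy_density, of "1 / Im w"] w
        by (simp add: power2_eq_square mult_ac)
      then show ?thesis
        using lborel_integrable_real_affine_iff[of "Im w" "\<lambda>t. Im w / (cmod (of_real t - w))\<^sup>2 / pi" "Re w"] w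
        by simp
    qed
    show "(\<lambda>n. \<integral>t. ?g (v n) t \<partial>lborel) \<longlonglongrightarrow> (\<integral>t. ?g w t \<partial>lborel)"
    \<comment> \<open>The 8 is 2 times 4: \<open>v n\<close> lies within \<open>Im w / 2\<close> of
      \<open>w\<close>, so that \<open>Im (v n) < 2 * Im w\<close> and the distance from
      \<open>t\<close> to \<open>v n\<close> is at least half of that from \<open>t\<close> to
      \<open>w\<close>.\<close>
    proof (rule integral_dominated_convergence[where w="\<lambda>t. 8 * (Im w / (cmod (of_real t - w))\<^sup>2 / pi)"])
      show "AE t in lborel. (\<lambda>n. ?g (v n) t) \<longlonglongrightarrow> ?g w t"
        using nz by (intro AE_I2 tendsto_intros vl) auto
      show "AE t in lborel. norm (?g (v n) t) \<le> 8 * (Im w / (cmod (of_real t - w))\<^sup>2 / pi)" for n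
      proof (rule AE_I2)
        fix t
        have "Im w \<le> cmod (of_real t - w)"
          using abs_Im_le_cmod[of "of_real t - w"] by simp
        moreover have "cmod (of_real t - w) \<le> cmod (of_real t - v n) + cmod (v n - w)"
          using norm_triangle_ineq[of "of_real t - v n" "v n - w"] by simp
        ultimately have h: "cmod (of_real t - w) / 2 \<le> cmod (of_real t - v n)"
          using v[of n] by simp
        have p: "0 < cmod (of_real t - w) / 2" using nz[of t] by simp
        have "Im (v n) / (cmod (of_real t - v n))\<^sup>2 \<le> (2 * Im w) / (cmod (of_real t - w) / 2)\<^sup>2"
          using w Imv[of n] p h by (intro frac_le power_mono) auto
        also have "\<dots> = 8 * (Im w / (cmod (of_real t - w))\<^sup>2)" by (simp add: power_divide)
        finally have "Im (v n) / (cmod (of_real t - v n))\<^sup>2 / pi \<le> 8 * (Im w / (cmod (of_real t - w))\<^sup>2) / pi"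
          by (rule divide_right_mono) simp
        then have X: "Im (v n) / (cmod (of_real t - v n))\<^sup>2 / pi \<le> 8 * (Im w / (cmod (of_real t - w))\<^sup>2 / pi)"
          by simp
        have X0: "0 \<le> Im (v n) / (cmod (of_real t - v n))\<^sup>2 / pi"
          using Imv(1)[of n] w by simp
        have "norm (?g (v n) t) = indicat_real S t * (Im (v n) / (cmod (of_real t - v n))\<^sup>2 / pi)"
          using X0 by (simp only: real_norm_def abs_mult abs_of_nonneg indicator_pos_le)
        also have "\<dots> \<le> 1 * (Im (v n) / (cmod (of_real t - v n))\<^sup>2 / pi)"
          by (rule mult_right_mono[OF _ X0]) (simp split: split_indicator)
        finally show "norm (?g (v n) t) \<le> 8 * (Im w / (cmod (of_real t - w))\<^sup>2 / pi)"
          using X by simp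
      qed
    next
      show "integrable lborel (\<lambda>t. 8 * (Im w / (cmod (of_real t - w))\<^sup>2 / pi))"
        by (rule integrable_mult_right[OF int])
    qed measurable
  qed
  then show ?thesis unfolding v_def by (rule LIMSEQ_offset)
qed

lemma average_translation_diff_tendsto_0:
  assumes A: "A \<in> sets borel" "emeasure lborel A < \<infinity>" and d: "d \<longlonglongrightarrow> 0"
  shows "(\<lambda>n. \<integral>s. translation_diff A (- d n * s) \<partial>cauchy_law) \<longlonglongrightarrow> 0"
proof -
  have [measurable]: "translation_diff A \<in> borel_measurable borel"
    by (rule translation_diff_measurable[OF A])
  have "(\<lambda>n. \<integral>s. translation_diff A (- d n * s) \<partial>cauchy_law) \<longlonglongrightarrow> (\<integral>s. 0 \<partial>cauchy_law)"
  proof (rule integral_dominated_convergence[where w="\<lambda>_. 2 * measure lborel A"])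
    show "AE s in cauchy_law. (\<lambda>n. translation_diff A (- d n * s)) \<longlonglongrightarrow> 0"
    proof (rule AE_I2, rule translation_diff_tendsto_0[OF A])
      show "(\<lambda>n. - d n * s) \<longlonglongrightarrow> 0" for s
        using tendsto_mult[OF tendsto_minus[OF d] tendsto_const, of s] by simp
    qed
    show "AE s in cauchy_law. norm (translation_diff A (- d n * s)) \<le> 2 * measure lborel A" for n
      using translation_diff_bounds[OF A] by (intro AE_I2) simp
  qed auto
  then show ?thesis by simp
qed

text \<open>The averages of the value distribution over the lines \<open>Im z = d\<close> approximate those on the
  real line at a rate that does not depend on the Herglotz function; hence pointwise convergence in
  the upper half-plane is enough.\<close>

theorem value_distribution_tendsto:
  fixes F :: "nat \<Rightarrow> complex \<Rightarrow> complex"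
  assumes F: "\<And>k. herglotz (F k)" "herglotz F0" and conv: "\<And>z. Im z > 0 \<Longrightarrow> (\<lambda>k. F k z) \<longlonglongrightarrow> F0 z"
    and G[measurable]: "\<And>k. G k \<in> borel_measurable borel" "G0 \<in> borel_measurable borel"
    and G_Im: "\<And>k x. Im (G k x) \<ge> 0" "\<And>x. Im (G0 x) \<ge> 0"
    and lim: "\<And>k. AE x in lborel. ((\<lambda>y. F k (Complex x y)) \<longlongrightarrow> G k x) (at_right 0)"
      "AE x in lborel. ((\<lambda>y. F0 (Complex x y)) \<longlongrightarrow> G0 x) (at_right 0)"
    and A[measurable]: "A \<in> sets borel" and A_fin: "emeasure lborel A < \<infinity>" and S[measurable]: "S \<in> sets borel"
  shows "(\<lambda>k. \<integral>x. indicator A x * harmonic_measure (G k x) S \<partial>lborel)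
    \<longlonglongrightarrow> (\<integral>x. indicator A x * harmonic_measure (G0 x) S \<partial>lborel)"
proof -
  define T where "T d = (\<integral>s. translation_diff A (- d * s) \<partial>cauchy_law)" for d :: real
  define m where "m H d = (\<integral>x. indicator A x * harmonic_measure (H (Complex x d)) S \<partial>lborel)" for H d
  have approx: "\<bar>m H d - (\<integral>x. indicator A x * harmonic_measure (g x) S \<partial>lborel)\<bar> \<le> T d"
    if "herglotz H" "g \<in> borel_measurable borel" "\<And>x. Im (g x) \<ge> 0"
      "AE x in lborel. ((\<lambda>y. H (Complex x y)) \<longlongrightarrow> g x) (at_right 0)" "d > 0" for H g d
  proof -
    have "harmonic_measure (H (Complex x d)) S = (\<integral>s. harmonic_measure (g (x + d * s)) S \<partial>cauchy_law)" for x
      using harmonic_measure_herglotz[OF that(1,2) S that(3,4), of "Complex x d"] that(5) by simp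
    then show ?thesis
      unfolding m_def T_def
      using poisson_average_diff[OF A A_fin harmonic_measure_measurable[OF S that(2)] harmonic_measure_range, of d]
      by simp
  qed
  have Fc: "continuous_on upper_half_plane (F k)" for k
    using F(1)[of k] by (auto simp: herglotz_def intro: holomorphic_on_imp_continuous_on)
  have F0c: "continuous_on upper_half_plane F0"
    using F(2) by (auto simp: herglotz_def intro: holomorphic_on_imp_continuous_on)
  have line: "(\<lambda>x. H (Complex x d)) \<in> borel_measurable borel"
    if "continuous_on upper_half_plane H" "d > 0" for H :: "complex \<Rightarrow> complex" and d
    by (rule borel_measurable_continuous_onI, rule continuous_on_compose2[OF that(1)])
       (use that(2) in \<open>auto simp: Complex_eq intro!: continuous_intros\<close>)
  have m_lim: "(\<lambda>k. m (F k) d) \<longlonglongrightarrow> m F0 d" if d: "d > 0" for d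
    unfolding m_def
  proof (rule integral_dominated_convergence[where w="indicat_real A"])
    show "(\<lambda>x. indicator A x * harmonic_measure (F0 (Complex x d)) S) \<in> borel_measurable lborel"
      using harmonic_measure_measurable[OF S line[OF F0c d]] by measurable
    show "(\<lambda>x. indicator A x * harmonic_measure (F k (Complex x d)) S) \<in> borel_measurable lborel" for k
      using harmonic_measure_measurable[OF S line[OF Fc d]] by measurable
    show "AE x in lborel. (\<lambda>k. indicator A x * harmonic_measure (F k (Complex x d)) S)
        \<longlonglongrightarrow> indicator A x * harmonic_measure (F0 (Complex x d)) S"
      using F(2) d by (intro AE_I2 tendsto_intros harmonic_measure_tendsto[OF S] conv) (auto simp: herglotz_def)
    show "AE x in lborel. norm (indicator A x * harmonic_measure (F k (Complex x d)) S) \<le> indicat_real A x" for k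
      using harmonic_measure_range[of _ S] by (intro AE_I2) (simp split: split_indicator)
    show "integrable lborel (indicat_real A)" using A_fin by simp
  qed
  let ?a = "\<lambda>k. \<integral>x. indicator A x * harmonic_measure (G k x) S \<partial>lborel"
    and ?b = "\<integral>x. indicator A x * harmonic_measure (G0 x) S \<partial>lborel"
  show ?thesis
  proof (rule LIMSEQ_I)
    fix r :: real assume r: "r > 0"
    \<comment> \<open>\<open>T\<close> depends on \<open>A\<close> and the height only. It fixes
      \<open>d\<close> before \<open>k\<close> is chosen, at the cost of \<open>r / 3\<close> for
      each of \<open>m (F k) d\<close> and \<open>m F0 d\<close>.\<close>
    have "(\<lambda>n. T (inverse (real (Suc n)))) \<longlonglongrightarrow> 0"
      unfolding T_def by (rule average_translation_diff_tendsto_0[OF A A_fin LIMSEQ_inverse_real_of_nat])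
    from LIMSEQ_D[OF this, of "r / 3"] r obtain n where "\<bar>T (inverse (real (Suc n)))\<bar> < r / 3" by auto
    then obtain d where d: "d > 0" "T d < r / 3" by (metis abs_ge_self inverse_positive_iff_positive le_less_trans of_nat_0_less_iff zero_less_Suc)
    obtain N where N: "\<And>k. k \<ge> N \<Longrightarrow> \<bar>m (F k) d - m F0 d\<bar> < r / 3"
      using LIMSEQ_D[OF m_lim[OF d(1)], of "r / 3"] r by auto
    have "norm (?a k - ?b) < r" if "k \<ge> N" for k
      using approx[OF F(1) G(1) G_Im(1) lim(1) d(1), of k] approx[OF F(2) G(2) G_Im(2) lim(2) d(1)] N[OF that] d(2)
      unfolding real_norm_def by linarith
    then show "\<exists>N. \<forall>k\<ge>N. norm (?a k - ?b) < r" by blast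
  qed
qed

lemma i_csqrt_herglotz: "herglotz (\<lambda>z. \<i> * csqrt z)"
  unfolding herglotz_def
proof (intro conjI allI impI)
  show "(\<lambda>z. \<i> * csqrt z) holomorphic_on upper_half_plane"
    by (intro holomorphic_intros) (auto simp: complex_nonpos_Reals_iff)
  show "Im (\<i> * csqrt z) > 0" if "Im z > 0" for z
    using csqrt_upper_half_plane(1)[OF that] by simp
qed

lemma i_sqrt_measurable: "i_sqrt \<in> borel_measurable borel"
proof -
  have "i_sqrt = (\<lambda>l. Complex (- sqrt ((\<bar>l\<bar> - l) / 2)) (sqrt ((\<bar>l\<bar> + l) / 2)))"
    by (rule ext) (auto simp: i_sqrt_def complex_eq_iff abs_if)
  also have "\<dots> \<in> borel_measurable borel" unfolding Complex_eq by measurable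
  finally show ?thesis .
qed

lemma i_sqrt_Im: "Im (i_sqrt l) \<ge> 0"
  by (simp add: i_sqrt_def)

section \<open>Solutions of the Schroedinger equation\<close>

text \<open>\<open>P\<close> is absolutely continuous with derivative \<open>p\<close>.\<close>

definition ac_primitive :: "real \<Rightarrow> real \<Rightarrow> (real \<Rightarrow> complex) \<Rightarrow> (real \<Rightarrow> complex) \<Rightarrow> bool" where
  "ac_primitive a b P p \<longleftrightarrow> p absolutely_integrable_on {a..b} \<and>
     (\<forall>x\<in>{a..b}. (p has_integral (P x - P a)) {a..x})"

lemma absolutely_integrable_continuous_mult:
  fixes f g :: "real \<Rightarrow> complex"
  assumes "continuous_on {a..b} f" "g absolutely_integrable_on {a..b}"
  shows "(\<lambda>x. f x * g x) absolutely_integrable_on {a..b}"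
proof (rule absolutely_integrable_bounded_measurable_product[OF bilinear_times _ _ _ assms(2)])
  show "f \<in> borel_measurable (lebesgue_on {a..b})"
    by (rule continuous_imp_measurable_on_sets_lebesgue[OF assms(1)]) simp
  show "bounded (f ` {a..b})"
    by (rule compact_imp_bounded[OF compact_continuous_image[OF assms(1) compact_Icc]])
qed simp

lemma ac_primitive_subinterval:
  assumes "ac_primitive a b P p" "a \<le> s" "s \<le> t" "t \<le> b"
  shows "p absolutely_integrable_on {s..t}" "(p has_integral (P t - P s)) {s..t}"
proof -
  have p: "p absolutely_integrable_on {a..b}" and i: "(p has_integral (P x - P a)) {a..x}" if "x \<in> {a..b}" for x
    using assms(1) that by (auto simp: ac_primitive_def)
  show st: "p absolutely_integrable_on {s..t}"
    by (rule absolutely_integrable_on_subinterval[OF p]) (use assms in auto)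
  have "p integrable_on {a..t}" using i[of t] assms by auto
  from Henstock_Kurzweil_Integration.integral_combine[OF assms(2,3) this]
  have "P s - P a + integral {s..t} p = P t - P a"
    using integral_unique[OF i[of s]] integral_unique[OF i[of t]] assms by simp
  then have "integral {s..t} p = P t - P s" by (simp add: algebra_simps)
  then show "(p has_integral (P t - P s)) {s..t}"
    using set_lebesgue_integral_eq_integral(1)[OF st] by (simp add: has_integral_iff)
qed

lemma ac_primitive_restrict:
  assumes "ac_primitive a b P p" "a \<le> s" "t \<le> b"
  shows "ac_primitive s t P p"
proof (cases "s \<le> t")
  case True
  show ?thesis
    unfolding ac_primitive_def
    using ac_primitive_subinterval[OF assms(1,2)] assms True by auto
qed (simp add: ac_primitive_def)

lemma ac_primitive_continuous:
  assumes "ac_primitive a b P p"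
  shows "continuous_on {a..b} P"
proof -
  have "p integrable_on {a..b}"
    using assms by (auto simp: ac_primitive_def set_lebesgue_integral_eq_integral)
  then have "continuous_on {a..b} (\<lambda>x. P a + integral {a..x} p)"
    by (intro continuous_intros indefinite_integral_continuous_1)
  moreover have "P a + integral {a..x} p = P x" if "x \<in> {a..b}" for x
    using assms that by (auto simp: ac_primitive_def dest!: bspec integral_unique)
  ultimately show ?thesis by (rule continuous_on_eq)
qed

lemma ac_primitive_add:
  "ac_primitive a b P p \<Longrightarrow> ac_primitive a b R r \<Longrightarrow> ac_primitive a b (\<lambda>x. P x + R x) (\<lambda>x. p x + r x)"
  unfolding ac_primitive_def add_diff_add by (auto intro: has_integral_add set_integral_add)

lemma ac_primitive_cmult:
  "ac_primitive a b P p \<Longrightarrow> ac_primitive a b (\<lambda>x. c * P x) (\<lambda>x. c * p x)"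
  unfolding ac_primitive_def right_diff_distrib[symmetric]
  by (auto intro: has_integral_mult_right set_integrable_mult_right)

lemma ac_primitive_diff:
  "ac_primitive a b P p \<Longrightarrow> ac_primitive a b R r \<Longrightarrow> ac_primitive a b (\<lambda>x. P x - R x) (\<lambda>x. p x - r x)"
  using ac_primitive_add[of a b P p "\<lambda>x. - 1 * R x" "\<lambda>x. - 1 * r x"] ac_primitive_cmult[of a b R r "- 1"] by simp

lemma ac_primitive_cnj:
  assumes "ac_primitive a b P p"
  shows "ac_primitive a b (\<lambda>x. cnj (P x)) (\<lambda>x. cnj (p x))"
  using assms has_integral_linear[OF _ bounded_linear_cnj, where f=p] absolutely_integrable_linear[OF _ bounded_linear_cnj, where f=p]
  unfolding ac_primitive_def o_def complex_cnj_diff[symmetric] by blast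

lemma ac_primitive_cong:
  assumes "ac_primitive a b P p" "\<And>x. x \<in> {a..b} \<Longrightarrow> P x = P' x" "\<And>x. x \<in> {a..b} \<Longrightarrow> p x = p' x"
  shows "ac_primitive a b P' p'"
  unfolding ac_primitive_def
proof (intro conjI ballI)
  show "p' absolutely_integrable_on {a..b}"
    using assms(1) set_integrable_cong[OF refl refl assms(3), where M=lebesgue and A="{a..b}"]
    by (simp add: ac_primitive_def)
  fix x assume x: "x \<in> {a..b}"
  then have "(p has_integral (P x - P a)) {a..x}" using assms(1) by (auto simp: ac_primitive_def)
  then have "(p has_integral (P' x - P' a)) {a..x}" using assms(2)[OF x] assms(2)[of a] x by simp
  then show "(p' has_integral (P' x - P' a)) {a..x}"
    by (rule has_integral_eq[rotated]) (use assms(3) x in auto)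
qed

lemma ac_primitiveI_continuous:
  assumes "\<And>x. x \<in> {a..b} \<Longrightarrow> (P has_vector_derivative p x) (at x within {a..b})" "continuous_on {a..b} p"
  shows "ac_primitive a b P p"
  unfolding ac_primitive_def
proof (intro conjI ballI)
  show "p absolutely_integrable_on {a..b}" by (rule absolutely_integrable_continuous_real[OF assms(2)])
  fix x assume x: "x \<in> {a..b}"
  show "(p has_integral (P x - P a)) {a..x}"
    by (rule fundamental_theorem_of_calculus)
       (use x assms(1) in \<open>auto intro: has_vector_derivative_within_subset[of _ _ _ "{a..b}"]\<close>)
qed

lemma ac_primitive_increment_le:
  assumes "ac_primitive a b P p" "a \<le> s" "s \<le> t" "t \<le> b"
  shows "norm (P t - P s) \<le> integral {s..t} (\<lambda>x. norm (p x))"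
proof -
  note i = ac_primitive_subinterval[OF assms]
  have "P t - P s = integral {s..t} p" using i(2) by (simp add: integral_unique)
  also have "norm \<dots> \<le> integral {s..t} (\<lambda>x. norm (p x))"
    using i(1) by (intro integral_norm_bound_integral) (auto simp: absolutely_integrable_on_def)
  finally show ?thesis .
qed

text \<open>Bisecting at a point where \<open>B\<close> takes its mean value improves the constant in
  \<open>\<bar>D t - D s\<bar> \<le> (B t - B s)\<^sup>2\<close> by a factor 2.\<close>

lemma constant_if_quadratic_increment:
  fixes D :: "real \<Rightarrow> 'a::real_normed_vector" and B :: "real \<Rightarrow> real"
  assumes B: "continuous_on {a..b} B"
    and D: "\<And>s t. a \<le> s \<Longrightarrow> s \<le> t \<Longrightarrow> t \<le> b \<Longrightarrow> norm (D t - D s) \<le> (B t - B s)\<^sup>2"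
    and mono: "\<And>s t. a \<le> s \<Longrightarrow> s \<le> t \<Longrightarrow> t \<le> b \<Longrightarrow> B s \<le> B t"
    and st: "a \<le> s" "s \<le> t" "t \<le> b"
  shows "D t = D s"
proof -
  have bound: "norm (D t - D s) \<le> (B t - B s)\<^sup>2 / 2 ^ n" if "a \<le> s" "s \<le> t" "t \<le> b" for n s t
    using that
  proof (induction n arbitrary: s t)
    case 0
    then show ?case using D by simp
  next
    case (Suc n)
    have "continuous_on {s..t} B" using B by (rule continuous_on_subset) (use Suc.prems in auto)
    moreover have "B s \<le> (B s + B t) / 2" "(B s + B t) / 2 \<le> B t" using mono[OF Suc.prems] by auto
    ultimately obtain m where m: "s \<le> m" "m \<le> t" "B m = (B s + B t) / 2"
      using IVT'[of B s "(B s + B t) / 2" t] Suc.prems by auto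
    have "norm (D t - D s) \<le> norm (D t - D m) + norm (D m - D s)"
      using norm_triangle_ineq[of "D t - D m" "D m - D s"] by simp
    also have "\<dots> \<le> (B t - B m)\<^sup>2 / 2 ^ n + (B m - B s)\<^sup>2 / 2 ^ n"
      using Suc.prems m(1,2) by (intro add_mono Suc.IH) auto
    also have "\<dots> = (B t - B s)\<^sup>2 / 2 ^ Suc n"
      unfolding m(3) by (simp add: field_simps power2_eq_square)
    finally show ?case .
  qed
  have "(\<lambda>n. (B t - B s)\<^sup>2 / 2 ^ n) \<longlonglongrightarrow> 0" by real_asymp
  then have "norm (D t - D s) \<le> 0"
    by (rule LIMSEQ_le_const) (use bound[OF st] in auto)
  then show ?thesis by simp
qed

text \<open>\<open>P t * R t - P s * R s\<close> equals
  \<open>R t * (P t - P s) + P s * (R t - R s)\<close>, an integral in which the factors are frozen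
  at \<open>t\<close> and \<open>s\<close>. Unfreezing them costs at most the square of the
  increment of \<open>B\<close>, the integral of \<open>\<bar>p\<bar> + \<bar>r\<bar>\<close>. So
  the defect \<open>D\<close> has quadratic increments and is constant; pointwise derivatives of
  \<open>P\<close> and \<open>R\<close> never occur.\<close>

lemma ac_primitive_mult:
  assumes P: "ac_primitive a b P p" and R: "ac_primitive a b R r"
  shows "ac_primitive a b (\<lambda>x. P x * R x) (\<lambda>x. P x * r x + R x * p x)"
proof -
  let ?d = "\<lambda>x. P x * r x + R x * p x"
  have cP: "continuous_on {a..b} P" and cR: "continuous_on {a..b} R"
    using P R by (auto intro: ac_primitive_continuous)
  have p: "p absolutely_integrable_on {a..b}" and r: "r absolutely_integrable_on {a..b}"
    using P R by (auto simp: ac_primitive_def)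
  have d: "?d absolutely_integrable_on {a..b}"
    by (intro set_integral_add absolutely_integrable_continuous_mult cP cR p r)
  let ?n = "\<lambda>x. norm (p x) + norm (r x)"
  have n: "?n integrable_on {a..b}"
    using p r by (intro integrable_add) (auto simp: absolutely_integrable_on_def)
  define B where "B x = integral {a..x} ?n" for x
  define D where "D x = P x * R x - integral {a..x} ?d" for x
  have nst: "?n integrable_on {s..t}" if "a \<le> s" "t \<le> b" for s t
    by (rule integrable_on_subinterval[OF n]) (use that in auto)
  have B_diff: "B t - B s = integral {s..t} ?n" if "a \<le> s" "s \<le> t" "t \<le> b" for s t
    using Henstock_Kurzweil_Integration.integral_combine[OF that(1,2) nst[OF order_refl that(3)]] by (simp add: B_def)
  have mono: "B s \<le> B t" if "a \<le> s" "s \<le> t" "t \<le> b" for s t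
  proof -
    have "0 \<le> integral {s..t} ?n" by (intro integral_nonneg nst that) auto
    then show ?thesis using B_diff[OF that] by simp
  qed
  have cB: "continuous_on {a..b} B" unfolding B_def by (rule indefinite_integral_continuous_1[OF n])
  have inc: "norm (P t - P s) \<le> B t - B s" "norm (R t - R s) \<le> B t - B s" if "a \<le> s" "s \<le> t" "t \<le> b" for s t
  proof -
    have pi: "(\<lambda>x. norm (p x)) integrable_on {s..t}" "(\<lambda>x. norm (r x)) integrable_on {s..t}"
      using ac_primitive_subinterval(1)[OF P that] ac_primitive_subinterval(1)[OF R that]
      by (auto simp: absolutely_integrable_on_def)
    have "integral {s..t} (\<lambda>x. norm (p x)) \<le> integral {s..t} ?n" "integral {s..t} (\<lambda>x. norm (r x)) \<le> integral {s..t} ?n"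
      using that by (auto intro!: integral_le pi nst)
    then show "norm (P t - P s) \<le> B t - B s" "norm (R t - R s) \<le> B t - B s"
      using ac_primitive_increment_le[OF P that] ac_primitive_increment_le[OF R that] B_diff[OF that] by auto
  qed
  have key: "norm (D t - D s) \<le> (B t - B s)\<^sup>2" if st: "a \<le> s" "s \<le> t" "t \<le> b" for s t
  proof -
    have dst: "?d integrable_on {u..v}" if "a \<le> u" "v \<le> b" for u v
      by (rule integrable_on_subinterval[of _ "{a..b}"])
         (use d that in \<open>auto simp: set_lebesgue_integral_eq_integral\<close>)
    have hd: "(?d has_integral integral {s..t} ?d) {s..t}" using dst[OF st(1,3)] by (rule integrable_integral)
    have h1: "((\<lambda>x. R t * p x) has_integral R t * (P t - P s)) {s..t}"
      by (rule has_integral_mult_right[OF ac_primitive_subinterval(2)[OF P st]])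
    have h2: "((\<lambda>x. P s * r x) has_integral P s * (R t - R s)) {s..t}"
      by (rule has_integral_mult_right[OF ac_primitive_subinterval(2)[OF R st]])
    have h: "((\<lambda>x. R t * p x + P s * r x - ?d x) has_integral (R t * (P t - P s) + P s * (R t - R s) - integral {s..t} ?d)) {s..t}"
      by (intro has_integral_diff has_integral_add h1 h2 hd)
    have "integral {a..t} ?d = integral {a..s} ?d + integral {s..t} ?d"
      using Henstock_Kurzweil_Integration.integral_combine[OF st(1,2) dst[OF order_refl st(3)]] by simp
    then have "D t - D s = R t * (P t - P s) + P s * (R t - R s) - integral {s..t} ?d"
      by (simp add: D_def algebra_simps)
    then have eq: "D t - D s = integral {s..t} (\<lambda>x. R t * p x + P s * r x - ?d x)"
      using h by (simp add: integral_unique)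
    have "norm (integral {s..t} (\<lambda>x. R t * p x + P s * r x - ?d x)) \<le> integral {s..t} (\<lambda>x. (B t - B s) * ?n x)"
    proof (rule integral_norm_bound_integral)
      show "(\<lambda>x. R t * p x + P s * r x - ?d x) integrable_on {s..t}" using h by auto
      show "(\<lambda>x. (B t - B s) * ?n x) integrable_on {s..t}"
        using integrable_on_cmult_left[OF nst[OF st(1,3)], of "B t - B s"] by simp
      fix x assume x: "x \<in> {s..t}"
      have "norm (R t - R x) \<le> B t - B s" "norm (P x - P s) \<le> B t - B s"
        using inc(2)[of x t] inc(1)[of s x] mono[of s x] mono[of x t] x st by auto
      moreover have "R t * p x + P s * r x - ?d x = (R t - R x) * p x - (P x - P s) * r x"
        by (simp add: algebra_simps)
      ultimately have "norm (R t * p x + P s * r x - ?d x) \<le> (B t - B s) * norm (p x) + (B t - B s) * norm (r x)"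
        by (simp only:) (intro norm_triangle_le_diff add_mono; simp add: norm_mult mult_right_mono)
      then show "norm (R t * p x + P s * r x - ?d x) \<le> (B t - B s) * ?n x" by (simp add: distrib_left)
    qed
    also have "\<dots> = (B t - B s) * (B t - B s)"
      using B_diff[OF st] by simp
    finally show ?thesis unfolding eq power2_eq_square .
  qed
  show ?thesis
    unfolding ac_primitive_def
  proof (intro conjI ballI d)
    fix x assume x: "x \<in> {a..b}"
    have "D x = D a"
      by (rule constant_if_quadratic_increment[OF cB key mono]) (use x in auto)
    then have "integral {a..x} ?d = P x * R x - P a * R a" by (simp add: D_def algebra_simps)
    moreover have "?d integrable_on {a..x}"
      by (rule integrable_on_subinterval[of _ "{a..b}"])
         (use d x in \<open>auto simp: set_lebesgue_integral_eq_integral\<close>)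
    ultimately show "(?d has_integral (P x * R x - P a * R a)) {a..x}" by (simp add: has_integral_iff)
  qed
qed

text \<open>Stated on a compact interval, so that solutions can be restricted and reflected. For
  \<open>a > b\<close> it holds vacuously, which lets \<open>sol V z 0 b F G\<close> be asserted for
  all \<open>b\<close>.\<close>

definition sol :: "(real \<Rightarrow> real) \<Rightarrow> complex \<Rightarrow> real \<Rightarrow> real \<Rightarrow> (real \<Rightarrow> complex) \<Rightarrow> (real \<Rightarrow> complex) \<Rightarrow> bool" where
  "sol V z a b F G \<longleftrightarrow> ac_primitive a b F G \<and> ac_primitive a b G (\<lambda>x. (of_real (V x) - z) * F x)"

lemma sol_restrict: "sol V z a b F G \<Longrightarrow> a \<le> s \<Longrightarrow> t \<le> b \<Longrightarrow> sol V z s t F G"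
  unfolding sol_def by (auto intro: ac_primitive_restrict)

lemma sol_continuous:
  assumes "sol V z a b F G"
  shows "continuous_on {a..b} F" "continuous_on {a..b} G"
  using assms by (auto simp: sol_def intro: ac_primitive_continuous)

lemma sol_linear:
  assumes "sol V z a b F G" "sol V z a b F' G'"
  shows "sol V z a b (\<lambda>x. c * F x + d * F' x) (\<lambda>x. c * G x + d * G' x)"
proof -
  have "ac_primitive a b (\<lambda>x. c * G x + d * G' x)
      (\<lambda>x. c * ((of_real (V x) - z) * F x) + d * ((of_real (V x) - z) * F' x))"
    using assms by (auto simp: sol_def intro!: ac_primitive_add ac_primitive_cmult)
  then have "ac_primitive a b (\<lambda>x. c * G x + d * G' x) (\<lambda>x. (of_real (V x) - z) * (c * F x + d * F' x))"
    by (rule ac_primitive_cong) (auto simp: algebra_simps)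
  then show ?thesis
    using assms by (auto simp: sol_def intro!: ac_primitive_add ac_primitive_cmult)
qed

section \<open>Passage between the half-line and compact intervals\<close>

lemma locally_integrable_absolutely:
  assumes "locally_integrable V" "0 \<le> a"
  shows "V absolutely_integrable_on {a..b}"
proof (cases "a \<le> b")
  case True
  then have "V absolutely_integrable_on {0..b}" using assms by (simp add: locally_integrable_def)
  then show ?thesis by (rule absolutely_integrable_on_subinterval) (use assms True in auto)
qed simp

lemma absolutely_integrable_coefficient:
  fixes V :: "real \<Rightarrow> real"
  assumes "V absolutely_integrable_on {a..b}"
  shows "(\<lambda>x. complex_of_real (V x) - z) absolutely_integrable_on {a..b}"
  using absolutely_integrable_linear[OF assms bounded_linear_of_real, unfolded o_def]
  by (rule set_integral_diff(1)) (rule absolutely_integrable_continuous_real[OF continuous_on_const])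

lemma absolutely_integrable_potential_term:
  fixes V :: "real \<Rightarrow> real" and F :: "real \<Rightarrow> complex"
  assumes "V absolutely_integrable_on {a..b}" "continuous_on {a..b} F"
  shows "(\<lambda>x. (complex_of_real (V x) - z) * F x) absolutely_integrable_on {a..b}"
  using absolutely_integrable_continuous_mult[OF assms(2) absolutely_integrable_coefficient[OF assms(1), of z]]
  by (simp add: mult.commute)

lemma solI:
  assumes "V absolutely_integrable_on {a..b}" "continuous_on {a..b} F" "continuous_on {a..b} G"
    and "\<And>x. x \<in> {a..b} \<Longrightarrow> (G has_integral (F x - F a)) {a..x}"
    and "\<And>x. x \<in> {a..b} \<Longrightarrow> ((\<lambda>t. (of_real (V t) - z) * F t) has_integral (G x - G a)) {a..x}"
  shows "sol V z a b F G"
  unfolding sol_def ac_primitive_def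
  using assms absolutely_integrable_potential_term[OF assms(1,2)] absolutely_integrable_continuous_real[OF assms(3)]
  by auto

lemma sol_if_schroedinger_solution:
  fixes F G :: "real \<Rightarrow> complex"
  assumes V: "locally_integrable V" and S: "schroedinger_solution V z F G"
  shows "sol V z 0 b F G"
proof (rule solI)
  have D: "(F has_vector_derivative G x) (at x within {0..})"
    and I: "((\<lambda>t. (of_real (V t) - z) * F t) has_integral (G x - G 0)) {0..x}" if "x \<ge> 0" for x
    using S that by (auto simp: schroedinger_solution_def)
  show V': "V absolutely_integrable_on {0..b}" by (rule locally_integrable_absolutely[OF V]) simp
  have Db: "(F has_vector_derivative G x) (at x within {0..b})" if "x \<in> {0..b}" for x
    by (rule has_vector_derivative_within_subset[OF D]) (use that in auto)
  then show F: "continuous_on {0..b} F"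
    by (meson continuous_on_eq_continuous_within has_vector_derivative_continuous)
  let ?q = "\<lambda>t. (of_real (V t) - z) * F t"
  show G: "continuous_on {0..b} G"
  proof (rule continuous_on_eq)
    have "?q integrable_on {0..b}"
      using absolutely_integrable_potential_term[OF V' F] by (rule set_lebesgue_integral_eq_integral(1))
    then show "continuous_on {0..b} (\<lambda>x. G 0 + integral {0..x} ?q)"
      by (intro continuous_intros indefinite_integral_continuous_1)
    show "G 0 + integral {0..x} ?q = G x" if "x \<in> {0..b}" for x
      using integral_unique[OF I[of x]] that by simp
  qed
  show "(?q has_integral (G x - G 0)) {0..x}" if "x \<in> {0..b}" for x using I[of x] that by simp
  show "(G has_integral (F x - F 0)) {0..x}" if "x \<in> {0..b}" for x
  proof (rule fundamental_theorem_of_calculus)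
    show "(F has_vector_derivative G y) (at y within {0..x})" if "y \<in> {0..x}" for y
      by (rule has_vector_derivative_within_subset[OF Db]) (use that \<open>x \<in> {0..b}\<close> in auto)
  qed (use that in auto)
qed

lemma schroedinger_solution_if_sol:
  fixes F G :: "real \<Rightarrow> complex"
  assumes S: "\<And>b. sol V z 0 b F G"
  shows "schroedinger_solution V z F G"
  unfolding schroedinger_solution_def
proof (intro allI impI conjI)
  fix x :: real assume x: "0 \<le> x"
  show "((\<lambda>t. (of_real (V t) - z) * F t) has_integral (G x - G 0)) {0..x}"
    using S[of x] x by (auto simp: sol_def ac_primitive_def)
  have GI: "(G has_integral (F y - F 0)) {0..y}" if "y \<ge> 0" for y
    using S[of y] that by (auto simp: sol_def ac_primitive_def)
  have "((\<lambda>y. F 0 + integral {0..y} G) has_vector_derivative G x) (at x within {0..x + 1})"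
    using integral_has_vector_derivative[OF sol_continuous(2)[OF S], of x "x + 1"] x
    by (auto intro!: derivative_eq_intros)
  moreover have "F 0 + integral {0..y} G = F y" if "y \<in> {0..x + 1}" for y
    using integral_unique[OF GI[of y]] that by simp
  ultimately have "(F has_vector_derivative G x) (at x within {0..x + 1})"
    using x by (intro has_vector_derivative_transform[of x "{0..x + 1}" F "\<lambda>y. F 0 + integral {0..y} G"]) auto
  moreover have "at x within {0..x + 1} = at x within {0..}"
    by (rule at_within_nhd[of x "{..<x + 1}"]) auto
  ultimately show "(F has_vector_derivative G x) (at x within {0..})" by simp
qed

lemma schroedinger_solution_of_real:
  fixes f g :: "real \<Rightarrow> real"
  assumes "schroedinger_solution V l f g"
  shows "schroedinger_solution V (complex_of_real l) (\<lambda>x. of_real (f x)) (\<lambda>x. of_real (g x))"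
  unfolding schroedinger_solution_def
proof (intro allI impI conjI)
  fix x :: real assume x: "0 \<le> x"
  show "((\<lambda>x. complex_of_real (f x)) has_vector_derivative of_real (g x)) (at x within {0..})"
    using assms x bounded_linear.has_vector_derivative[OF bounded_linear_of_real]
    by (auto simp: schroedinger_solution_def)
  have "((\<lambda>t. (V t - l) * f t) has_integral (g x - g 0)) {0..x}"
    using assms x by (auto simp: schroedinger_solution_def)
  from has_integral_linear[OF this bounded_linear_of_real]
  show "((\<lambda>t. (complex_of_real (V t) - of_real l) * of_real (f t)) has_integral (of_real (g x) - of_real (g 0))) {0..x}"
    by (simp add: o_def)
qed

text \<open>Where \<open>B\<close> grows by at most 1/2, the growth inequality at a maximum point of
  \<open>N\<close> absorbs half of that maximum, so \<open>N\<close> at most doubles. A growth of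
  \<open>n / 2\<close> splits into \<open>n\<close> such stretches by the intermediate value
  theorem. The power of 2 takes the place of the exponential in Gronwall's lemma.\<close>

lemma gronwall_halving:
  fixes N B :: "real \<Rightarrow> real"
  assumes N: "continuous_on {a..b} N" "\<And>x. N x \<ge> 0" and B: "continuous_on {a..b} B"
    and growth: "\<And>s t M. a \<le> s \<Longrightarrow> s \<le> t \<Longrightarrow> t \<le> b \<Longrightarrow> (\<And>x. x \<in> {s..t} \<Longrightarrow> N x \<le> M) \<Longrightarrow> N t \<le> N s + (B t - B s) * M"
    and mono: "\<And>s t. a \<le> s \<Longrightarrow> s \<le> t \<Longrightarrow> t \<le> b \<Longrightarrow> B s \<le> B t"
  shows "a \<le> s \<Longrightarrow> s \<le> t \<Longrightarrow> t \<le> b \<Longrightarrow> B t - B s \<le> real n / 2 \<Longrightarrow> N t \<le> 2 ^ n * N s"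
proof (induction n arbitrary: s)
  have maxi: "\<exists>u\<in>{s..t}. \<forall>x\<in>{s..t}. N x \<le> N u" if "a \<le> s" "s \<le> t" "t \<le> b" for s t
    by (rule continuous_attains_sup)
       (use that in \<open>auto intro: continuous_on_subset[OF N(1)]\<close>)
  {
    case 0
    obtain u where "u \<in> {s..t}" "\<forall>x\<in>{s..t}. N x \<le> N u" using maxi[OF 0(1-3)] by blast
    then have "N t \<le> N s + (B t - B s) * N u" using 0 by (intro growth) auto
    moreover have "B t = B s" using 0 mono[of s t] by simp
    ultimately show ?case by simp
  next
    case (Suc n)
    have half: "N t' \<le> 2 * N s" if "s \<le> t'" "t' \<le> t" "B t' - B s \<le> 1 / 2" for t'
    proof -
      have st': "a \<le> s" "s \<le> t'" "t' \<le> b" using that Suc.prems by auto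
      obtain u where u: "u \<in> {s..t'}" "\<forall>x\<in>{s..t'}. N x \<le> N u" using maxi[OF st'] by blast
      have "N u \<le> N s + (B u - B s) * N u" using u st' by (intro growth) auto
      also have "\<dots> \<le> N s + 1 / 2 * N u"
        using that(3) mono[of u t'] u(1) st' N(2)[of u] by (intro add_left_mono mult_right_mono) auto
      finally have "N u \<le> 2 * N s" by simp
      then show ?thesis using u(2) st' by force
    qed
    show ?case
    proof (cases "B t - B s \<le> 1 / 2")
      case True
      have "N t \<le> 2 * N s" using half[of t] Suc.prems True by auto
      also have "\<dots> \<le> 2 ^ Suc n * N s" using N(2)[of s] by (intro mult_right_mono) auto
      finally show ?thesis .
    next
      case False
      have "continuous_on {s..t} B" by (rule continuous_on_subset[OF B]) (use Suc.prems in auto)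
      then obtain m where m: "s \<le> m" "m \<le> t" "B m = B s + 1 / 2"
        using IVT'[of B s "B s + 1 / 2" t] Suc.prems False by auto
      have "N t \<le> 2 ^ n * N m"
        using Suc.prems m by (intro Suc.IH) (auto simp: field_simps)
      also have "\<dots> \<le> 2 ^ n * (2 * N s)" using half[of m] m by (intro mult_left_mono) auto
      finally show ?thesis by simp
    qed
  }
qed

text \<open>The growth function integrates \<open>1 + \<bar>V\<bar> + \<bar>c\<bar>\<close>, which
  majorises both coefficients of the first-order system, so \<open>K\<close> serves all
  \<open>z\<close> with \<open>norm z \<le> c\<close> and all initial data at once. Zero data then
  give uniqueness, and the uniformity in \<open>z\<close> is used for the dependence on the spectral
  parameter.\<close>

lemma sol_bound:
  assumes V: "V absolutely_integrable_on {a..b}"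
  shows "\<exists>K\<ge>0. \<forall>z F G x. norm z \<le> c \<longrightarrow> sol V z a b F G \<longrightarrow> x \<in> {a..b} \<longrightarrow>
    norm (F x) + norm (G x) \<le> K * (norm (F a) + norm (G a))"
proof -
  let ?q = "\<lambda>x. 1 + \<bar>V x\<bar> + \<bar>c\<bar>"
  define B where "B x = integral {a..x} ?q" for x
  have q: "?q integrable_on {a..b}"
    using V by (intro integrable_add) (auto simp: absolutely_integrable_on_def)
  have qst: "?q integrable_on {s..t}" if "a \<le> s" "t \<le> b" for s t
    by (rule integrable_on_subinterval[OF q]) (use that in auto)
  have B_diff: "B t - B s = integral {s..t} ?q" if "a \<le> s" "s \<le> t" "t \<le> b" for s t
    using Henstock_Kurzweil_Integration.integral_combine[OF that(1,2) qst[OF order_refl that(3)]] by (simp add: B_def)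
  have mono: "B s \<le> B t" if "a \<le> s" "s \<le> t" "t \<le> b" for s t
  proof -
    have "0 \<le> integral {s..t} ?q" by (intro integral_nonneg qst that) auto
    then show ?thesis using B_diff[OF that] by simp
  qed
  have cB: "continuous_on {a..b} B" unfolding B_def by (rule indefinite_integral_continuous_1[OF q])
  obtain n where n: "2 * (B b - B a) \<le> real n" using real_arch_simple by blast
  show ?thesis
  proof (intro exI[of _ "2 ^ n"] conjI allI impI)
    show "(0::real) \<le> 2 ^ n" by simp
    fix z F G x assume z: "norm z \<le> c" and S: "sol V z a b F G" and x: "x \<in> {a..b}"
    let ?N = "\<lambda>x. norm (F x) + norm (G x)"
    show "?N x \<le> 2 ^ n * ?N a"
    proof (rule gronwall_halving[where N="?N" and B=B and a=a and b=b])
      show "continuous_on {a..b} ?N" using sol_continuous[OF S] by (intro continuous_intros)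
      show "continuous_on {a..b} B" by (rule cB)
      show "B s \<le> B t" if "a \<le> s" "s \<le> t" "t \<le> b" for s t by (rule mono[OF that])
      have "B x \<le> B b" "B a \<le> B a" using mono[of x b] x by auto
      then show "B x - B a \<le> real n / 2" using n by simp
      fix s t M assume st: "a \<le> s" "s \<le> t" "t \<le> b" and M: "\<And>x. x \<in> {s..t} \<Longrightarrow> ?N x \<le> M"
      let ?g = "\<lambda>x. (of_real (V x) - z) * F x"
      have aF: "ac_primitive a b F G" and aG: "ac_primitive a b G ?g" using S by (auto simp: sol_def)
      have iF: "(\<lambda>x. norm (G x)) integrable_on {s..t}" and iG: "(\<lambda>x. norm (?g x)) integrable_on {s..t}"
        using ac_primitive_subinterval(1)[OF aF st] ac_primitive_subinterval(1)[OF aG st]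
        by (auto simp: absolutely_integrable_on_def)
      have "?N t - ?N s \<le> norm (F t - F s) + norm (G t - G s)"
        using norm_triangle_ineq2[of "F t" "F s"] norm_triangle_ineq2[of "G t" "G s"] by simp
      also have "\<dots> \<le> integral {s..t} (\<lambda>x. norm (G x)) + integral {s..t} (\<lambda>x. norm (?g x))"
        by (intro add_mono ac_primitive_increment_le[OF aF st] ac_primitive_increment_le[OF aG st])
      also have "\<dots> = integral {s..t} (\<lambda>x. norm (G x) + norm (?g x))"
        by (rule Henstock_Kurzweil_Integration.integral_add[symmetric, OF iF iG])
      also have "\<dots> \<le> integral {s..t} (\<lambda>x. ?q x * M)"
      proof (rule integral_le)
        show "(\<lambda>x. norm (G x) + norm (?g x)) integrable_on {s..t}" by (intro integrable_add iF iG)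
        show "(\<lambda>x. ?q x * M) integrable_on {s..t}"
          using integrable_on_cmult_left[OF qst[OF st(1,3)], of M] by (simp add: mult.commute)
        fix x assume x: "x \<in> {s..t}"
        have "norm (of_real (V x) - z) \<le> \<bar>V x\<bar> + \<bar>c\<bar>"
          using norm_triangle_ineq4[of "of_real (V x)" z] z by simp
        then have "norm (?g x) \<le> (\<bar>V x\<bar> + \<bar>c\<bar>) * M"
          unfolding norm_mult using M[OF x] by (intro mult_mono) (auto intro: order_trans[of _ "?N x"])
        moreover have "norm (G x) \<le> M" using M[OF x] by (auto intro: order_trans[of _ "?N x"])
        ultimately show "norm (G x) + norm (?g x) \<le> ?q x * M" by (simp add: algebra_simps)
      qed
      also have "\<dots> = (B t - B s) * M"
        using B_diff[OF st] by simp
      finally show "?N t \<le> ?N s + (B t - B s) * M" by simp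
    qed (use x in auto)
  qed
qed

lemma sol_unique:
  assumes V: "V absolutely_integrable_on {a..b}" and S: "sol V z a b F G" "sol V z a b F' G'"
    and init: "F a = F' a" "G a = G' a" and x: "x \<in> {a..b}"
  shows "F x = F' x" "G x = G' x"
proof -
  obtain K where K: "\<And>w F G x. norm w \<le> norm z \<Longrightarrow> sol V w a b F G \<Longrightarrow> x \<in> {a..b} \<Longrightarrow>
    norm (F x) + norm (G x) \<le> K * (norm (F a) + norm (G a))"
    using sol_bound[OF V, of "norm z"] by metis
  have "norm (1 * F x + (- 1) * F' x) + norm (1 * G x + (- 1) * G' x) \<le> K * 0"
    using K[OF order_refl sol_linear[OF S, of 1 "-1"] x] init by simp
  then have "norm (F x - F' x) + norm (G x - G' x) \<le> 0" by simp
  then have "norm (F x - F' x) \<le> 0" "norm (G x - G' x) \<le> 0"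
    using norm_ge_zero[of "F x - F' x"] norm_ge_zero[of "G x - G' x"] by linarith+
  then show "F x = F' x" "G x = G' x" by auto
qed

section \<open>Existence by Picard iteration\<close>

lemma ac_primitive_power:
  assumes P: "ac_primitive a b P p"
  shows "ac_primitive a b (\<lambda>x. P x ^ Suc n) (\<lambda>x. of_nat (Suc n) * (p x * P x ^ n))"
proof (induction n)
  case 0
  then show ?case using P by simp
next
  case (Suc n)
  show ?case
    by (rule ac_primitive_cong[OF ac_primitive_mult[OF P Suc]]) (auto simp: algebra_simps)
qed

text \<open>The power rule for an indefinite integral of a merely integrable \<open>q\<close>; in
  the iteration it turns \<open>B^n / n!\<close> into \<open>B^(n+1) / (n+1)!\<close>. The complex
  detour is due to \<open>ac_primitive\<close> being complex-valued.\<close>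

lemma integral_power_primitive:
  fixes q :: "real \<Rightarrow> real"
  assumes q: "q absolutely_integrable_on {0..X}" and x: "x \<in> {0..X}"
  defines "B \<equiv> \<lambda>x. integral {0..x} q"
  shows "((\<lambda>t. q t * B t ^ n) has_integral B x ^ Suc n / real (Suc n)) {0..x}"
proof -
  have qi: "q integrable_on {0..y}" if "y \<in> {0..X}" for y
    by (rule integrable_on_subinterval[of _ "{0..X}"])
       (use q that in \<open>auto simp: set_lebesgue_integral_eq_integral\<close>)
  have "ac_primitive 0 X (\<lambda>x. of_real (B x)) (\<lambda>x. of_real (q x))"
    unfolding ac_primitive_def
  proof (intro conjI ballI)
    show "(\<lambda>x. complex_of_real (q x)) absolutely_integrable_on {0..X}"
      using absolutely_integrable_linear[OF q bounded_linear_of_real] by (simp add: o_def)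
    fix y assume y: "y \<in> {0..X}"
    have "(q has_integral B y - B 0) {0..y}" using integrable_integral[OF qi[OF y]] by (simp add: B_def)
    from has_integral_linear[OF this bounded_linear_of_real]
    show "((\<lambda>x. complex_of_real (q x)) has_integral of_real (B y) - of_real (B 0)) {0..y}"
      by (simp add: o_def)
  qed
  from ac_primitive_subinterval(2)[OF ac_primitive_power[OF this, of n], of 0 x]
  have "((\<lambda>t. of_nat (Suc n) * (complex_of_real (q t) * of_real (B t) ^ n)) has_integral
      (of_real (B x) ^ Suc n - of_real (B 0) ^ Suc n)) {0..x}" using x by simp
  from has_integral_linear[OF this bounded_linear_Re]
  have "((\<lambda>t. real (Suc n) * (q t * B t ^ n)) has_integral B x ^ Suc n) {0..x}"
    by (simp add: o_def B_def flip: of_real_power of_real_mult of_nat_Suc)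
  from has_integral_mult_right[OF this, of "1 / real (Suc n)"]
  show ?thesis by (simp del: of_nat_Suc)
qed

fun picard :: "(real \<Rightarrow> real) \<Rightarrow> complex \<Rightarrow> complex \<Rightarrow> complex \<Rightarrow> nat \<Rightarrow> (real \<Rightarrow> complex) \<times> (real \<Rightarrow> complex)" where
  "picard V z f g 0 = ((\<lambda>x. f), (\<lambda>x. g))"
| "picard V z f g (Suc n) = ((\<lambda>x. f + integral {0..x} (snd (picard V z f g n))),
     (\<lambda>x. g + integral {0..x} (\<lambda>t. (of_real (V t) - z) * fst (picard V z f g n) t)))"

text \<open>Successive iterates differ by at most \<open>C * B x ^ Suc n / fact (Suc n)\<close>, so
  they converge at each point, and dominated convergence takes the integral equations to the
  limit.\<close>

theorem schroedinger_solution_exists: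
  fixes f g z :: complex
  assumes V: "locally_integrable V"
  obtains F G where "F 0 = f" "G 0 = g" "\<And>b. sol V z 0 b F G"
proof -
  define F where "F n = fst (picard V z f g n)" for n
  define G where "G n = snd (picard V z f g n)" for n
  have F0: "F 0 x = f" and G0: "G 0 x = g" for x by (simp_all add: F_def G_def)
  have FS: "F (Suc n) x = f + integral {0..x} (G n)" for n x by (simp add: F_def G_def)
  have GS: "G (Suc n) x = g + integral {0..x} (\<lambda>t. (of_real (V t) - z) * F n t)" for n x by (simp add: F_def G_def)
  have V': "V absolutely_integrable_on {0..X}" for X by (rule locally_integrable_absolutely[OF V]) simp
  have cont: "continuous_on {0..X} (F n) \<and> continuous_on {0..X} (G n)" for n X
  proof (induction n)
    case 0
    then show ?case by (simp add: F_def G_def)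
  next
    case (Suc n)
    have "(\<lambda>t. (of_real (V t) - z) * F n t) integrable_on {0..X}"
      using absolutely_integrable_potential_term[OF V'] Suc by (blast intro: set_lebesgue_integral_eq_integral(1))
    then have "continuous_on {0..X} (\<lambda>x. g + integral {0..x} (\<lambda>t. (of_real (V t) - z) * F n t))"
      by (intro continuous_intros indefinite_integral_continuous_1)
    moreover have "continuous_on {0..X} (\<lambda>x. f + integral {0..x} (G n))"
      using Suc by (intro continuous_intros indefinite_integral_continuous_1 integrable_continuous_real) blast
    ultimately show ?case by (simp only: FS[abs_def] GS[abs_def])
  qed
  have Fc: "continuous_on {0..X} (F n)" and Gc: "continuous_on {0..X} (G n)" for X n using cont by auto
  have Gi: "G n integrable_on {0..x}" for n x by (rule integrable_continuous_real[OF Gc])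
  let ?Q = "\<lambda>t. of_real (V t) - z"
  have QFi: "(\<lambda>t. ?Q t * F n t) integrable_on {0..x}" for n x
    by (rule set_lebesgue_integral_eq_integral(1)[OF absolutely_integrable_potential_term[OF V' Fc]])
  \<comment> \<open>\<open>q\<close> dominates both coefficients of the first-order system, 1 and
    \<open>V - z\<close>, so one function \<open>B\<close> bounds the increments of both
    components.\<close>
  define q where "q x = 1 + norm (?Q x)" for x
  have q: "q absolutely_integrable_on {0..X}" for X
    unfolding q_def using absolutely_integrable_coefficient[OF V', of X z]
    by (intro set_integral_add(1)[OF absolutely_integrable_continuous_real[OF continuous_on_const]]
        absolutely_integrable_norm[unfolded o_def])
  define B where "B x = integral {0..x} q" for x
  have B0: "B x \<ge> 0" for x
    unfolding B_def using set_lebesgue_integral_eq_integral(1)[OF q] by (rule integral_nonneg) (simp add: q_def)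
  define C where "C = norm f + norm g"
  have C: "C \<ge> 0" by (simp add: C_def)
  have step: "((\<lambda>t. q t * (C * B t ^ n / fact n)) has_integral C * B x ^ Suc n / fact (Suc n)) {0..x}" if "x \<ge> 0" for x n
    using has_integral_mult_right[OF integral_power_primitive[OF q, of x x n], of "C / fact n"] that
    by (simp add: B_def field_simps)
  have diff: "norm (F (Suc n) x - F n x) \<le> C * B x ^ Suc n / fact (Suc n) \<and> norm (G (Suc n) x - G n x) \<le> C * B x ^ Suc n / fact (Suc n)"
    if "x \<ge> 0" for n x
    using that
  proof (induction n arbitrary: x)
    case 0
    have I0: "integral {0..x} (\<lambda>t. q t * (C * B t ^ 0 / fact 0)) = C * B x ^ Suc 0 / fact (Suc 0)"
      "(\<lambda>t. q t * (C * B t ^ 0 / fact 0)) integrable_on {0..x}"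
      using step[OF 0, of 0] by (auto simp: has_integral_iff)
    have b: "norm (?Q t * F 0 t) \<le> q t * C" "norm (G 0 t) \<le> q t * C" for t
    proof -
      have c: "norm f \<le> C" "norm g \<le> C" "norm (?Q t) \<le> q t" "1 \<le> q t" by (simp_all add: C_def q_def)
      then have "norm (?Q t) * norm f \<le> q t * C" by (intro mult_mono) auto
      then show "norm (?Q t * F 0 t) \<le> q t * C" by (simp add: F0 norm_mult)
      have "1 * norm g \<le> q t * C" using c by (intro mult_mono) auto
      then show "norm (G 0 t) \<le> q t * C" by (simp add: G0)
    qed
    have "norm (integral {0..x} (G 0)) \<le> integral {0..x} (\<lambda>t. q t * (C * B t ^ 0 / fact 0))"
      by (rule integral_norm_bound_integral[OF Gi I0(2)]) (use b in simp)
    moreover have "norm (integral {0..x} (\<lambda>t. ?Q t * F 0 t)) \<le> integral {0..x} (\<lambda>t. q t * (C * B t ^ 0 / fact 0))"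
      by (rule integral_norm_bound_integral[OF QFi I0(2)]) (use b in simp)
    moreover have "F (Suc 0) x - F 0 x = integral {0..x} (G 0)" "G (Suc 0) x - G 0 x = integral {0..x} (\<lambda>t. ?Q t * F 0 t)"
      by (simp_all only: FS GS F0[of x] G0[of x] add_diff_cancel_left')
    ultimately show ?case unfolding I0(1) by simp
  next
    case (Suc n)
    have "norm (F (Suc (Suc n)) x - F (Suc n) x) = norm (integral {0..x} (\<lambda>t. G (Suc n) t - G n t))"
      unfolding FS by (simp add: Henstock_Kurzweil_Integration.integral_diff[OF Gi Gi])
    also have "\<dots> \<le> C * B x ^ Suc (Suc n) / fact (Suc (Suc n))"
    proof (subst integral_unique[OF step[OF Suc.prems, of "Suc n"], symmetric], rule integral_norm_bound_integral)
      fix t assume t: "t \<in> {0..x}"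
      have b: "norm (G (Suc n) t - G n t) \<le> C * B t ^ Suc n / fact (Suc n)" using Suc.IH[of t] t by auto
      moreover have "1 * (C * B t ^ Suc n / fact (Suc n)) \<le> q t * (C * B t ^ Suc n / fact (Suc n))"
        using C B0 by (intro mult_right_mono) (auto simp: q_def)
      ultimately show "norm (G (Suc n) t - G n t) \<le> q t * (C * B t ^ Suc n / fact (Suc n))" by simp
    qed (use Gi step[OF Suc.prems, of "Suc n"] in \<open>auto intro!: integrable_diff\<close>)
    finally have 1: "norm (F (Suc (Suc n)) x - F (Suc n) x) \<le> C * B x ^ Suc (Suc n) / fact (Suc (Suc n))" .
    have "norm (G (Suc (Suc n)) x - G (Suc n) x) = norm (integral {0..x} (\<lambda>t. ?Q t * F (Suc n) t - ?Q t * F n t))"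
      unfolding GS by (simp add: Henstock_Kurzweil_Integration.integral_diff[OF QFi QFi])
    also have "\<dots> \<le> C * B x ^ Suc (Suc n) / fact (Suc (Suc n))"
    proof (subst integral_unique[OF step[OF Suc.prems, of "Suc n"], symmetric], rule integral_norm_bound_integral)
      fix t assume t: "t \<in> {0..x}"
      have b: "norm (F (Suc n) t - F n t) \<le> C * B t ^ Suc n / fact (Suc n)" using Suc.IH[of t] t by auto
      show "norm (?Q t * F (Suc n) t - ?Q t * F n t) \<le> q t * (C * B t ^ Suc n / fact (Suc n))"
        unfolding right_diff_distrib[symmetric] norm_mult using b
        by (intro mult_mono) (auto simp: q_def)
    qed (use QFi step[OF Suc.prems, of "Suc n"] in \<open>auto intro!: integrable_diff\<close>)
    finally show ?case using 1 by blast
  qed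
  have summ: "summable (\<lambda>n. C * B x ^ Suc n / fact (Suc n))" for x
  proof -
    have "summable (\<lambda>n. C * (B x ^ n /\<^sub>R fact n))" by (rule summable_mult[OF summable_exp_generic])
    then have "summable (\<lambda>n. C * (B x ^ Suc n /\<^sub>R fact (Suc n)))" by (subst summable_Suc_iff)
    then show ?thesis by (simp add: field_simps)
  qed
  have conv: "\<exists>l. (\<lambda>n. H n x) \<longlonglongrightarrow> l"
    if "\<And>n. norm (H (Suc n) x - H n x) \<le> C * B x ^ Suc n / fact (Suc n)" for H :: "nat \<Rightarrow> real \<Rightarrow> complex" and x
  proof -
    have "summable (\<lambda>n. H (Suc n) x - H n x)"
      by (rule summable_comparison_test'[OF summ[of x], of 0]) (use that in auto)
    from summable_LIMSEQ[OF this]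
    have "(\<lambda>n. H n x - H 0 x) \<longlonglongrightarrow> (\<Sum>n. H (Suc n) x - H n x)"
      by (simp only: sum_lessThan_telescope[of "\<lambda>i. H i x"])
    from tendsto_add[OF this tendsto_const[of "H 0 x"]] show ?thesis by auto
  qed
  have "\<forall>x\<ge>0. \<exists>l. (\<lambda>n. F n x) \<longlonglongrightarrow> l" "\<forall>x\<ge>0. \<exists>l. (\<lambda>n. G n x) \<longlonglongrightarrow> l"
    using conv[of F] conv[of G] diff by blast+
  then obtain F' G' where F': "\<And>x. x \<ge> 0 \<Longrightarrow> (\<lambda>n. F n x) \<longlonglongrightarrow> F' x" and G': "\<And>x. x \<ge> 0 \<Longrightarrow> (\<lambda>n. G n x) \<longlonglongrightarrow> G' x"
    by metis
  define K where "K X = C + (\<Sum>n. C * B X ^ Suc n / fact (Suc n))" for X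
  have Bmono: "B x \<le> B X" if "0 \<le> x" "x \<le> X" for x X
    unfolding B_def by (rule integral_subset_le)
      (use that set_lebesgue_integral_eq_integral(1)[OF q] in \<open>auto simp: q_def\<close>)
  have bnd: "norm (H n x) \<le> K X"
    if "\<And>n. norm (H (Suc n) x - H n x) \<le> C * B x ^ Suc n / fact (Suc n)" "norm (H 0 x) \<le> C" "0 \<le> x" "x \<le> X"
    for H :: "nat \<Rightarrow> real \<Rightarrow> complex" and x X n
  proof -
    have "H n x = H 0 x + (\<Sum>i<n. H (Suc i) x - H i x)" by (simp add: sum_lessThan_telescope[of "\<lambda>i. H i x"])
    then have "norm (H n x) \<le> norm (H 0 x) + norm (\<Sum>i<n. H (Suc i) x - H i x)" by (metis norm_triangle_ineq)
    also have "\<dots> \<le> C + (\<Sum>i<n. C * B X ^ Suc i / fact (Suc i))"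
    proof (intro add_mono that(2) sum_norm_le)
      fix i
      have "norm (H (Suc i) x - H i x) \<le> C * B x ^ Suc i / fact (Suc i)" by (rule that(1))
      also have "\<dots> \<le> C * B X ^ Suc i / fact (Suc i)"
        using C B0 Bmono[OF that(3,4)] by (intro divide_right_mono mult_left_mono power_mono) auto
      finally show "norm (H (Suc i) x - H i x) \<le> C * B X ^ Suc i / fact (Suc i)" .
    qed
    also have "\<dots> \<le> K X"
      unfolding K_def using C B0 by (intro add_left_mono sum_le_suminf[OF summ]) auto
    finally show ?thesis .
  qed
  have Fb: "norm (F n x) \<le> K X" and Gb: "norm (G n x) \<le> K X" if "0 \<le> x" "x \<le> X" for n x X
    using bnd[of F x X n] bnd[of G x X n] diff[OF that(1)] that by (auto simp: F0 G0 C_def)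
  have FI: "G' integrable_on {0..x} \<and> F' x = f + integral {0..x} G'" if x: "x \<ge> 0" for x
  proof -
    have h: "(\<lambda>_. K x) integrable_on {0..x}" by (rule integrable_const_ivl)
    have b: "norm (G n t) \<le> K x" if "t \<in> {0..x}" for n t using Gb that by auto
    have l: "(\<lambda>n. G n t) \<longlonglongrightarrow> G' t" if "t \<in> {0..x}" for t using G' that by auto
    note * = dominated_convergence[of G, OF Gi h b l]
    have "(\<lambda>n. F (Suc n) x) \<longlonglongrightarrow> f + integral {0..x} G'"
      unfolding FS by (intro tendsto_intros *)
    from LIMSEQ_unique[OF LIMSEQ_Suc[OF F'[OF x]] this] *(1) show ?thesis by blast
  qed
  have GI: "(\<lambda>t. ?Q t * F' t) integrable_on {0..x} \<and> G' x = g + integral {0..x} (\<lambda>t. ?Q t * F' t)" if x: "x \<ge> 0" for x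
  proof -
    have h: "(\<lambda>t. q t * K x) integrable_on {0..x}"
      using integrable_on_cmult_left[OF set_lebesgue_integral_eq_integral(1)[OF q], of "K x" x] by (simp add: mult.commute)
    have b: "norm (?Q t * F n t) \<le> q t * K x" if "t \<in> {0..x}" for n t
      unfolding norm_mult using Fb[of t x n] that by (intro mult_mono) (auto simp: q_def)
    have l: "(\<lambda>n. ?Q t * F n t) \<longlonglongrightarrow> ?Q t * F' t" if "t \<in> {0..x}" for t
      using that by (intro tendsto_intros F') auto
    note dc = dominated_convergence[of "\<lambda>n t. ?Q t * F n t", OF QFi h b l]
    have "(\<lambda>n. G (Suc n) x) \<longlonglongrightarrow> g + integral {0..x} (\<lambda>t. ?Q t * F' t)"
      unfolding GS by (intro tendsto_intros dc(2))
    from LIMSEQ_unique[OF LIMSEQ_Suc[OF G'[OF x]] this] dc(1) show ?thesis by blast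
  qed
  have F'0: "F' 0 = f" and G'0: "G' 0 = g" using FI[of 0] GI[of 0] by auto
  have S: "sol V z 0 b F' G'" if "b \<ge> 0" for b
  proof (rule solI[OF V'])
    show "continuous_on {0..b} F'"
    proof (rule continuous_on_eq)
      show "continuous_on {0..b} (\<lambda>x. f + integral {0..x} G')"
        by (rule continuous_on_add[OF continuous_on_const indefinite_integral_continuous_1[OF conjunct1[OF FI[OF that]]]])
      show "f + integral {0..x} G' = F' x" if "x \<in> {0..b}" for x
        by (rule conjunct2[OF FI, symmetric]) (use that in simp)
    qed
    show "continuous_on {0..b} G'"
    proof (rule continuous_on_eq)
      show "continuous_on {0..b} (\<lambda>x. g + integral {0..x} (\<lambda>t. ?Q t * F' t))"
        by (rule continuous_on_add[OF continuous_on_const indefinite_integral_continuous_1[OF conjunct1[OF GI[OF that]]]])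
      show "g + integral {0..x} (\<lambda>t. ?Q t * F' t) = G' x" if "x \<in> {0..b}" for x
        by (rule conjunct2[OF GI, symmetric]) (use that in simp)
    qed
    show "(G' has_integral F' x - F' 0) {0..x}" if "x \<in> {0..b}" for x
    proof -
      have "x \<ge> 0" using that by simp
      then have "G' integrable_on {0..x}" "F' x = f + integral {0..x} G'" using FI by blast+
      then show ?thesis using integrable_integral[of G' "{0..x}"] F'0 by (metis add_diff_cancel_left')
    qed
    show "((\<lambda>t. ?Q t * F' t) has_integral G' x - G' 0) {0..x}" if "x \<in> {0..b}" for x
    proof -
      have "x \<ge> 0" using that by simp
      then have *: "(\<lambda>t. ?Q t * F' t) integrable_on {0..x}" "G' x = g + integral {0..x} (\<lambda>t. ?Q t * F' t)" using GI by blast+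
      then show ?thesis using integrable_integral[OF *(1)] G'0 by (metis add_diff_cancel_left')
    qed
  qed
  have "sol V z 0 b F' G'" for b
    using S[of "max b 0"] sol_restrict[of V z 0 "max b 0" F' G' 0 b] by simp
  from that[OF F'0 G'0 this] show ?thesis .
qed

lemma wronskian_constant:
  assumes "sol V z a b F G" "sol V z a b F' G'" "x \<in> {a..b}"
  shows "F x * G' x - G x * F' x = F a * G' a - G a * F' a"
proof -
  let ?q = "\<lambda>x. of_real (V x) - z"
  have "ac_primitive a b (\<lambda>x. F x * G' x - G x * F' x)
      (\<lambda>x. (F x * (?q x * F' x) + G' x * G x) - (G x * G' x + F' x * (?q x * F x)))"
    using assms unfolding sol_def by (intro ac_primitive_diff ac_primitive_mult) auto
  then have "ac_primitive a b (\<lambda>x. F x * G' x - G x * F' x) (\<lambda>x. 0)"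
    by (rule ac_primitive_cong) (auto simp: algebra_simps)
  from ac_primitive_subinterval(2)[OF this order_refl, of x] assms(3)
  have "((\<lambda>x. 0) has_integral (F x * G' x - G x * F' x - (F a * G' a - G a * F' a))) {a..x}" by simp
  from has_integral_unique[OF this has_integral_0] show ?thesis by simp
qed

text \<open>Uniqueness has been shown from the left endpoint. The Wronskians with \<open>u\<close>
  and \<open>v\<close> are constant, vanish at \<open>y\<close> and equal \<open>- G a\<close> and
  \<open>F a\<close> at \<open>a\<close>, which carries zero data back to \<open>a\<close>.\<close>

lemma sol_zero_of_zero:
  assumes V: "V absolutely_integrable_on {a..b}" and S: "sol V z a b F G"
    and y: "y \<in> {a..b}" "F y = 0" "G y = 0" and uv: "sol V z a b u u'" "sol V z a b v v'"
    and init: "u a = 1" "u' a = 0" "v a = 0" "v' a = 1" and x: "x \<in> {a..b}"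
  shows "F x = 0 \<and> G x = 0"
proof -
  have a: "F a = 0" "G a = 0"
    using wronskian_constant[OF S uv(1) y(1)] wronskian_constant[OF S uv(2) y(1)] y init by simp_all
  have "sol V z a b (\<lambda>x. 0 * F x + 0 * F x) (\<lambda>x. 0 * G x + 0 * G x)" by (rule sol_linear[OF S S])
  then have "sol V z a b (\<lambda>x. 0) (\<lambda>x. 0)" by simp
  from sol_unique[OF V S this _ _ x] a show ?thesis by simp
qed

section \<open>Estimates of solutions\<close>

text \<open>Where \<open>F x\<close> is nonzero this is
  \<open>(cmod (F x))\<^sup>2 * Im (G x / F x)\<close>, so its sign decides whether the logarithmic
  derivative lies in the upper half-plane.\<close>

definition energy :: "(real \<Rightarrow> complex) \<Rightarrow> (real \<Rightarrow> complex) \<Rightarrow> real \<Rightarrow> real" where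
  "energy F G x = Im (G x * cnj (F x))"

text \<open>\<open>V\<close> is real and drops out of the imaginary part of the derivative of
  \<open>G * cnj F\<close>; only \<open>- Im z * (cmod F)\<^sup>2\<close> is left.\<close>

lemma energy_identity:
  assumes S: "sol V z a b F G" and x: "a \<le> x" "x \<le> y" "y \<le> b"
  shows "energy F G x = energy F G y + Im z * integral {x..y} (\<lambda>t. (cmod (F t))\<^sup>2)"
proof -
  let ?q = "\<lambda>x. of_real (V x) - z"
  have "ac_primitive a b (\<lambda>x. G x * cnj (F x)) (\<lambda>x. G x * cnj (G x) + cnj (F x) * (?q x * F x))"
    using S unfolding sol_def by (intro ac_primitive_mult ac_primitive_cnj) auto
  from ac_primitive_subinterval(2)[OF this x]
  have "((\<lambda>x. G x * cnj (G x) + cnj (F x) * (?q x * F x)) has_integral (G y * cnj (F y) - G x * cnj (F x))) {x..y}" .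
  from has_integral_linear[OF this bounded_linear_Im]
  have "((\<lambda>x. Im (G x * cnj (G x) + cnj (F x) * (?q x * F x))) has_integral energy F G y - energy F G x) {x..y}"
    by (simp add: o_def energy_def)
  moreover have "Im (G x * cnj (G x) + cnj (F x) * (?q x * F x)) = - Im z * (cmod (F x))\<^sup>2" for x
    by (simp add: cmod_power2) (simp add: algebra_simps power2_eq_square)
  ultimately have "((\<lambda>x. - Im z * (cmod (F x))\<^sup>2) has_integral energy F G y - energy F G x) {x..y}"
    by (simp only:)
  from integral_unique[OF this] show ?thesis by simp
qed

lemma sol_square_integrable_interval:
  assumes "sol V z a b F G" "a \<le> x" "y \<le> b"
  shows "(\<lambda>t. (cmod (F t))\<^sup>2) integrable_on {x..y}"
proof (rule integrable_continuous_real)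
  have "continuous_on {x..y} F" by (rule continuous_on_subset[OF sol_continuous(1)[OF assms(1)]]) (use assms in auto)
  then show "continuous_on {x..y} (\<lambda>t. (cmod (F t))\<^sup>2)" by (intro continuous_intros)
qed

text \<open>Green's formula with a test function that vanishes to second order at \<open>d\<close>:
  the values of the solution at \<open>d\<close> drop out, and the boundary term at \<open>c\<close>
  is the quantity to be estimated.\<close>

lemma test_function_identity:
  assumes S: "sol V z c d F G" and cd: "c \<le> d" and \<psi>: "ac_primitive c d \<psi> \<psi>'" "ac_primitive c d \<psi>' \<psi>''"
    and d: "\<psi> d = 0" "\<psi>' d = 0"
  shows "((\<lambda>x. \<psi> x * ((of_real (V x) - z) * F x) - F x * \<psi>'' x) has_integral (\<psi>' c * F c - \<psi> c * G c)) {c..d}"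
proof -
  let ?q = "\<lambda>x. of_real (V x) - z"
  have "ac_primitive c d (\<lambda>x. \<psi> x * G x - F x * \<psi>' x)
      (\<lambda>x. (\<psi> x * (?q x * F x) + G x * \<psi>' x) - (F x * \<psi>'' x + \<psi>' x * G x))"
    using S \<psi> unfolding sol_def by (intro ac_primitive_diff ac_primitive_mult) auto
  then have "ac_primitive c d (\<lambda>x. \<psi> x * G x - F x * \<psi>' x) (\<lambda>x. \<psi> x * (?q x * F x) - F x * \<psi>'' x)"
    by (rule ac_primitive_cong) (auto simp: algebra_simps)
  from ac_primitive_subinterval(2)[OF this order_refl cd order_refl]
  show ?thesis by (simp add: d mult.commute)
qed

text \<open>The integral is 0 by convention if the square is not integrable, so integrability is
  carried along as a separate assumption.\<close>

definition square_integral :: "(real \<Rightarrow> real) \<Rightarrow> real \<Rightarrow> real \<Rightarrow> real" where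
  "square_integral V c d = integral {c..d} (\<lambda>x. (V x)\<^sup>2)"

text \<open>The bound \<open>r \<bar>F\<bar> \<le> (s \<bar>F\<bar>\<^sup>2 + r\<^sup>2 / s) / 2\<close> with \<open>r = \<bar>V\<bar> + \<rho>\<close> replaces the
  Cauchy-Schwarz inequality.\<close>

lemma test_function_estimate:
  assumes S: "sol V z c d F G" and cd: "c \<le> d" and \<psi>: "ac_primitive c d \<psi> \<psi>'" "ac_primitive c d \<psi>' \<psi>''"
    and d: "\<psi> d = 0" "\<psi>' d = 0"
    and b: "\<And>x. x \<in> {c..d} \<Longrightarrow> norm (\<psi> x) \<le> 1" "\<And>x. x \<in> {c..d} \<Longrightarrow> norm (\<psi>'' x + z * \<psi> x) \<le> \<rho>"
    and V2: "(\<lambda>x. (V x)\<^sup>2) integrable_on {c..d}" and s: "s > 0"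
  shows "norm (\<psi> c * G c - \<psi>' c * F c) \<le> (s * integral {c..d} (\<lambda>x. (cmod (F x))\<^sup>2)
    + (2 * square_integral V c d + 2 * \<rho>\<^sup>2 * (d - c)) / s) / 2"
proof -
  let ?q = "\<lambda>x. of_real (V x) - z"
  let ?f = "\<lambda>x. \<psi> x * (?q x * F x) - F x * \<psi>'' x"
  note I = test_function_identity[OF S cd \<psi> d]
  have F2: "(\<lambda>t. (cmod (F t))\<^sup>2) integrable_on {c..d}" by (rule sol_square_integrable_interval[OF S]) auto
  let ?g = "\<lambda>x. (s / 2) * (cmod (F x))\<^sup>2 + ((1 / s) * (V x)\<^sup>2 + \<rho>\<^sup>2 / s)"
  have hi: "(?g has_integral ((s / 2) * integral {c..d} (\<lambda>x. (cmod (F x))\<^sup>2)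
      + ((1 / s) * square_integral V c d + (d - c) *\<^sub>R (\<rho>\<^sup>2 / s)))) {c..d}"
    unfolding square_integral_def
    by (intro has_integral_add has_integral_mult_right integrable_integral F2 V2 has_integral_const_real[of _ c d, unfolded content_real[OF cd]])
  have le: "norm (?f x) \<le> ?g x" if x: "x \<in> {c..d}" for x
  proof -
    have "?f x = (of_real (V x) * \<psi> x - (\<psi>'' x + z * \<psi> x)) * F x" by (simp add: algebra_simps)
    then have "norm (?f x) = norm (of_real (V x) * \<psi> x - (\<psi>'' x + z * \<psi> x)) * cmod (F x)" by (simp add: norm_mult)
    also have "\<dots> \<le> (\<bar>V x\<bar> * 1 + \<rho>) * cmod (F x)"
    proof (rule mult_right_mono)
      have "norm (of_real (V x) * \<psi> x) \<le> \<bar>V x\<bar> * 1" unfolding norm_mult using b(1)[OF x] by (intro mult_mono) auto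
      then show "norm (of_real (V x) * \<psi> x - (\<psi>'' x + z * \<psi> x)) \<le> \<bar>V x\<bar> * 1 + \<rho>"
        using norm_triangle_ineq4[of "of_real (V x) * \<psi> x" "\<psi>'' x + z * \<psi> x"] b(2)[OF x] by linarith
    qed simp
    also have "\<dots> \<le> ?g x"
    proof -
      define r where "r = \<bar>V x\<bar> + \<rho>"
      define f where "f = cmod (F x)"
      have "0 \<le> (s * f - r)\<^sup>2" by simp
      then have "2 * (s * (r * f)) \<le> s\<^sup>2 * f\<^sup>2 + r\<^sup>2" by (simp add: power2_eq_square algebra_simps)
      moreover have "r\<^sup>2 \<le> 2 * (V x)\<^sup>2 + 2 * \<rho>\<^sup>2"
        using zero_le_power2[of "\<bar>V x\<bar> - \<rho>"] unfolding r_def by (simp add: power2_eq_square algebra_simps)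
      ultimately have "2 * (s * (r * f)) \<le> s\<^sup>2 * f\<^sup>2 + (2 * (V x)\<^sup>2 + 2 * \<rho>\<^sup>2)" by linarith
      then have "r * f \<le> (s\<^sup>2 * f\<^sup>2 + (2 * (V x)\<^sup>2 + 2 * \<rho>\<^sup>2)) / (2 * s)" using s by (simp add: pos_le_divide_eq mult_ac)
      also have "\<dots> = (s / 2) * f\<^sup>2 + ((1 / s) * (V x)\<^sup>2 + \<rho>\<^sup>2 / s)"
        using s by (simp add: field_simps power2_eq_square)
      finally show ?thesis by (simp add: r_def f_def)
    qed
    finally show ?thesis .
  qed
  have "norm (\<psi>' c * F c - \<psi> c * G c) = norm (integral {c..d} ?f)" using I by (simp add: integral_unique)
  also have "\<dots> \<le> integral {c..d} ?g"
    using I hi le by (intro integral_norm_bound_integral) blast+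
  also have "\<dots> = (s * integral {c..d} (\<lambda>x. (cmod (F x))\<^sup>2)
    + (2 * square_integral V c d + 2 * \<rho>\<^sup>2 * (d - c)) / s) / 2"
    unfolding integral_unique[OF hi] using s by (simp add: field_simps)
  finally show ?thesis by (simp only: norm_minus_commute[of "\<psi> c * G c"])
qed

lemma csqrt_bounds:
  assumes "Im z > 0"
  shows "Im (csqrt z) > 0" "(\<i> * csqrt z)\<^sup>2 = - z"
  using csqrt_upper_half_plane(2)[OF assms] by (simp_all add: power_mult_distrib)

text \<open>The test function is \<open>((d - x) / (d - c))\<^sup>2 exp (\<i> \<surd>z (x - c))\<close>: it vanishes to second order at
  \<open>d\<close>, so that no boundary terms arise there, and it solves the free equation up to
  \<open>O (1 / (d - c))\<close>.\<close>

lemma m_value_estimate: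
  fixes z :: complex
  assumes S: "sol V z c d F G" and cd: "c < d" and z: "Im z > 0" and en: "energy F G d \<ge> 0" and F: "F c \<noteq> 0"
    and V2: "(\<lambda>x. (V x)\<^sup>2) integrable_on {c..d}" and s: "s > 0"
  defines "L \<equiv> d - c" and "m \<equiv> G c / F c"
  shows "cmod (m - \<i> * csqrt z) \<le> 2 / L + (s * cmod m / Im z
    + (2 * square_integral V c d + 2 * (2 / L\<^sup>2 + 4 * cmod (csqrt z) / L)\<^sup>2 * L) / s) / 2"
proof -
  have L: "L > 0" using cd by (simp add: L_def)
  define k where "k = \<i> * csqrt z"
  have kk: "k * k = - z" using csqrt_bounds(2)[OF z] by (simp add: k_def power2_eq_square)
  \<comment> \<open>The exponential factor therefore does not grow to the right of \<open>c\<close>,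
    which keeps \<open>\<psi>\<close> bounded by 1.\<close>
  have Rek: "Re k \<le> 0" using csqrt_bounds(1)[OF z] by (simp add: k_def)
  have nk: "cmod k = cmod (csqrt z)" by (simp add: k_def norm_mult)
  define \<phi> where "\<phi> x = complex_of_real ((d - x) / L)" for x
  define e where "e x = exp (k * of_real (x - c))" for x
  define \<psi> where "\<psi> x = \<phi> x * \<phi> x * e x" for x
  define \<psi>' where "\<psi>' x = (- 2 / of_real L) * (\<phi> x * e x) + k * \<psi> x" for x
  define \<psi>'' where "\<psi>'' x = (2 / of_real (L\<^sup>2)) * e x + (- 4 * k / of_real L) * (\<phi> x * e x) + k * k * \<psi> x" for x
  have d\<phi>: "(\<phi> has_vector_derivative (- 1 / of_real L)) (at x within T)" for x T
    unfolding \<phi>_def using L by (auto intro!: derivative_eq_intros simp: field_simps)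
  have de: "(e has_vector_derivative (k * e x)) (at x within T)" for x T
  proof -
    have "((\<lambda>x. of_real (x - c) :: complex) has_vector_derivative 1) (at x within T)"
      by (auto intro!: derivative_eq_intros)
    moreover have "((\<lambda>w. exp (k * w)) has_field_derivative (k * e x)) (at (of_real (x - c)))"
      unfolding e_def by (auto intro!: derivative_eq_intros)
    ultimately have "((\<lambda>w. exp (k * w)) \<circ> (\<lambda>x. of_real (x - c)) has_vector_derivative (1 * (k * e x))) (at x within T)"
      by (intro field_vector_diff_chain_within) (auto intro: has_field_derivative_at_within)
    then show ?thesis unfolding e_def[abs_def] o_def by simp
  qed
  have d\<psi>: "(\<psi> has_vector_derivative \<psi>' x) (at x within T)" for x T
  proof -
    have "(\<psi> has_vector_derivative (\<phi> x * \<phi> x) * (k * e x) + (\<phi> x * (- 1 / of_real L) + (- 1 / of_real L) * \<phi> x) * e x) (at x within T)"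
      unfolding \<psi>_def by (intro has_vector_derivative_mult d\<phi> de)
    then show ?thesis by (simp add: \<psi>'_def \<psi>_def algebra_simps)
  qed
  have d\<psi>': "(\<psi>' has_vector_derivative \<psi>'' x) (at x within T)" for x T
  proof -
    have "(\<psi>' has_vector_derivative ((- 2 / of_real L) * (\<phi> x * (k * e x) + (- 1 / of_real L) * e x) + k * \<psi>' x)) (at x within T)"
      unfolding \<psi>'_def[abs_def]
      by (intro has_vector_derivative_add has_vector_derivative_mult_right has_vector_derivative_mult d\<phi> de d\<psi>[unfolded \<psi>'_def])
    moreover have "(- 2 / of_real L) * (\<phi> x * (k * e x) + (- 1 / of_real L) * e x) + k * \<psi>' x = \<psi>'' x"
      by (simp add: \<psi>'_def \<psi>''_def algebra_simps power2_eq_square)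
    ultimately show ?thesis by simp
  qed
  have c\<phi>: "continuous_on T \<phi>" and ce: "continuous_on T e" for T
    unfolding \<phi>_def e_def using L by (auto intro!: continuous_intros)
  have ac1: "ac_primitive c d \<psi> \<psi>'"
    by (rule ac_primitiveI_continuous[OF d\<psi>]) (unfold \<psi>'_def \<psi>_def, intro continuous_intros c\<phi> ce)
  have ac2: "ac_primitive c d \<psi>' \<psi>''"
    by (rule ac_primitiveI_continuous[OF d\<psi>']) (unfold \<psi>''_def \<psi>_def, intro continuous_intros c\<phi> ce)
  have \<phi>d: "\<phi> d = 0" and \<phi>c: "\<phi> c = 1" and ec: "e c = 1" using L by (auto simp: \<phi>_def e_def L_def)
  have n\<phi>: "norm (\<phi> x) \<le> 1" and ne: "norm (e x) \<le> 1" if x: "x \<in> {c..d}" for x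
  proof -
    show "norm (\<phi> x) \<le> 1" using x L by (auto simp: \<phi>_def L_def norm_divide simp flip: of_real_diff)
    have "Re (k * of_real (x - c)) \<le> 0" using Rek x by (simp add: mult_nonpos_nonneg)
    then show "norm (e x) \<le> 1" by (simp add: e_def)
  qed
  have n\<psi>: "norm (\<psi> x) \<le> 1" if "x \<in> {c..d}" for x
    unfolding \<psi>_def norm_mult using n\<phi>[OF that] ne[OF that] by (intro mult_le_one) auto
  have n2: "norm (\<psi>'' x + z * \<psi> x) \<le> 2 / L\<^sup>2 + 4 * cmod (csqrt z) / L" if "x \<in> {c..d}" for x
  proof -
    have "\<psi>'' x + z * \<psi> x = (2 / of_real (L\<^sup>2)) * e x + (- 4 * k / of_real L) * (\<phi> x * e x)"
      unfolding \<psi>''_def kk by simp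
    also have "norm \<dots> \<le> norm ((2 / of_real (L\<^sup>2)) * e x) + norm ((- 4 * k / of_real L) * (\<phi> x * e x))"
      by (rule norm_triangle_ineq)
    also have "\<dots> \<le> (2 / L\<^sup>2) * 1 + (4 * cmod (csqrt z) / L) * (1 * 1)"
      unfolding norm_mult using n\<phi>[OF that] ne[OF that] L
      by (intro add_mono mult_mono) (auto simp: norm_divide norm_mult nk norm_power)
    finally show ?thesis by simp
  qed
  \<comment> \<open>Here the nonnegative current at \<open>d\<close> enters: it bounds
    \<open>Im z\<close> times the integral of \<open>(cmod F)\<^sup>2\<close> by the current at
    \<open>c\<close>. Division by \<open>(cmod (F c))\<^sup>2\<close> turns this into the bound
    \<open>cmod m / Im z\<close>.\<close>
  have I: "Im z * integral {c..d} (\<lambda>x. (cmod (F x))\<^sup>2) \<le> cmod (G c) * cmod (F c)"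
  proof -
    have "Im z * integral {c..d} (\<lambda>x. (cmod (F x))\<^sup>2) \<le> energy F G c"
      using energy_identity[OF S order_refl _ order_refl] cd en by simp
    also have "\<dots> \<le> cmod (G c * cnj (F c))" unfolding energy_def by (rule order_trans[OF abs_ge_self abs_Im_le_cmod])
    finally show ?thesis by (simp add: norm_mult)
  qed
  have S1: "sol V z c d (\<lambda>x. (1 / F c) * F x + 0 * F x) (\<lambda>x. (1 / F c) * G x + 0 * G x)"
    by (rule sol_linear[OF S S])
  then have S1: "sol V z c d (\<lambda>x. F x / F c) (\<lambda>x. G x / F c)" by simp
  have int1: "integral {c..d} (\<lambda>x. (cmod (F x / F c))\<^sup>2) \<le> cmod m / Im z"
  proof -
    have "integral {c..d} (\<lambda>x. (cmod (F x / F c))\<^sup>2) = integral {c..d} (\<lambda>x. (cmod (F x))\<^sup>2) / (cmod (F c))\<^sup>2"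
      by (simp add: norm_divide power_divide)
    also have "\<dots> \<le> (cmod (G c) * cmod (F c) / Im z) / (cmod (F c))\<^sup>2"
      using I z by (intro divide_right_mono) (auto simp: pos_le_divide_eq mult.commute)
    also have "\<dots> = cmod m / Im z" using F by (simp add: m_def norm_divide power2_eq_square)
    finally show ?thesis .
  qed
  \<comment> \<open>Differentiating the squared cut-off at \<open>c\<close> gives
    \<open>- 2 / L\<close>; this is the source of the summand \<open>2 / L\<close> in the
    estimate.\<close>
  have "\<psi>' c = - 2 / of_real L + k" "\<psi> c = 1" by (simp_all add: \<psi>'_def \<psi>_def \<phi>c ec)
  then have eq: "\<psi> c * (G c / F c) - \<psi>' c * (F c / F c) = m - k + 2 / of_real L"
    using F by (simp add: m_def)
  have "cmod (m - k) \<le> cmod (m - k + 2 / of_real L) + cmod (2 / of_real L)"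
    using norm_triangle_ineq4[of "m - k + 2 / of_real L" "2 / of_real L"] by simp
  also have "cmod (2 / of_real L :: complex) = 2 / L" using L by (simp add: norm_divide)
  also have "cmod (m - k + 2 / of_real L) \<le> (s * integral {c..d} (\<lambda>x. (cmod (F x / F c))\<^sup>2)
    + (2 * square_integral V c d + 2 * (2 / L\<^sup>2 + 4 * cmod (csqrt z) / L)\<^sup>2 * (d - c)) / s) / 2"
    unfolding eq[symmetric]
    by (rule test_function_estimate[OF S1 less_imp_le[OF cd] ac1 ac2 _ _ n\<psi> n2 V2 s])
       (auto simp: \<psi>_def \<psi>'_def \<phi>d)
  also have "\<dots> \<le> (s * (cmod m / Im z)
    + (2 * square_integral V c d + 2 * (2 / L\<^sup>2 + 4 * cmod (csqrt z) / L)\<^sup>2 * L) / s) / 2"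
    unfolding L_def using int1 s by (intro divide_right_mono add_right_mono mult_left_mono) auto
  finally show ?thesis by (simp add: k_def)
qed

section \<open>Analytic dependence on the spectral parameter\<close>

definition cauchy_solution :: "(real \<Rightarrow> real) \<Rightarrow> complex \<Rightarrow> complex \<Rightarrow> complex \<Rightarrow> (real \<Rightarrow> complex) \<times> (real \<Rightarrow> complex)" where
  "cauchy_solution V z f g = (SOME p. fst p 0 = f \<and> snd p 0 = g \<and> (\<forall>b. sol V z 0 b (fst p) (snd p)))"

lemma cauchy_solution:
  assumes "locally_integrable V"
  shows "fst (cauchy_solution V z f g) 0 = f" "snd (cauchy_solution V z f g) 0 = g"
    "sol V z 0 b (fst (cauchy_solution V z f g)) (snd (cauchy_solution V z f g))"
proof -
  obtain F G where "F 0 = f" "G 0 = g" "\<And>b. sol V z 0 b F G"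
    using schroedinger_solution_exists[OF assms, of f g z] by metis
  then have "\<exists>p. fst p 0 = f \<and> snd p 0 = g \<and> (\<forall>b. sol V z 0 b (fst p) (snd p))"
    by (intro exI[of _ "(F, G)"]) simp
  from someI_ex[OF this]
  show "fst (cauchy_solution V z f g) 0 = f" "snd (cauchy_solution V z f g) 0 = g"
    "sol V z 0 b (fst (cauchy_solution V z f g)) (snd (cauchy_solution V z f g))"
    unfolding cauchy_solution_def by blast+
qed

text \<open>The choice behind \<open>cauchy_solution\<close> is arbitrary at negative arguments
  only.\<close>

lemma cauchy_solution_unique:
  assumes V: "locally_integrable V" and S: "\<And>b. sol V z 0 b F G" and x: "x \<ge> 0"
  shows "F x = fst (cauchy_solution V z (F 0) (G 0)) x" "G x = snd (cauchy_solution V z (F 0) (G 0)) x"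
  using sol_unique[OF locally_integrable_absolutely[OF V order_refl] S[of x] cauchy_solution(3)[OF V], of "F 0" "G 0" x]
    cauchy_solution(1,2)[OF V, of z "F 0" "G 0"] x by simp_all

text \<open>Variation of constants: the difference of the solutions for \<open>w\<close> and \<open>z\<close> is \<open>w - z\<close> times an
  expression that is continuous in \<open>w\<close>.\<close>

lemma sol_parameter_difference:
  assumes Sw: "sol V w 0 b Fw Gw" and Sz: "sol V z 0 b Fz Gz" and init: "Fw 0 = Fz 0" "Gw 0 = Gz 0"
    and u: "sol V z 0 b u u'" "u 0 = 1" "u' 0 = 0" and v: "sol V z 0 b v v'" "v 0 = 0" "v' 0 = 1"
    and t: "t \<in> {0..b}"
  shows "Fw t - Fz t = (w - z) * (u t * integral {0..t} (\<lambda>x. Fw x * v x) - v t * integral {0..t} (\<lambda>x. Fw x * u x))"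
    "Gw t - Gz t = (w - z) * (u' t * integral {0..t} (\<lambda>x. Fw x * v x) - v' t * integral {0..t} (\<lambda>x. Fw x * u x))"
proof -
  let ?q = "\<lambda>z x. of_real (V x) - z"
  have key: "(Fw t - Fz t) * h' t - (Gw t - Gz t) * h t = (w - z) * integral {0..t} (\<lambda>x. Fw x * h x)"
    if h: "sol V z 0 b h h'" for h h'
  proof -
    have "ac_primitive 0 b (\<lambda>x. (Fw x - Fz x) * h' x - (Gw x - Gz x) * h x)
      (\<lambda>x. ((Fw x - Fz x) * (?q z x * h x) + h' x * (Gw x - Gz x))
        - ((Gw x - Gz x) * h' x + h x * (?q w x * Fw x - ?q z x * Fz x)))"
      using Sw Sz h unfolding sol_def by (intro ac_primitive_diff ac_primitive_mult) blast+
    then have "ac_primitive 0 b (\<lambda>x. (Fw x - Fz x) * h' x - (Gw x - Gz x) * h x) (\<lambda>x. (w - z) * (Fw x * h x))"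
      by (rule ac_primitive_cong) (auto simp: algebra_simps)
    from ac_primitive_subinterval(2)[OF this order_refl, of t] t
    have "((\<lambda>x. (w - z) * (Fw x * h x)) has_integral ((Fw t - Fz t) * h' t - (Gw t - Gz t) * h t)) {0..t}"
      by (simp add: init)
    from integral_unique[OF this] show ?thesis by simp
  qed
  have W: "u t * v' t - u' t * v t = 1"
    using wronskian_constant[OF u(1) v(1) t] u v by simp
  have X: "(Fw t - Fz t) * v' t - (Gw t - Gz t) * v t = (w - z) * integral {0..t} (\<lambda>x. Fw x * v x)"
    and Y: "(Fw t - Fz t) * u' t - (Gw t - Gz t) * u t = (w - z) * integral {0..t} (\<lambda>x. Fw x * u x)"
    by (rule key[OF v(1)], rule key[OF u(1)])
  have "Fw t - Fz t = (Fw t - Fz t) * (u t * v' t - u' t * v t)" by (simp add: W)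
  also have "\<dots> = u t * ((Fw t - Fz t) * v' t - (Gw t - Gz t) * v t) - v t * ((Fw t - Fz t) * u' t - (Gw t - Gz t) * u t)"
    by (simp add: algebra_simps)
  also have "\<dots> = (w - z) * (u t * integral {0..t} (\<lambda>x. Fw x * v x) - v t * integral {0..t} (\<lambda>x. Fw x * u x))"
    unfolding X Y by (simp add: algebra_simps)
  finally show "Fw t - Fz t = \<dots>" .
  have "Gw t - Gz t = (Gw t - Gz t) * (u t * v' t - u' t * v t)" by (simp add: W)
  also have "\<dots> = u' t * ((Fw t - Fz t) * v' t - (Gw t - Gz t) * v t) - v' t * ((Fw t - Fz t) * u' t - (Gw t - Gz t) * u t)"
    by (simp add: algebra_simps)
  also have "\<dots> = (w - z) * (u' t * integral {0..t} (\<lambda>x. Fw x * v x) - v' t * integral {0..t} (\<lambda>x. Fw x * u x))"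
    unfolding X Y by (simp add: algebra_simps)
  finally show "Gw t - Gz t = \<dots>" .
qed

lemma integral_product_bound:
  fixes f h :: "real \<Rightarrow> complex"
  assumes "continuous_on {0..t} f" "continuous_on {0..t} h" "t \<ge> 0"
    and "\<And>x. x \<in> {0..t} \<Longrightarrow> norm (f x) \<le> A" "\<And>x. x \<in> {0..t} \<Longrightarrow> norm (h x) \<le> B"
  shows "norm (integral {0..t} (\<lambda>x. f x * h x)) \<le> t * (A * B)"
proof -
  have A: "A \<ge> 0" using order_trans[OF norm_ge_zero assms(4)[of 0]] assms(3) by simp
  have "norm (integral {0..t} (\<lambda>x. f x * h x)) \<le> integral {0..t} (\<lambda>x. A * B)"
  proof (rule integral_norm_bound_integral)
    show "(\<lambda>x. f x * h x) integrable_on {0..t}"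
      by (intro integrable_continuous_real continuous_on_mult assms(1,2))
    show "norm (f x * h x) \<le> A * B" if "x \<in> {0..t}" for x
      unfolding norm_mult using assms(4,5)[OF that] A by (intro mult_mono) auto
  qed (rule integrable_const_ivl)
  then show ?thesis using assms(3) by (simp add: mult_ac)
qed

text \<open>By variation of constants the difference quotient at \<open>z\<close> is a fixed
  combination of the integrals of \<open>F w\<close> against \<open>u\<close> and \<open>v\<close>.
  The same formula bounds \<open>F w - F z\<close> by a multiple of \<open>norm (w - z)\<close>
  uniformly on [0, b], so these integrals are continuous at \<open>z\<close> and the quotient
  converges.\<close>

theorem cauchy_solution_holomorphic:
  assumes V: "locally_integrable V" and b: "b \<ge> 0"
  shows "(\<lambda>z. fst (cauchy_solution V z f g) b) holomorphic_on UNIV"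
    "(\<lambda>z. snd (cauchy_solution V z f g) b) holomorphic_on UNIV"
proof -
  define F where "F z = fst (cauchy_solution V z f g)" for z
  define G where "G z = snd (cauchy_solution V z f g)" for z
  have S: "sol V z 0 c (F z) (G z)" and init: "F z 0 = f" "G z 0 = g" for z c
    by (simp_all add: F_def G_def cauchy_solution[OF V])
  have "\<exists>d d'. ((\<lambda>z. F z b) has_field_derivative d) (at z) \<and> ((\<lambda>z. G z b) has_field_derivative d') (at z)" for z
  proof -
    let ?u = "fst (cauchy_solution V z 1 0)" and ?u' = "snd (cauchy_solution V z 1 0)"
    let ?v = "fst (cauchy_solution V z 0 1)" and ?v' = "snd (cauchy_solution V z 0 1)"
    have u: "?u 0 = 1" "?u' 0 = 0" "sol V z 0 c ?u ?u'" and v: "?v 0 = 0" "?v' 0 = 1" "sol V z 0 c ?v ?v'" for c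
      by (simp_all add: cauchy_solution[OF V])
    obtain K where K: "K \<ge> 0" "\<And>w F G x. norm w \<le> norm z + 1 \<Longrightarrow> sol V w 0 b F G \<Longrightarrow> x \<in> {0..b} \<Longrightarrow>
        norm (F x) + norm (G x) \<le> K * (norm (F 0) + norm (G 0))"
      using sol_bound[OF locally_integrable_absolutely[OF V order_refl], of "norm z + 1" b] by metis
    define M where "M = K * (norm f + norm g)"
    have ub: "norm (?u x) \<le> K" "norm (?v x) \<le> K" if "x \<in> {0..b}" for x
    proof -
      have "norm (?u x) + norm (?u' x) \<le> K" "norm (?v x) + norm (?v' x) \<le> K"
        using K(2)[OF _ u(3) that] K(2)[OF _ v(3) that] by (simp_all add: u(1,2) v(1,2))
      then show "norm (?u x) \<le> K" "norm (?v x) \<le> K"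
        using norm_ge_zero[of "?u' x"] norm_ge_zero[of "?v' x"] by linarith+
    qed
    have Fb: "norm (F w x) \<le> M" if "norm (w - z) \<le> 1" "x \<in> {0..b}" for w x
    proof -
      have "norm w \<le> norm z + 1" using norm_triangle_ineq2[of w z] that by simp
      from K(2)[OF this S that(2)] have "norm (F w x) + norm (G w x) \<le> M" by (simp add: M_def init)
      then show ?thesis using norm_ge_zero[of "G w x"] by linarith
    qed
    have cont: "continuous_on {0..t} (F w)" "continuous_on {0..t} ?u" "continuous_on {0..t} ?v" for w t
      using sol_continuous(1)[OF S] sol_continuous(1)[OF u(3)] sol_continuous(1)[OF v(3)] by auto
    define \<alpha> where "\<alpha> w = integral {0..b} (\<lambda>x. F w x * ?v x)" for w
    define \<beta> where "\<beta> w = integral {0..b} (\<lambda>x. F w x * ?u x)" for w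
    define C where "C = K * (b * (M * K)) + K * (b * (M * K))"
    have M: "M \<ge> 0" using K(1) by (simp add: M_def)
    have Db: "norm (F w x - F z x) \<le> norm (w - z) * C" if w: "norm (w - z) \<le> 1" and x: "x \<in> {0..b}" for w x
    proof -
      let ?a = "integral {0..x} (\<lambda>x. F w x * ?v x)" and ?b = "integral {0..x} (\<lambda>x. F w x * ?u x)"
      have "norm ?a \<le> x * (M * K)" "norm ?b \<le> x * (M * K)"
        using x by (auto intro!: integral_product_bound cont Fb[OF w] ub)
      moreover have "x * (M * K) \<le> b * (M * K)" using x M K(1) by (intro mult_right_mono) auto
      ultimately have ab: "norm ?a \<le> b * (M * K)" "norm ?b \<le> b * (M * K)" by linarith+
      have "norm (?u x * ?a - ?v x * ?b) \<le> norm (?u x * ?a) + norm (?v x * ?b)" by (rule norm_triangle_ineq4)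
      also have "\<dots> \<le> C" unfolding C_def norm_mult using ub[OF x] ab K(1) by (intro add_mono mult_mono) auto
      finally show ?thesis
        using sol_parameter_difference(1)[OF S S _ _ u(3,1,2) v(3,1,2) x, of w] init
        by (simp add: norm_mult mult_left_mono)
    qed
    have lim: "((\<lambda>w. integral {0..b} (\<lambda>x. F w x * h x)) \<longlongrightarrow> integral {0..b} (\<lambda>x. F z x * h x)) (at z)"
      if h: "continuous_on {0..b} h" "\<And>x. x \<in> {0..b} \<Longrightarrow> norm (h x) \<le> K" for h
    proof (rule LIM_zero_cancel, rule Lim_null_comparison)
      have "\<forall>\<^sub>F w in at z. dist w z < 1" by (auto simp: eventually_at intro!: exI[of _ 1])
      then show "\<forall>\<^sub>F w in at z. norm (integral {0..b} (\<lambda>x. F w x * h x) - integral {0..b} (\<lambda>x. F z x * h x))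
          \<le> b * ((norm (w - z) * C) * K)"
      proof eventually_elim
        case (elim w)
        then have w: "norm (w - z) \<le> 1" by (simp add: dist_norm)
        have i: "(\<lambda>x. F w x * h x) integrable_on {0..b}" for w
          by (intro integrable_continuous_real continuous_on_mult cont h)
        have "integral {0..b} (\<lambda>x. F w x * h x) - integral {0..b} (\<lambda>x. F z x * h x)
          = integral {0..b} (\<lambda>x. (F w x - F z x) * h x)"
          by (simp add: left_diff_distrib Henstock_Kurzweil_Integration.integral_diff[OF i i])
        moreover have "norm (integral {0..b} (\<lambda>x. (F w x - F z x) * h x)) \<le> b * ((norm (w - z) * C) * K)"
          by (rule integral_product_bound[OF _ h(1) b Db[OF w] h(2)]) (auto intro!: continuous_intros cont)
        ultimately show ?case by simp
      qed
      have "((\<lambda>w. b * ((norm (w - z) * C) * K)) \<longlongrightarrow> b * ((norm (z - z) * C) * K)) (at z)"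
        by (intro tendsto_intros)
      then show "((\<lambda>w. b * ((norm (w - z) * C) * K)) \<longlongrightarrow> 0) (at z)" by simp
    qed
    have \<alpha>: "(\<alpha> \<longlongrightarrow> \<alpha> z) (at z)"
      unfolding \<alpha>_def by (rule lim[OF cont(3) ub(2)])
    have \<beta>: "(\<beta> \<longlongrightarrow> \<beta> z) (at z)"
      unfolding \<beta>_def by (rule lim[OF cont(2) ub(1)])
    have bb: "b \<in> {0..b}" using b by simp
    have "((\<lambda>z. F z b) has_field_derivative (?u b * \<alpha> z - ?v b * \<beta> z)) (at z)"
      unfolding has_field_derivative_iff
    proof (rule Lim_transform_eventually)
      show "((\<lambda>w. ?u b * \<alpha> w - ?v b * \<beta> w) \<longlongrightarrow> ?u b * \<alpha> z - ?v b * \<beta> z) (at z)"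
        by (intro tendsto_intros \<alpha> \<beta>)
      show "\<forall>\<^sub>F w in at z. ?u b * \<alpha> w - ?v b * \<beta> w = (F w b - F z b) / (w - z)"
        using sol_parameter_difference(1)[OF S S _ _ u(3,1,2) v(3,1,2) bb]
        by (auto simp: eventually_at init \<alpha>_def \<beta>_def intro!: exI[of _ 1])
    qed
    moreover have "((\<lambda>z. G z b) has_field_derivative (?u' b * \<alpha> z - ?v' b * \<beta> z)) (at z)"
      unfolding has_field_derivative_iff
    proof (rule Lim_transform_eventually)
      show "((\<lambda>w. ?u' b * \<alpha> w - ?v' b * \<beta> w) \<longlongrightarrow> ?u' b * \<alpha> z - ?v' b * \<beta> z) (at z)"
        by (intro tendsto_intros \<alpha> \<beta>)
      show "\<forall>\<^sub>F w in at z. ?u' b * \<alpha> w - ?v' b * \<beta> w = (G w b - G z b) / (w - z)"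
        using sol_parameter_difference(2)[OF S S _ _ u(3,1,2) v(3,1,2) bb]
        by (auto simp: eventually_at init \<alpha>_def \<beta>_def intro!: exI[of _ 1])
    qed
    ultimately show ?thesis by blast
  qed
  then show "(\<lambda>z. fst (cauchy_solution V z f g) b) holomorphic_on UNIV"
    "(\<lambda>z. snd (cauchy_solution V z f g) b) holomorphic_on UNIV"
    unfolding F_def G_def by (auto simp: holomorphic_on_open)
qed

section \<open>Local bounds and the limit-point property\<close>

lemma ac_primitive_of_real:
  assumes "\<And>x. (p has_real_derivative q x) (at x)" "continuous_on UNIV q"
  shows "ac_primitive a b (\<lambda>x. of_real (p x)) (\<lambda>x. of_real (q x))"
proof (rule ac_primitiveI_continuous)
  show "((\<lambda>x. complex_of_real (p x)) has_vector_derivative of_real (q x)) (at x within {a..b})" for x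
    by (rule bounded_linear.has_vector_derivative[OF bounded_linear_of_real
          has_vector_derivative_at_within[OF assms(1)[unfolded has_real_derivative_iff_has_vector_derivative]]])
  show "continuous_on {a..b} (\<lambda>x. complex_of_real (q x))"
    by (intro continuous_intros continuous_on_subset[OF assms(2)]) simp
qed

text \<open>Two cubic Hermite polynomials with a double zero at \<open>c + 1\<close> serve as test
  functions: one has value 0 and slope 1 at \<open>c\<close>, the other value 1 and slope 0, so they
  isolate \<open>F c\<close> and \<open>G c\<close>. On the interval they are at most 1 and their
  second derivatives at most 6 in modulus, whence \<open>6 + cmod z\<close>. The parameter
  \<open>s\<close> stays free, to be balanced against a small integral of
  \<open>(cmod F)\<^sup>2\<close>.\<close>

lemma local_bound:
  assumes S: "sol V z c (c + 1) F G" and V2: "(\<lambda>x. (V x)\<^sup>2) integrable_on {c..c + 1}"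
    and sq: "square_integral V c (c + 1) \<le> 1" and s: "s > 0"
  defines "B \<equiv> (s * integral {c..c + 1} (\<lambda>x. (cmod (F x))\<^sup>2) + (2 + 2 * (6 + cmod z)\<^sup>2) / s) / 2"
  shows "norm (F c) \<le> B" "norm (G c) \<le> B"
proof -
  let ?I = "integral {c..c + 1} (\<lambda>x. (cmod (F x))\<^sup>2)"
  have fin: "(s * ?I + (2 * square_integral V c (c + 1) + 2 * (6 + cmod z)\<^sup>2 * (c + 1 - c)) / s) / 2 \<le> B"
    unfolding B_def using sq s by (intro divide_right_mono add_left_mono) auto
  have second: "norm (of_real r + z * of_real q) \<le> 6 + cmod z" if "\<bar>r\<bar> \<le> 6" "\<bar>q\<bar> \<le> 1" for r q
  proof -
    have "norm (of_real r + z * of_real q) \<le> \<bar>r\<bar> + cmod z * \<bar>q\<bar>"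
      using norm_triangle_ineq[of "of_real r" "z * of_real q"] by (simp add: norm_mult)
    also have "\<dots> \<le> 6 + cmod z * 1" using that by (intro add_mono mult_left_mono) auto
    finally show ?thesis by simp
  qed
  define p0 where "p0 x = (x - c) * (c + 1 - x)\<^sup>2" for x
  define p1 where "p1 x = (c + 1 - x)\<^sup>2 - 2 * (x - c) * (c + 1 - x)" for x
  define p2 where "p2 x = 6 * (x - c) - 4" for x
  define q0 where "q0 x = (c + 1 - x)\<^sup>2 * (1 + 2 * (x - c))" for x
  define q1 where "q1 x = - 6 * (x - c) * (c + 1 - x)" for x
  define q2 where "q2 x = 12 * (x - c) - 6" for x
  have d: "(p0 has_real_derivative p1 x) (at x)" "(p1 has_real_derivative p2 x) (at x)"
    "(q0 has_real_derivative q1 x) (at x)" "(q1 has_real_derivative q2 x) (at x)" for x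
    unfolding p0_def p1_def p2_def q0_def q1_def q2_def
    by (auto intro!: derivative_eq_intros simp: algebra_simps power2_eq_square)
  have ct: "continuous_on UNIV p1" "continuous_on UNIV p2" "continuous_on UNIV q1" "continuous_on UNIV q2"
    unfolding p1_def p2_def q1_def q2_def by (auto intro!: continuous_intros)
  have bp: "\<bar>p0 x\<bar> \<le> 1" "\<bar>p2 x\<bar> \<le> 6" "\<bar>q0 x\<bar> \<le> 1" "\<bar>q2 x\<bar> \<le> 6" if "x \<in> {c..c + 1}" for x
  proof -
    define y where "y = x - c"
    have y: "0 \<le> y" "y \<le> 1" using that by (auto simp: y_def)
    have cy: "c + 1 - x = 1 - y" by (simp add: y_def)
    have "(1 - y)\<^sup>2 \<le> 1" "0 \<le> (1 - y)\<^sup>2" using y by (simp_all add: power_le_one)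
    then have "0 \<le> y * (1 - y)\<^sup>2" "y * (1 - y)\<^sup>2 \<le> 1" using y by (simp_all add: mult_le_one)
    then show "\<bar>p0 x\<bar> \<le> 1" by (simp add: p0_def cy flip: y_def)
    show "\<bar>p2 x\<bar> \<le> 6" "\<bar>q2 x\<bar> \<le> 6" using y by (auto simp: p2_def q2_def y_def)
    have "0 \<le> y * y * (3 - 2 * y)" using y by simp
    then have "(1 - y)\<^sup>2 * (1 + 2 * y) \<le> 1" by (simp add: algebra_simps power2_eq_square)
    moreover have "0 \<le> (1 - y)\<^sup>2 * (1 + 2 * y)" using y by simp
    ultimately show "\<bar>q0 x\<bar> \<le> 1" by (simp add: q0_def cy flip: y_def)
  qed
  have "norm (of_real (p0 c) * G c - of_real (p1 c) * F c) \<le> (s * ?I + (2 * square_integral V c (c + 1) + 2 * (6 + cmod z)\<^sup>2 * (c + 1 - c)) / s) / 2"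
    by (rule test_function_estimate[OF S _ ac_primitive_of_real[OF d(1) ct(1)] ac_primitive_of_real[OF d(2) ct(2)] _ _ _ second[OF bp(2,1)] V2 s])
       (auto simp: p0_def[of "c + 1"] p1_def[of "c + 1"] intro!: bp(1))
  also have "of_real (p0 c) * G c - of_real (p1 c) * F c = - F c" by (simp add: p0_def p1_def)
  finally show "norm (F c) \<le> B" using fin by simp
  have "norm (of_real (q0 c) * G c - of_real (q1 c) * F c) \<le> (s * ?I + (2 * square_integral V c (c + 1) + 2 * (6 + cmod z)\<^sup>2 * (c + 1 - c)) / s) / 2"
    by (rule test_function_estimate[OF S _ ac_primitive_of_real[OF d(3) ct(3)] ac_primitive_of_real[OF d(4) ct(4)] _ _ _ second[OF bp(4,3)] V2 s])
       (auto simp: q0_def[of "c + 1"] q1_def[of "c + 1"] intro!: bp(3))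
  also have "of_real (q0 c) * G c - of_real (q1 c) * F c = G c" by (simp add: q0_def q1_def)
  finally show "norm (G c) \<le> B" using fin by simp
qed

text \<open>Local integrability makes \<open>V\<close> measurable, so finiteness of the extended
  integral yields integrability of the square.\<close>

lemma square_integral_eq_nn_integral:
  assumes V: "locally_integrable V" and ab: "0 \<le> a"
    and fin: "(\<integral>\<^sup>+x\<in>{a<..<b}. ennreal ((V x)\<^sup>2) \<partial>lebesgue) < \<infinity>"
  shows "(\<lambda>x. (V x)\<^sup>2) integrable_on {a..b}"
    "ennreal (square_integral V a b) = (\<integral>\<^sup>+x\<in>{a<..<b}. ennreal ((V x)\<^sup>2) \<partial>lebesgue)"
proof -
  let ?f = "\<lambda>x. indicat_real {a..b} x * (V x)\<^sup>2"
  have "V absolutely_integrable_on {a..b}" by (rule locally_integrable_absolutely[OF V ab])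
  then have [measurable]: "(\<lambda>x. indicat_real {a..b} x * V x) \<in> borel_measurable lebesgue"
    by (auto simp: set_integrable_def dest: borel_measurable_integrable)
  have "?f = (\<lambda>x. (indicat_real {a..b} x * V x)\<^sup>2)" by (auto simp: fun_eq_iff split: split_indicator)
  then have meas: "?f \<in> borel_measurable lebesgue" by simp
  have ae: "AE x in lebesgue. x \<notin> {a, b}"
    by (rule AE_not_in) (simp add: negligible_iff_null_sets[symmetric])
  have eq: "(\<integral>\<^sup>+x. ennreal (?f x) \<partial>lebesgue) = (\<integral>\<^sup>+x\<in>{a<..<b}. ennreal ((V x)\<^sup>2) \<partial>lebesgue)"
  proof (rule nn_integral_cong_AE)
    show "AE x in lebesgue. ennreal (?f x) = ennreal ((V x)\<^sup>2) * indicator {a<..<b} x"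
      using ae by eventually_elim (auto split: split_indicator)
  qed
  have int: "integrable lebesgue ?f"
    by (rule integrableI_nonneg[OF meas]) (use fin eq in auto)
  then have si: "(\<lambda>x. (V x)\<^sup>2) absolutely_integrable_on {a..b}" by (simp add: set_integrable_def)
  note hk = set_lebesgue_integral_eq_integral[OF si]
  show "(\<lambda>x. (V x)\<^sup>2) integrable_on {a..b}" by (rule hk(1))
  have "square_integral V a b = (\<integral>x. ?f x \<partial>lebesgue)"
    using hk(2) by (simp add: square_integral_def set_lebesgue_integral_def)
  then show "ennreal (square_integral V a b) = (\<integral>\<^sup>+x\<in>{a<..<b}. ennreal ((V x)\<^sup>2) \<partial>lebesgue)"
    unfolding eq[symmetric] by (simp add: nn_integral_eq_integral[OF int])
qed

text \<open>The definition of sparseness does not place its intervals far out. An interval of length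
  \<open>\<bar>C\<bar> + 1\<close> in [0, \<infinity>), however, ends at or beyond
  \<open>\<bar>C\<bar> + 1\<close>, and its last unit piece begins at or beyond
  \<open>\<bar>C\<bar>\<close>.\<close>

lemma L2_sparse_unit_interval:
  assumes V: "L2_sparse V"
  obtains c where "c \<ge> 0" "c \<ge> C" "(\<lambda>x. (V x)\<^sup>2) integrable_on {c..c + 1}" "square_integral V c (c + 1) \<le> 1"
proof -
  have li: "locally_integrable V" using V by (simp add: L2_sparse_def)
  have "\<exists>a b. 0 \<le> a \<and> b - a = \<bar>C\<bar> + 1 \<and> (\<integral>\<^sup>+x\<in>{a<..<b}. ennreal ((V x)\<^sup>2) \<partial>lebesgue) < ennreal 1"
    using V unfolding L2_sparse_def by (metis abs_ge_zero add_nonneg_pos zero_less_one)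
  then obtain a b where ab: "0 \<le> a" "b - a = \<bar>C\<bar> + 1" "(\<integral>\<^sup>+x\<in>{a<..<b}. ennreal ((V x)\<^sup>2) \<partial>lebesgue) < ennreal 1" by blast
  then have fin: "(\<integral>\<^sup>+x\<in>{a<..<b}. ennreal ((V x)\<^sup>2) \<partial>lebesgue) < \<infinity>"
    by (metis ennreal_less_top infinity_ennreal_def less_trans)
  note sq = square_integral_eq_nn_integral[OF li ab(1) fin]
  define c where "c = b - 1"
  have c: "c \<ge> a" "c \<ge> \<bar>C\<bar>" "c + 1 = b" using ab by (auto simp: c_def)
  have i: "(\<lambda>x. (V x)\<^sup>2) integrable_on {c..c + 1}" by (rule integrable_on_subinterval[OF sq(1)]) (use c in auto)
  have "square_integral V c (c + 1) \<le> square_integral V a b"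
    unfolding square_integral_def by (rule integral_subset_le[OF _ i sq(1)]) (use c in auto)
  also have "\<dots> \<le> 1" using ab(3) unfolding sq(2)[symmetric] by (simp add: ennreal_less_iff ennreal_less_one_iff less_imp_le)
  finally show ?thesis using that[of c] i c ab by auto
qed

text \<open>The limit-point property: the local bound on unit intervals far out, where \<open>V\<close> is small in
  \<open>L\<^sup>2\<close>, forces the current \<open>energy F G\<close> of a square integrable solution to vanish at infinity.\<close>

lemma energy_lower_bound:
  assumes V: "L2_sparse V" and S: "\<And>b. sol V z 0 b F G" and M: "\<And>b. integral {0..b} (\<lambda>t. (cmod (F t))\<^sup>2) \<le> M"
    and xy: "0 \<le> x" "x \<le> y" and z: "Im z > 0"
  shows "Im z * integral {x..y} (\<lambda>t. (cmod (F t))\<^sup>2) \<le> energy F G x"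
proof -
  let ?f = "\<lambda>t. (cmod (F t))\<^sup>2"
  have i: "?f integrable_on {a..b}" if "0 \<le> a" for a b
    using sol_square_integrable_interval[OF S that order_refl] .
  define R where "R = 2 + 2 * (6 + cmod z)\<^sup>2"
  have R: "R > 0" by (simp add: R_def add_pos_nonneg)
  have comb: "integral {a..b} ?f = integral {0..b} ?f - integral {0..a} ?f" if "0 \<le> a" "a \<le> b" for a b
    using Henstock_Kurzweil_Integration.integral_combine[OF that i[OF order_refl]] by simp
  \<comment> \<open>The integrals over [0, b] increase to \<open>J\<close>, so the integral over a
    unit interval beyond a suitable \<open>T\<close> is as small as desired.\<close>
  define J where "J = (SUP b\<in>{0..}. integral {0..b} ?f)"
  have bdd: "bdd_above ((\<lambda>b. integral {0..b} ?f) ` {0..})" using M by (intro bdd_aboveI2[of _ _ M])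
  have small: "\<exists>c\<ge>y. \<bar>energy F G c\<bar> \<le> \<eta>\<^sup>2" if \<eta>: "\<eta> > 0" for \<eta>
  proof -
    \<comment> \<open>With this \<open>s\<close>, and the integral over the unit interval at most
      \<open>\<eta> / s\<close>, each of the two terms that \<open>local_bound\<close> averages is
      at most \<open>\<eta>\<close>.\<close>
    define s where "s = R / \<eta>"
    have s: "s > 0" using R \<eta> by (simp add: s_def)
    obtain T where T: "T \<ge> 0" "J - \<eta> / s < integral {0..T} ?f"
      using less_cSUP_iff[OF _ bdd, of "J - \<eta> / s"] \<eta> s by (auto simp: J_def)
    obtain c where c: "c \<ge> 0" "c \<ge> max y T" "(\<lambda>x. (V x)\<^sup>2) integrable_on {c..c + 1}" "square_integral V c (c + 1) \<le> 1"
      by (rule L2_sparse_unit_interval[OF V])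
    have "integral {0..c + 1} ?f \<le> J" unfolding J_def using c by (intro cSUP_upper bdd) auto
    moreover have "integral {0..T} ?f \<le> integral {0..c} ?f"
      by (rule integral_subset_le) (use c T i in auto)
    ultimately have "integral {c..c + 1} ?f \<le> \<eta> / s" using comb[of c "c + 1"] c T by simp
    then have I: "s * integral {c..c + 1} ?f \<le> \<eta>" using s by (simp add: pos_le_divide_eq mult.commute)
    have Rs: "R / s = \<eta>" using R \<eta> by (simp add: s_def)
    have Sc: "sol V z c (c + 1) F G" by (rule sol_restrict[OF S c(1) order_refl])
    have h: "(s * integral {c..c + 1} ?f + R / s) / 2 \<le> \<eta>" using I Rs by simp
    have "norm (F c) \<le> \<eta>"
      by (rule order_trans[OF local_bound(1)[OF Sc c(3,4) s] h[unfolded R_def]])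
    moreover have "norm (G c) \<le> \<eta>"
      by (rule order_trans[OF local_bound(2)[OF Sc c(3,4) s] h[unfolded R_def]])
    ultimately have "norm (G c * cnj (F c)) \<le> \<eta>\<^sup>2"
      unfolding norm_mult power2_eq_square using \<eta> by (intro mult_mono) auto
    then have "\<bar>energy F G c\<bar> \<le> \<eta>\<^sup>2" unfolding energy_def by (rule order_trans[OF abs_Im_le_cmod])
    then show ?thesis using c(2) by auto
  qed
  have lower: "Im z * integral {x..y} ?f - \<eta>\<^sup>2 \<le> energy F G x" if \<eta>: "\<eta> > 0" for \<eta>
  proof -
    obtain c where c: "c \<ge> y" "\<bar>energy F G c\<bar> \<le> \<eta>\<^sup>2" using small[OF \<eta>] by blast
    have "energy F G x = energy F G c + Im z * integral {x..c} ?f"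
      by (rule energy_identity[OF S[of c]]) (use xy c in auto)
    moreover have "integral {x..y} ?f \<le> integral {x..c} ?f"
      by (rule integral_subset_le) (use c xy i in auto)
    then have "Im z * integral {x..y} ?f \<le> Im z * integral {x..c} ?f" using z by (intro mult_left_mono) auto
    ultimately show ?thesis using c(2) by linarith
  qed
  show ?thesis
  proof (rule field_le_epsilon)
    fix e :: real assume "e > 0"
    then show "Im z * integral {x..y} ?f \<le> energy F G x + e" using lower[of "sqrt e"] by simp
  qed
qed

section \<open>Weyl solutions\<close>

definition bounded_solution :: "(real \<Rightarrow> real) \<Rightarrow> complex \<Rightarrow> (real \<Rightarrow> complex) \<Rightarrow> (real \<Rightarrow> complex) \<Rightarrow> bool" where
  "bounded_solution V z F G \<longleftrightarrow> (\<forall>b. sol V z 0 b F G) \<and> (\<exists>M. \<forall>b. integral {0..b} (\<lambda>t. (cmod (F t))\<^sup>2) \<le> M)"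

lemma sol_square_integrable:
  assumes "\<And>b. sol V z 0 b F G" "0 \<le> a"
  shows "(\<lambda>t. (cmod (F t))\<^sup>2) integrable_on {a..b}"
  using sol_square_integrable_interval[OF assms order_refl] .

lemma weyl_solution_bounded:
  assumes V: "locally_integrable V" and W: "weyl_solution V z F G"
  shows "bounded_solution V z F G"
proof -
  have S: "sol V z 0 b F G" for b
    using W by (intro sol_if_schroedinger_solution[OF V]) (simp add: weyl_solution_def)
  let ?f = "\<lambda>t. (cmod (F t))\<^sup>2"
  obtain R where R: "R \<ge> 0" "?f absolutely_integrable_on {R..}" using W by (auto simp: weyl_solution_def)
  have iR: "?f integrable_on {R..}" using R(2) by (rule set_lebesgue_integral_eq_integral(1))
  have "integral {0..b} ?f \<le> integral {0..R} ?f + integral {R..} ?f" for b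
  proof (cases "b \<le> R")
    case True
    have "integral {0..b} ?f \<le> integral {0..R} ?f"
      by (rule integral_subset_le) (use True sol_square_integrable[OF S] in auto)
    moreover have "integral {R..} ?f \<ge> 0" by (rule integral_nonneg[OF iR]) simp
    ultimately show ?thesis by linarith
  next
    case False
    have "integral {0..b} ?f = integral {0..R} ?f + integral {R..b} ?f"
      using Henstock_Kurzweil_Integration.integral_combine[OF R(1) _ sol_square_integrable[OF S], of b] False by simp
    moreover have "integral {R..b} ?f \<le> integral {R..} ?f"
      by (rule integral_subset_le) (use iR R(1) sol_square_integrable[OF S] in auto)
    ultimately show ?thesis by linarith
  qed
  then show ?thesis unfolding bounded_solution_def using S by blast
qed

lemma bounded_solution_weyl:
  assumes B: "bounded_solution V z F G" and nz: "x \<ge> 0" "F x \<noteq> 0"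
  shows "weyl_solution V z F G"
proof -
  let ?f = "\<lambda>t. (cmod (F t))\<^sup>2"
  have S: "sol V z 0 b F G" for b using B by (auto simp: bounded_solution_def)
  obtain M where M: "\<And>b. integral {0..b} ?f \<le> M" using B by (auto simp: bounded_solution_def)
  have si: "?f absolutely_integrable_on {0..b}" for b
    by (rule nonnegative_absolutely_integrable_1[OF sol_square_integrable[OF S order_refl]]) simp
  have eq: "set_lebesgue_integral lebesgue {0..b} ?f = integral {0..b} ?f" for b
    by (rule set_lebesgue_integral_eq_integral(2)[OF si])
  have "incseq (\<lambda>n. integral {0..real n} ?f)"
    by (rule incseq_SucI, rule integral_subset_le) (use sol_square_integrable[OF S order_refl] in auto)
  then obtain l where l: "(\<lambda>n. integral {0..real n} ?f) \<longlonglongrightarrow> l"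
    using incseq_convergent[of "\<lambda>n. integral {0..real n} ?f" M] M by blast
  have "set_integrable lebesgue (\<Union>n. {0..real n}) ?f"
  proof (rule pos_integrable_to_top)
    show "incseq (\<lambda>n. {0..real n})" by (auto simp: incseq_def)
    show "(\<lambda>n. set_lebesgue_integral lebesgue {0..real n} ?f) \<longlonglongrightarrow> l" unfolding eq by (rule l)
  qed (use si in auto)
  also have "(\<Union>n. {0..real n}) = {0..}"
    using real_arch_simple by fastforce
  finally have "set_integrable lebesgue {0..} ?f" .
  then show ?thesis
    unfolding weyl_solution_def using schroedinger_solution_if_sol[OF S] nz by blast
qed

lemma sol_derivative_zero:
  assumes S: "sol V z a b F G" and ab: "a < b" and F: "\<And>x. x \<in> {a..b} \<Longrightarrow> F x = 0"
  shows "G a = 0"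
proof -
  have ac: "ac_primitive a b F G" "ac_primitive a b G (\<lambda>x. (of_real (V x) - z) * F x)"
    using S by (simp_all add: sol_def)
  have G: "G x = G a" if "x \<in> {a..b}" for x
  proof -
    have "((\<lambda>t. (of_real (V t) - z) * F t) has_integral (G x - G a)) {a..x}"
      by (rule ac_primitive_subinterval(2)[OF ac(2)]) (use that in simp_all)
    then have "((\<lambda>t. 0) has_integral (G x - G a)) {a..x}"
      by (rule has_integral_eq[rotated]) (use F that in auto)
    from has_integral_unique[OF this has_integral_0] show ?thesis by simp
  qed
  have "(G has_integral (F b - F a)) {a..b}"
    by (rule ac_primitive_subinterval(2)[OF ac(1)]) (use ab in simp_all)
  then have "((\<lambda>_. G a) has_integral (F b - F a)) {a..b}"
    by (rule has_integral_eq[rotated]) (rule G)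
  from has_integral_unique[OF this has_integral_const_real] have "F b - F a = (b - a) *\<^sub>R G a" using ab by simp
  then show ?thesis using F ab by simp
qed

lemma square_integral_zero:
  assumes S: "sol V z a b F G" and ab: "a < b" and I: "integral {a..b} (\<lambda>t. (cmod (F t))\<^sup>2) \<le> 0"
  shows "\<And>x. x \<in> {a..b} \<Longrightarrow> F x = 0" "G a = 0"
proof -
  let ?f = "\<lambda>t. (cmod (F t))\<^sup>2"
  have "integral {a..b} ?f \<ge> 0" by (rule integral_nonneg[OF sol_square_integrable_interval[OF S]]) auto
  then have "integral {a..b} ?f = 0" using I by simp
  moreover have "continuous_on {a..b} ?f" using sol_continuous(1)[OF S] by (intro continuous_intros)
  ultimately have "\<forall>x\<in>{a..b}. ?f x = 0" using integral_eq_0_iff[of a b ?f] ab by simp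
  then show F: "\<And>x. x \<in> {a..b} \<Longrightarrow> F x = 0" by simp
  show "G a = 0" by (rule sol_derivative_zero[OF S ab F])
qed

text \<open>The current at \<open>N\<close> dominates \<open>Im z\<close> times the integral of
  \<open>(cmod F)\<^sup>2\<close> over [N, N + 1]. If it were not positive, \<open>F\<close> would
  vanish on that interval together with \<open>G N\<close>, and then on all of [0, \<infinity>) by
  uniqueness.\<close>

lemma bounded_solution_energy_pos:
  assumes V: "L2_sparse V" and B: "bounded_solution V z F G" and z: "Im z > 0"
    and nz: "x \<ge> 0" "F x \<noteq> 0" and N: "N \<ge> 0"
  shows "energy F G N > 0"
proof (rule ccontr)
  assume neg: "\<not> energy F G N > 0"
  have li: "locally_integrable V" using V by (simp add: L2_sparse_def)
  have S: "sol V z 0 b F G" for b using B by (auto simp: bounded_solution_def)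
  obtain M where M: "\<And>b. integral {0..b} (\<lambda>t. (cmod (F t))\<^sup>2) \<le> M" using B by (auto simp: bounded_solution_def)
  have "Im z * integral {N..N + 1} (\<lambda>t. (cmod (F t))\<^sup>2) \<le> energy F G N"
    by (rule energy_lower_bound[OF V S M N _ z]) simp
  also have "\<dots> \<le> 0" using neg by simp
  finally have "integral {N..N + 1} (\<lambda>t. (cmod (F t))\<^sup>2) \<le> 0" using z by (simp add: mult_le_0_iff)
  then have I: "integral {N..N + 1} (\<lambda>t. (cmod (F t))\<^sup>2) \<le> 0" .
  have SN: "sol V z N (N + 1) F G" by (rule sol_restrict[OF S N order_refl])
  have "F N = 0" by (rule square_integral_zero(1)[OF SN _ I]) simp_all
  have "G N = 0" by (rule square_integral_zero(2)[OF SN _ I]) simp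
  have "F x = 0 \<and> G x = 0"
  proof (rule sol_zero_of_zero[where y=N and b="max N x" and z=z and V=V and a=0])
    show "V absolutely_integrable_on {0..max N x}" by (rule locally_integrable_absolutely[OF li order_refl])
    show "sol V z 0 (max N x) F G" by (rule S)
    show "F N = 0" "G N = 0" by fact+
    show "sol V z 0 (max N x) (fst (cauchy_solution V z 1 0)) (snd (cauchy_solution V z 1 0))"
      "sol V z 0 (max N x) (fst (cauchy_solution V z 0 1)) (snd (cauchy_solution V z 0 1))"
      by (rule cauchy_solution(3)[OF li])+
  qed (use N nz(1) in \<open>simp_all add: cauchy_solution(1,2)[OF li]\<close>)
  then show False using nz(2) by simp
qed

lemma bounded_solution_linear:
  assumes B: "bounded_solution V z F G" "bounded_solution V z F' G'"
  shows "bounded_solution V z (\<lambda>x. c * F x + d * F' x) (\<lambda>x. c * G x + d * G' x)"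
proof -
  have S: "sol V z 0 b F G" "sol V z 0 b F' G'" for b using B by (auto simp: bounded_solution_def)
  obtain M M' where M: "\<And>b. integral {0..b} (\<lambda>t. (cmod (F t))\<^sup>2) \<le> M" "\<And>b. integral {0..b} (\<lambda>t. (cmod (F' t))\<^sup>2) \<le> M'"
    using B by (auto simp: bounded_solution_def)
  note SL = sol_linear[OF S, of _ c d]
  have "integral {0..b} (\<lambda>t. (cmod (c * F t + d * F' t))\<^sup>2) \<le> 2 * (cmod c)\<^sup>2 * M + 2 * (cmod d)\<^sup>2 * M'" for b
  proof -
    have i: "(\<lambda>t. (cmod (F t))\<^sup>2) integrable_on {0..b}" "(\<lambda>t. (cmod (F' t))\<^sup>2) integrable_on {0..b}"
      using sol_square_integrable[OF S(1) order_refl] sol_square_integrable[OF S(2) order_refl] by auto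
    have h: "((\<lambda>t. 2 * (cmod c)\<^sup>2 * (cmod (F t))\<^sup>2 + 2 * (cmod d)\<^sup>2 * (cmod (F' t))\<^sup>2) has_integral
        (2 * (cmod c)\<^sup>2 * integral {0..b} (\<lambda>t. (cmod (F t))\<^sup>2) + 2 * (cmod d)\<^sup>2 * integral {0..b} (\<lambda>t. (cmod (F' t))\<^sup>2))) {0..b}"
      by (intro has_integral_add has_integral_mult_right integrable_integral i)
    have "integral {0..b} (\<lambda>t. (cmod (c * F t + d * F' t))\<^sup>2)
      \<le> 2 * (cmod c)\<^sup>2 * integral {0..b} (\<lambda>t. (cmod (F t))\<^sup>2) + 2 * (cmod d)\<^sup>2 * integral {0..b} (\<lambda>t. (cmod (F' t))\<^sup>2)"
    proof (rule has_integral_le[OF integrable_integral h])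
      show "(\<lambda>t. (cmod (c * F t + d * F' t))\<^sup>2) integrable_on {0..b}" by (rule sol_square_integrable[OF SL order_refl])
      fix t
      have "(cmod (c * F t + d * F' t))\<^sup>2 \<le> (cmod (c * F t) + cmod (d * F' t))\<^sup>2"
        by (intro power_mono norm_triangle_ineq) simp
      also have "\<dots> \<le> 2 * (cmod (c * F t))\<^sup>2 + 2 * (cmod (d * F' t))\<^sup>2"
        using zero_le_power2[of "cmod (c * F t) - cmod (d * F' t)"] by (simp add: power2_eq_square algebra_simps)
      finally show "(cmod (c * F t + d * F' t))\<^sup>2 \<le> 2 * (cmod c)\<^sup>2 * (cmod (F t))\<^sup>2 + 2 * (cmod d)\<^sup>2 * (cmod (F' t))\<^sup>2"
        by (simp add: norm_mult power_mult_distrib mult_ac)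
    qed
    also have "\<dots> \<le> 2 * (cmod c)\<^sup>2 * M + 2 * (cmod d)\<^sup>2 * M'"
      by (intro add_mono mult_left_mono M) auto
    finally show ?thesis .
  qed
  then show ?thesis unfolding bounded_solution_def using SL by blast
qed

text \<open>The combination of \<open>F\<close> and \<open>F'\<close> with coefficients
  \<open>F' N\<close> and \<open>- F N\<close> vanishes at \<open>N\<close>, so its current there is
  0 and it is the zero solution; its derivative at \<open>N\<close> is the difference of the cross
  products. Here \<open>F'\<close> denotes a second solution, not a derivative.\<close>

lemma weyl_quotient_unique:
  assumes V: "L2_sparse V" and z: "Im z > 0" and N: "N \<ge> 0"
    and W: "weyl_solution V z F G" "weyl_solution V z F' G'"
  shows "G N / F N = G' N / F' N" "F N \<noteq> 0" "energy F G N > 0"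
proof -
  have li: "locally_integrable V" using V by (simp add: L2_sparse_def)
  note B = weyl_solution_bounded[OF li W(1)] weyl_solution_bounded[OF li W(2)]
  obtain x x' where x: "x \<ge> 0" "F x \<noteq> 0" and x': "x' \<ge> 0" "F' x' \<noteq> 0" using W by (auto simp: weyl_solution_def)
  have e: "energy F G N > 0" "energy F' G' N > 0"
    by (rule bounded_solution_energy_pos[OF V B(1) z x N], rule bounded_solution_energy_pos[OF V B(2) z x' N])
  then show nz: "F N \<noteq> 0" and "energy F G N > 0" by (auto simp: energy_def)
  have nz': "F' N \<noteq> 0" using e by (auto simp: energy_def)
  let ?H = "\<lambda>x. F' N * F x + (- F N) * F' x" and ?K = "\<lambda>x. F' N * G x + (- F N) * G' x"
  have BH: "bounded_solution V z ?H ?K" by (rule bounded_solution_linear[OF B])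
  have HN: "?H N = 0" by simp
  have H0: "?H x = 0" if "x \<ge> 0" for x
  proof (rule ccontr)
    assume "?H x \<noteq> 0"
    from bounded_solution_energy_pos[OF V BH z that this N] HN show False by (simp add: energy_def)
  qed
  have "sol V z N (N + 1) ?H ?K"
    using BH N by (auto simp: bounded_solution_def intro: sol_restrict[of V z 0 "N + 1"])
  then have "?K N = 0"
  proof (rule sol_derivative_zero)
    show "?H x = 0" if "x \<in> {N..N + 1}" for x by (rule H0) (use that N in simp)
  qed simp
  then show "G N / F N = G' N / F' N" using nz nz' by (simp add: field_simps)
qed

lemma m_function_eq:
  assumes V: "L2_sparse V" and z: "Im z > 0" and N: "N \<ge> 0" and W: "weyl_solution V z F G"
  shows "m_function V N z = G N / F N"
  unfolding m_function_def
proof (rule the_equality)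
  show "\<exists>F' G'. weyl_solution V z F' G' \<and> G N / F N = G' N / F' N"
    by (rule exI[of _ F], rule exI[of _ G]) (simp add: W)
  show "w = G N / F N" if "\<exists>F' G'. weyl_solution V z F' G' \<and> w = G' N / F' N" for w
    using that
  proof (elim exE conjE)
    fix F' G' assume W': "weyl_solution V z F' G'" and w: "w = G' N / F' N"
    show "w = G N / F N" unfolding w by (rule weyl_quotient_unique(1)[OF V z N W W', symmetric])
  qed
qed

section \<open>Dirichlet problems on finite intervals and the Weyl coefficient\<close>

context
  fixes V :: "real \<Rightarrow> real" and u u' v v' :: "complex \<Rightarrow> real \<Rightarrow> complex"
  assumes li: "locally_integrable V"
  defines "u \<equiv> \<lambda>z. fst (cauchy_solution V z 1 0)" and "u' \<equiv> \<lambda>z. snd (cauchy_solution V z 1 0)"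
    and "v \<equiv> \<lambda>z. fst (cauchy_solution V z 0 1)" and "v' \<equiv> \<lambda>z. snd (cauchy_solution V z 0 1)"
begin

lemma fundamental:
  "u z 0 = 1" "u' z 0 = 0" "v z 0 = 0" "v' z 0 = 1" "sol V z 0 b (u z) (u' z)" "sol V z 0 b (v z) (v' z)"
  unfolding u_def u'_def v_def v'_def by (simp_all add: cauchy_solution[OF li])

lemma fundamental_holomorphic:
  assumes "b \<ge> 0"
  shows "(\<lambda>z. u z b) holomorphic_on A" "(\<lambda>z. u' z b) holomorphic_on A"
    "(\<lambda>z. v z b) holomorphic_on A" "(\<lambda>z. v' z b) holomorphic_on A"
  unfolding u_def u'_def v_def v'_def
  using cauchy_solution_holomorphic[OF li assms] holomorphic_on_subset by blast+

lemma combination_sol: "sol V z 0 b (\<lambda>x. u z x + m * v z x) (\<lambda>x. u' z x + m * v' z x)"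
  using sol_linear[OF fundamental(5,6), of z b 1 m] by simp

text \<open>The current of \<open>v\<close> starts at 0, because \<open>v\<close> does, and falls by
  \<open>Im z\<close> times the integral of \<open>(cmod v)\<^sup>2\<close>. In particular no
  Dirichlet eigenvalue lies in the upper half-plane.\<close>

lemma v_energy:
  assumes z: "Im z > 0" and R: "R > 0"
  shows "energy (v z) (v' z) R < 0" "v z R \<noteq> 0"
proof -
  have "energy (v z) (v' z) 0 = energy (v z) (v' z) R + Im z * integral {0..R} (\<lambda>t. (cmod (v z t))\<^sup>2)"
    by (rule energy_identity[OF fundamental(6)[of z R]]) (use R in auto)
  moreover have "energy (v z) (v' z) 0 = 0" by (simp add: energy_def fundamental)
  moreover have "integral {0..R} (\<lambda>t. (cmod (v z t))\<^sup>2) > 0"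
  proof (rule ccontr)
    assume "\<not> ?thesis"
    then have "v' z 0 = 0" using square_integral_zero(2)[OF fundamental(6) R] by simp
    then show False by (simp add: fundamental)
  qed
  ultimately show "energy (v z) (v' z) R < 0" using z by (simp add: eq_neg_iff_add_eq_0[symmetric] add.commute)
  then show "v z R \<noteq> 0" by (auto simp: energy_def)
qed

text \<open>\<open>m\<close> is chosen so that \<open>u + m v\<close> satisfies the Dirichlet
  condition at \<open>R\<close>; its current is then 0 at \<open>R\<close> and \<open>Im m\<close>
  at 0.\<close>

lemma dirichlet_energy:
  assumes z: "Im z > 0" and R: "R > 0"
  defines "m \<equiv> - u z R / v z R"
  shows "Im m = Im z * integral {0..R} (\<lambda>t. (cmod (u z t + m * v z t))\<^sup>2)"
proof -
  let ?F = "\<lambda>x. u z x + m * v z x" and ?G = "\<lambda>x. u' z x + m * v' z x"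
  have "energy ?F ?G 0 = energy ?F ?G R + Im z * integral {0..R} (\<lambda>t. (cmod (?F t))\<^sup>2)"
    by (rule energy_identity[OF combination_sol[of z R]]) (use R in auto)
  moreover have "energy ?F ?G 0 = Im m" by (simp add: energy_def fundamental)
  moreover have "?F R = 0" using v_energy(2)[OF z R] by (simp add: m_def)
  ultimately show ?thesis by (simp add: energy_def)
qed

text \<open>The bound on Weyl discs: \<open>Im z\<close> times the integral of
  \<open>(cmod (u + m v))\<^sup>2\<close> over [0, 1] is at most \<open>Im m\<close>, hence at most
  \<open>cmod m\<close>. The left side grows quadratically in \<open>m\<close> because
  \<open>v\<close> is not zero on [0, 1], so \<open>cmod m\<close> is bounded independently of
  \<open>R\<close>.\<close>

lemma dirichlet_bounded:
  assumes z: "Im z > 0"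
  shows "\<exists>K. \<forall>R\<ge>1. cmod (- u z R / v z R) \<le> K"
proof -
  define A where "A = integral {0..1} (\<lambda>t. (cmod (u z t))\<^sup>2)"
  define B where "B = integral {0..1} (\<lambda>t. (cmod (v z t))\<^sup>2)"
  have i: "(\<lambda>t. (cmod (u z t))\<^sup>2) integrable_on {0..b}" "(\<lambda>t. (cmod (v z t))\<^sup>2) integrable_on {0..b}"
    "(\<lambda>t. (cmod (u z t + m * v z t))\<^sup>2) integrable_on {0..b}" for b m
    using sol_square_integrable[OF fundamental(5)] sol_square_integrable[OF fundamental(6)] sol_square_integrable[OF combination_sol]
    by auto
  have B: "B > 0"
  proof (rule ccontr)
    assume "\<not> B > 0"
    then have "v' z 0 = 0" using square_integral_zero(2)[OF fundamental(6), of 1] by (simp add: B_def)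
    then show False by (simp add: fundamental)
  qed
  have A: "A \<ge> 0" unfolding A_def by (rule integral_nonneg[OF i(1)]) simp
  have "cmod (- u z R / v z R) \<le> (2 / Im z + 2 * A) / B + 1" if R: "R \<ge> 1" for R
  proof -
    define m where "m = - u z R / v z R"
    have "Im z * integral {0..1} (\<lambda>t. (cmod (u z t + m * v z t))\<^sup>2) \<le> Im z * integral {0..R} (\<lambda>t. (cmod (u z t + m * v z t))\<^sup>2)"
      using z R by (intro mult_left_mono integral_subset_le i) auto
    also have "\<dots> = Im m" unfolding m_def by (rule dirichlet_energy[symmetric, OF z]) (use R in simp)
    also have "\<dots> \<le> cmod m" by (rule order_trans[OF abs_ge_self abs_Im_le_cmod])
    finally have I: "integral {0..1} (\<lambda>t. (cmod (u z t + m * v z t))\<^sup>2) \<le> cmod m / Im z"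
      using z by (simp add: pos_le_divide_eq mult.commute)
    have "((\<lambda>t. (cmod m)\<^sup>2 * (cmod (v z t))\<^sup>2) has_integral (cmod m)\<^sup>2 * B) {0..1}"
      unfolding B_def by (intro has_integral_mult_right integrable_integral i)
    moreover have "((\<lambda>t. 2 * (cmod (u z t + m * v z t))\<^sup>2 + 2 * (cmod (u z t))\<^sup>2) has_integral
        (2 * integral {0..1} (\<lambda>t. (cmod (u z t + m * v z t))\<^sup>2) + 2 * A)) {0..1}"
      unfolding A_def by (intro has_integral_add has_integral_mult_right integrable_integral i)
    moreover have "(cmod m)\<^sup>2 * (cmod (v z t))\<^sup>2 \<le> 2 * (cmod (u z t + m * v z t))\<^sup>2 + 2 * (cmod (u z t))\<^sup>2" for t
    proof -
      have "cmod (m * v z t) \<le> cmod (u z t + m * v z t) + cmod (u z t)"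
        using norm_triangle_ineq4[of "u z t + m * v z t" "u z t"] by simp
      then have "(cmod (m * v z t))\<^sup>2 \<le> (cmod (u z t + m * v z t) + cmod (u z t))\<^sup>2" by (intro power_mono) auto
      also have "\<dots> \<le> 2 * (cmod (u z t + m * v z t))\<^sup>2 + 2 * (cmod (u z t))\<^sup>2"
        using zero_le_power2[of "cmod (u z t + m * v z t) - cmod (u z t)"] by (simp add: power2_eq_square algebra_simps)
      finally show ?thesis by (simp add: norm_mult power_mult_distrib)
    qed
    ultimately have "(cmod m)\<^sup>2 * B \<le> 2 * integral {0..1} (\<lambda>t. (cmod (u z t + m * v z t))\<^sup>2) + 2 * A"
      by (rule has_integral_le)
    also have "\<dots> \<le> 2 * (cmod m / Im z) + 2 * A" using I by simp
    finally have q: "(cmod m)\<^sup>2 * B \<le> 2 * (cmod m / Im z) + 2 * A" .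
    show ?thesis
    proof (cases "cmod m \<le> 1")
      case True
      have "0 \<le> (2 / Im z + 2 * A) / B" using z A B by simp
      then show ?thesis using True unfolding m_def by linarith
    next
      case False
      have "2 * (cmod m / Im z) + 2 * A \<le> cmod m * (2 / Im z + 2 * A)"
        using False A mult_right_mono[of 1 "cmod m" "2 * A"] by (simp add: algebra_simps)
      with q have "cmod m * (cmod m * B) \<le> cmod m * (2 / Im z + 2 * A)" by (simp add: power2_eq_square mult_ac)
      then have "cmod m * B \<le> 2 / Im z + 2 * A" by (rule mult_left_le_imp_le) (use False in linarith)
      then have "cmod m \<le> (2 / Im z + 2 * A) / B" using B by (simp add: pos_le_divide_eq)
      then show ?thesis unfolding m_def by simp
    qed
  qed
  then show ?thesis by blast
qed

text \<open>Montel's theorem, applied to the Cayley transforms of the \<open>m\<close>-functions of the problems with a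
  Dirichlet condition at \<open>n + 1\<close>.\<close>

lemma weyl_coefficient_exists:
  shows "\<exists>M. M holomorphic_on upper_half_plane \<and>
    (\<forall>z. Im z > 0 \<longrightarrow> weyl_solution V z (\<lambda>x. u z x + M z * v z x) (\<lambda>x. u' z x + M z * v' z x))"
proof -
  define m where "m n z = - u z (real (Suc n)) / v z (real (Suc n))" for n z
  \<comment> \<open>The Cayley transform gives the common bound 1 in the whole half-plane, while the
    bound on \<open>m n z\<close> at hand depends on \<open>z\<close>.\<close>
  define h where "h n z = (m n z - \<i>) / (m n z + \<i>)" for n z
  have Im_m: "Im (m n z) \<ge> 0" if "Im z > 0" for n z
  proof -
    have "integral {0..real (Suc n)} (\<lambda>t. (cmod (u z t + m n z * v z t))\<^sup>2) \<ge> 0"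
      by (rule integral_nonneg[OF sol_square_integrable[OF combination_sol]]) auto
    then show ?thesis
      using dirichlet_energy[OF that, of "real (Suc n)"] that unfolding m_def[symmetric] by simp
  qed
  have nz: "m n z + \<i> \<noteq> 0" if "Im z > 0" for n z
  proof -
    have "Im (m n z + \<i>) > 0" using Im_m[OF that, of n] by simp
    then show ?thesis by (metis less_irrefl zero_complex.simps(2))
  qed
  have hb: "cmod (h n z) \<le> 1" if "Im z > 0" for n z
  proof -
    have "(cmod (m n z - \<i>))\<^sup>2 \<le> (cmod (m n z + \<i>))\<^sup>2"
      using Im_m[OF that, of n] unfolding cmod_power2 by (simp add: power2_eq_square algebra_simps)
    then have "cmod (m n z - \<i>) \<le> cmod (m n z + \<i>)" by (rule power2_le_imp_le) simp
    then show ?thesis using nz[OF that, of n] by (simp add: h_def norm_divide)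
  qed
  have hh: "h n holomorphic_on upper_half_plane" for n
    unfolding h_def m_def
    by (intro holomorphic_intros fundamental_holomorphic)
       (use v_energy(2)[of _ "real (Suc n)"] nz[unfolded m_def] in auto)
  obtain g r where g: "g holomorphic_on upper_half_plane" and r: "strict_mono (r :: nat \<Rightarrow> nat)"
    and lim: "\<And>z. z \<in> upper_half_plane \<Longrightarrow> (\<lambda>n. h (r n) z) \<longlonglongrightarrow> g z"
  proof (rule Montel[of upper_half_plane "range h" h])
    show "\<exists>B. \<forall>f\<in>range h. \<forall>z\<in>K. cmod (f z) \<le> B" if "compact K" "K \<subseteq> upper_half_plane" for K
      using hb that(2) by (intro exI[of _ 1]) blast
  qed (use hh open_halfspace_Im_gt[of 0] in auto)
  define M where "M z = \<i> * (1 + g z) / (1 - g z)" for z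
  have m_h: "m n z = \<i> * (1 + h n z) / (1 - h n z)" "1 - h n z = 2 * \<i> / (m n z + \<i>)" if "Im z > 0" for n z
  proof -
    show 1: "1 - h n z = 2 * \<i> / (m n z + \<i>)" using nz[OF that, of n] by (simp add: h_def field_simps)
    have 2: "1 + h n z = 2 * m n z / (m n z + \<i>)" using nz[OF that, of n] by (simp add: h_def field_simps)
    show "m n z = \<i> * (1 + h n z) / (1 - h n z)" unfolding 1 2 using nz[OF that, of n] by simp
  qed
  \<comment> \<open>The Cayley transform takes infinity to 1. The bound on \<open>m n z\<close>
    keeps \<open>1 - h n z\<close> away from 0, so the limit \<open>M z\<close> is finite.\<close>
  have g1: "g z \<noteq> 1" if z: "Im z > 0" for z
  proof -
    obtain K where K: "\<And>R. R \<ge> 1 \<Longrightarrow> cmod (- u z R / v z R) \<le> K" using dirichlet_bounded[OF z] by metis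
    have mK: "cmod (m n z) \<le> K" for n unfolding m_def by (rule K) simp
    have K0: "K \<ge> 0" using order_trans[OF norm_ge_zero mK[of 0]] .
    have "2 / (K + 1) \<le> cmod (1 - h n z)" for n
    proof -
      have "cmod (m n z + \<i>) \<le> K + 1" using norm_triangle_ineq[of "m n z" \<i>] mK[of n] by simp
      moreover have "cmod (m n z + \<i>) > 0" using nz[OF z, of n] by simp
      ultimately show ?thesis unfolding m_h(2)[OF z] norm_divide by (simp add: norm_mult frac_le)
    qed
    moreover have "(\<lambda>n. cmod (1 - h (r n) z)) \<longlonglongrightarrow> cmod (1 - g z)" using z by (intro tendsto_intros lim) simp
    ultimately have "2 / (K + 1) \<le> cmod (1 - g z)" by (intro LIMSEQ_le_const) auto
    moreover have "2 / (K + 1) > 0" using K0 by simp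
    ultimately show ?thesis by auto
  qed
  have Mlim: "(\<lambda>n. m (r n) z) \<longlonglongrightarrow> M z" if z: "Im z > 0" for z
    unfolding m_h(1)[OF z] M_def using g1[OF z] z by (intro tendsto_intros lim) auto
  show ?thesis
  proof (intro exI[of _ M] conjI allI impI)
    show "M holomorphic_on upper_half_plane"
      unfolding M_def using g1 by (intro holomorphic_intros g) auto
    fix z :: complex assume z: "Im z > 0"
    obtain K where K: "\<And>R. R \<ge> 1 \<Longrightarrow> cmod (- u z R / v z R) \<le> K" using dirichlet_bounded[OF z] by metis
    have mK: "cmod (m n z) \<le> K" for n unfolding m_def by (rule K) simp
    have "integral {0..b} (\<lambda>t. (cmod (u z t + M z * v z t))\<^sup>2) \<le> K / Im z" for b
    proof -
      let ?g = "\<lambda>t. (cmod (u z t) + K * cmod (v z t))\<^sup>2"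
      have cu: "continuous_on {0..b} (u z)" "continuous_on {0..b} (v z)"
        by (rule sol_continuous(1)[OF fundamental(5)], rule sol_continuous(1)[OF fundamental(6)])
      have gi: "?g integrable_on {0..b}"
        by (intro integrable_continuous_real continuous_intros cu)
      have b1: "norm ((cmod (u z t + m (r n) z * v z t))\<^sup>2) \<le> ?g t" for t n
      proof -
        have "cmod (u z t + m (r n) z * v z t) \<le> cmod (u z t) + cmod (m (r n) z) * cmod (v z t)"
          using norm_triangle_ineq[of "u z t" "m (r n) z * v z t"] by (simp add: norm_mult)
        also have "\<dots> \<le> cmod (u z t) + K * cmod (v z t)" by (intro add_left_mono mult_right_mono mK) simp
        finally show ?thesis by (simp add: power_mono)
      qed
      have l1: "(\<lambda>n. (cmod (u z t + m (r n) z * v z t))\<^sup>2) \<longlonglongrightarrow> (cmod (u z t + M z * v z t))\<^sup>2" for t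
        by (intro tendsto_intros Mlim z)
      have L: "(\<lambda>n. integral {0..b} (\<lambda>t. (cmod (u z t + m (r n) z * v z t))\<^sup>2)) \<longlonglongrightarrow> integral {0..b} (\<lambda>t. (cmod (u z t + M z * v z t))\<^sup>2)"
        by (rule dominated_convergence(2)[OF sol_square_integrable[OF combination_sol order_refl] gi b1 l1])
      \<comment> \<open>For large \<open>n\<close> the interval [0, b] lies within the Dirichlet
        interval, over which the integral is \<open>Im (m (r n) z) / Im z\<close>. The resulting
        bound \<open>K / Im z\<close> is free of \<open>b\<close>, which makes the limit square
        integrable.\<close>
      have ev: "integral {0..b} (\<lambda>t. (cmod (u z t + m (r n) z * v z t))\<^sup>2) \<le> K / Im z" if n: "real n \<ge> b" for n
      proof -
        have "b \<le> real (Suc (r n))" using n seq_suble[OF r, of n] by simp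
        then have "integral {0..b} (\<lambda>t. (cmod (u z t + m (r n) z * v z t))\<^sup>2) \<le> integral {0..real (Suc (r n))} (\<lambda>t. (cmod (u z t + m (r n) z * v z t))\<^sup>2)"
          by (intro integral_subset_le sol_square_integrable[OF combination_sol]) auto
        also have "\<dots> = Im (m (r n) z) / Im z"
          using dirichlet_energy[OF z, of "real (Suc (r n))"] z unfolding m_def[symmetric] by simp
        also have "\<dots> \<le> K / Im z"
          using z by (intro divide_right_mono order_trans[OF order_trans[OF abs_ge_self abs_Im_le_cmod] mK]) auto
        finally show ?thesis .
      qed
      obtain n0 where "b \<le> real n0" using real_arch_simple by blast
      then show ?thesis by (intro LIMSEQ_le_const2[OF L] exI[of _ n0]) (auto intro!: ev)
    qed
    then have "bounded_solution V z (\<lambda>x. u z x + M z * v z x) (\<lambda>x. u' z x + M z * v' z x)"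
      unfolding bounded_solution_def using combination_sol by blast
    then show "weyl_solution V z (\<lambda>x. u z x + M z * v z x) (\<lambda>x. u' z x + M z * v' z x)"
      by (rule bounded_solution_weyl[where x=0]) (auto simp: fundamental)
  qed
qed

text \<open>One holomorphic coefficient \<open>M\<close> at 0 serves every \<open>N\<close>: the
  quotient at \<open>N\<close> is a fractional linear function of it with entire coefficients, and
  its imaginary part has the sign of the current.\<close>

lemma m_function_herglotz:
  assumes V: "L2_sparse V" and N: "N \<ge> 0"
  shows "herglotz (m_function V N)"
proof -
  obtain M where M: "M holomorphic_on upper_half_plane"
    "\<And>z. Im z > 0 \<Longrightarrow> weyl_solution V z (\<lambda>x. u z x + M z * v z x) (\<lambda>x. u' z x + M z * v' z x)"
    using weyl_coefficient_exists by blast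
  have eq: "m_function V N z = (u' z N + M z * v' z N) / (u z N + M z * v z N)"
    and nz: "u z N + M z * v z N \<noteq> 0"
    and e: "energy (\<lambda>x. u z x + M z * v z x) (\<lambda>x. u' z x + M z * v' z x) N > 0" if "Im z > 0" for z
    using m_function_eq[OF V that N M(2)[OF that]] weyl_quotient_unique[OF V that N M(2)[OF that] M(2)[OF that]] by auto
  have "(\<lambda>z. (u' z N + M z * v' z N) / (u z N + M z * v z N)) holomorphic_on upper_half_plane"
    using nz by (intro holomorphic_intros fundamental_holomorphic N M(1)) auto
  then have "m_function V N holomorphic_on upper_half_plane"
    by (rule holomorphic_transform) (simp add: eq)
  moreover have "Im (m_function V N z) > 0" if "Im z > 0" for z
    using e[OF that] nz[OF that] unfolding eq[OF that] energy_def
    by (simp add: Im_complex_div_gt_0)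
  ultimately show ?thesis unfolding herglotz_def by blast
qed

lemma dirichlet_herglotz:
  assumes b: "b > 0"
  shows "herglotz (\<lambda>z. - v' z b / v z b)"
  unfolding herglotz_def
proof (intro conjI allI impI)
  show "(\<lambda>z. - v' z b / v z b) holomorphic_on upper_half_plane"
    by (intro holomorphic_intros fundamental_holomorphic) (use b v_energy(2)[OF _ b] in auto)
  show "Im (- v' z b / v z b) > 0" if "Im z > 0" for z
    using v_energy[OF that b] by (simp add: energy_def Im_complex_div_lt_0)
qed

end

section \<open>Sparse potentials\<close>

lemma ac_primitive_reflect:
  assumes P: "ac_primitive a b P p"
  shows "ac_primitive 0 (b - a) (\<lambda>x. P (b - x)) (\<lambda>x. - p (b - x))"
proof -
  have refl: "((\<lambda>x. f (b - x)) has_integral I) {0..x}" if "(f has_integral I) {b - x..b}" for f :: "real \<Rightarrow> 'c::real_normed_vector" and I x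
  proof -
    have "((\<lambda>y. f (y + b)) has_integral I) {b - x - b..b - b}" by (rule has_integral_shift_real_ivl[OF that])
    then have "((\<lambda>y. f (y + b)) has_integral I) {- x..0}" by simp
    then have "((\<lambda>y. f (- y + b)) has_integral I) {- 0..- (- x)}" by (subst has_integral_reflect_real)
    then show ?thesis by (simp add: add.commute)
  qed
  show ?thesis
    unfolding ac_primitive_def
  proof (intro conjI ballI)
    show "(\<lambda>x. - p (b - x)) absolutely_integrable_on {0..b - a}"
    proof (cases "a \<le> b")
      case True
      have "p absolutely_integrable_on {b - (b - a)..b}" using P by (simp add: ac_primitive_def)
      then have "(p has_integral integral {b - (b - a)..b} p) {b - (b - a)..b}"
        "((\<lambda>x. norm (p x)) has_integral integral {b - (b - a)..b} (\<lambda>x. norm (p x))) {b - (b - a)..b}"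
        by (simp_all add: absolutely_integrable_on_def integrable_integral)
      from this[THEN refl] have "(\<lambda>x. p (b - x)) absolutely_integrable_on {0..b - a}"
        unfolding absolutely_integrable_on_def by blast
      then show ?thesis by (simp add: set_integrable_def)
    qed simp
    fix x assume x: "x \<in> {0..b - a}"
    have "(p has_integral (P b - P (b - x))) {b - x..b}"
      by (rule ac_primitive_subinterval(2)[OF P]) (use x in auto)
    from has_integral_neg[OF refl[OF this]]
    show "((\<lambda>x. - p (b - x)) has_integral (P (b - x) - P (b - 0))) {0..x}" by simp
  qed
qed

text \<open>Reversal of the axis changes the sign of the first derivative and keeps the form of the
  equation. The quotient of the reflected solution at 0 is minus that of the original at
  \<open>b\<close>, which brings \<open>v\<close> within reach of the estimate at left ends.\<close>

lemma sol_reflect: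
  assumes "sol V z a b F G"
  shows "sol (\<lambda>x. V (b - x)) z 0 (b - a) (\<lambda>x. F (b - x)) (\<lambda>x. - G (b - x))"
proof -
  have "ac_primitive a b F G" "ac_primitive a b G (\<lambda>x. (of_real (V x) - z) * F x)"
    using assms by (simp_all add: sol_def)
  note r = this[THEN ac_primitive_reflect]
  show ?thesis
    unfolding sol_def using r(1) ac_primitive_cmult[OF r(2), of "- 1"] by simp
qed

lemma square_integral_reflect:
  assumes "(\<lambda>x. (V x)\<^sup>2) integrable_on {a..b}"
  shows "(\<lambda>x. (V (b - x))\<^sup>2) integrable_on {0..b - a}"
    "square_integral (\<lambda>x. V (b - x)) 0 (b - a) = square_integral V a b"
proof -
  have "((\<lambda>x. (V x)\<^sup>2) has_integral square_integral V a b) {a..b}"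
    using assms by (simp add: square_integral_def integrable_integral)
  then have "((\<lambda>y. (V (y + b))\<^sup>2) has_integral square_integral V a b) {a - b..b - b}" by (rule has_integral_shift_real_ivl)
  then have "((\<lambda>y. (V (y + b))\<^sup>2) has_integral square_integral V a b) {a - b..0}" by simp
  then have "((\<lambda>y. (V (- y + b))\<^sup>2) has_integral square_integral V a b) {- 0..- (a - b)}"
    by (subst has_integral_reflect_real)
  then have "((\<lambda>x. (V (b - x))\<^sup>2) has_integral square_integral V a b) {0..b - a}" by simp
  then show "(\<lambda>x. (V (b - x))\<^sup>2) integrable_on {0..b - a}"
    "square_integral (\<lambda>x. V (b - x)) 0 (b - a) = square_integral V a b"
    by (auto simp: square_integral_def has_integral_iff)
qed

text \<open>The estimate is used twice: first to bound \<open>m k\<close>, then with a small \<open>s\<close>.\<close>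

theorem m_value_tendsto:
  fixes F G :: "nat \<Rightarrow> real \<Rightarrow> complex" and W :: "nat \<Rightarrow> real \<Rightarrow> real" and c d :: "nat \<Rightarrow> real"
  assumes z: "Im z > 0" and S: "\<And>k. sol (W k) z (c k) (d k) (F k) (G k)" and cd: "\<And>k. c k < d k"
    and en: "\<And>k. energy (F k) (G k) (d k) \<ge> 0" and F: "\<And>k. F k (c k) \<noteq> 0"
    and L: "filterlim (\<lambda>k. d k - c k) at_top sequentially"
    and W: "\<forall>\<^sub>F k in sequentially. (\<lambda>x. (W k x)\<^sup>2) integrable_on {c k..d k}"
    and W0: "(\<lambda>k. square_integral (W k) (c k) (d k)) \<longlonglongrightarrow> 0"
  shows "(\<lambda>k. G k (c k) / F k (c k)) \<longlonglongrightarrow> \<i> * csqrt z"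
proof -
  define m where "m k = G k (c k) / F k (c k)" for k
  define \<kappa> where "\<kappa> = \<i> * csqrt z"
  define r where "r = cmod (csqrt z)"
  define L' where "L' k = d k - c k" for k
  define t where "t k = 2 / L' k" for k
  define e where "e k = 2 * square_integral (W k) (c k) (d k) + 2 * (2 / (L' k)\<^sup>2 + 4 * r / L' k)\<^sup>2 * L' k" for k
  have "((\<lambda>x::real. 2 / x) \<longlongrightarrow> 0) at_top" by real_asymp
  then have t0: "t \<longlonglongrightarrow> 0" unfolding t_def L'_def by (rule filterlim_compose[OF _ L])
  have "((\<lambda>x::real. 2 * (2 / x\<^sup>2 + 4 * r / x)\<^sup>2 * x) \<longlongrightarrow> 0) at_top"
  proof (rule Lim_transform_eventually)
    have "((\<lambda>x::real. 1 / x) \<longlongrightarrow> 0) at_top" by real_asymp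
    then have "((\<lambda>x. 2 * (1 / x) * (2 * (1 / x) + 4 * r)\<^sup>2) \<longlongrightarrow> 2 * 0 * (2 * 0 + 4 * r)\<^sup>2) at_top"
      by (intro tendsto_intros)
    then show "((\<lambda>x. 2 * (1 / x) * (2 * (1 / x) + 4 * r)\<^sup>2) \<longlongrightarrow> 0) at_top" by simp
    show "\<forall>\<^sub>F x in at_top. 2 * (1 / x) * (2 * (1 / x) + 4 * r)\<^sup>2 = 2 * (2 / x\<^sup>2 + 4 * r / x)\<^sup>2 * x"
      using eventually_gt_at_top[of 0]
    proof eventually_elim
      case (elim x)
      then have "2 / x\<^sup>2 + 4 * r / x = (1 / x) * (2 * (1 / x) + 4 * r)"
        by (simp add: field_simps power2_eq_square)
      then show ?case using elim by (simp only: power_mult_distrib) (simp add: power2_eq_square)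
    qed
  qed
  then have "(\<lambda>k. 2 * (2 / (L' k)\<^sup>2 + 4 * r / L' k)\<^sup>2 * L' k) \<longlonglongrightarrow> 0" unfolding L'_def by (rule filterlim_compose[OF _ L])
  from tendsto_add[OF tendsto_mult[OF tendsto_const[of 2] W0] this] have e0: "e \<longlonglongrightarrow> 0" by (simp add: e_def[abs_def])
  have est: "cmod (m k - \<kappa>) \<le> t k + (s * cmod (m k) / Im z + e k / s) / 2"
    if "(\<lambda>x. (W k x)\<^sup>2) integrable_on {c k..d k}" "s > 0" for k s
    unfolding m_def \<kappa>_def t_def e_def L'_def r_def by (rule m_value_estimate[OF S cd z en F that])
  \<comment> \<open>At \<open>s = Im z\<close> the estimate contains \<open>cmod (m k) / 2\<close>,
    which is absorbed on the left; what remains is \<open>cmod \<kappa> + 1\<close>,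
    doubled.\<close>
  define C where "C = 2 * (cmod \<kappa> + 1)"
  have C: "C > 0" by (simp add: C_def add_nonneg_pos)
  have "(\<lambda>k. t k + e k / (2 * Im z)) \<longlonglongrightarrow> 0 + 0 / (2 * Im z)" by (intro tendsto_intros t0 e0) (use z in simp)
  then have "\<forall>\<^sub>F k in sequentially. t k + e k / (2 * Im z) < 1" by (rule order_tendstoD) simp
  with W have bnd: "\<forall>\<^sub>F k in sequentially. cmod (m k) \<le> C"
  proof eventually_elim
    case (elim k)
    have "cmod (m k - \<kappa>) \<le> t k + (Im z * cmod (m k) / Im z + e k / Im z) / 2" by (rule est[OF elim(1) z])
    also have "\<dots> = cmod (m k) / 2 + (t k + e k / (2 * Im z))" using z by (simp add: field_simps)
    finally have "cmod (m k - \<kappa>) \<le> cmod (m k) / 2 + 1" using elim(2) by simp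
    moreover have "cmod (m k) \<le> cmod (m k - \<kappa>) + cmod \<kappa>" using norm_triangle_ineq[of "m k - \<kappa>" \<kappa>] by simp
    ultimately show ?case by (simp add: C_def)
  qed
  have "m \<longlonglongrightarrow> \<kappa>"
  proof (rule tendstoI)
    fix \<epsilon> :: real assume \<epsilon>: "\<epsilon> > 0"
    \<comment> \<open>This makes \<open>s * C / Im z\<close> equal to \<open>\<epsilon>\<close>,
      which enters the estimate halved.\<close>
    define s where "s = \<epsilon> * Im z / C"
    have s: "s > 0" using \<epsilon> z C by (simp add: s_def)
    have "(\<lambda>k. t k + e k / (2 * s)) \<longlonglongrightarrow> 0 + 0 / (2 * s)" by (intro tendsto_intros t0 e0) (use s in simp)
    then have "\<forall>\<^sub>F k in sequentially. t k + e k / (2 * s) < \<epsilon> / 2" by (rule order_tendstoD) (use \<epsilon> in simp)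
    with W bnd show "\<forall>\<^sub>F k in sequentially. dist (m k) \<kappa> < \<epsilon>"
    proof eventually_elim
      case (elim k)
      have "s * cmod (m k) / Im z \<le> s * C / Im z" using elim(2) s z by (intro divide_right_mono mult_left_mono) auto
      also have "\<dots> = \<epsilon>" using z C by (simp add: s_def)
      finally have h: "s * cmod (m k) / Im z \<le> \<epsilon>" .
      have "cmod (m k - \<kappa>) \<le> t k + (s * cmod (m k) / Im z + e k / s) / 2" by (rule est[OF elim(1) s])
      also have "\<dots> = s * cmod (m k) / Im z / 2 + (t k + e k / (2 * s))" by (simp add: field_simps)
      also have "\<dots> < \<epsilon> / 2 + \<epsilon> / 2" by (rule add_le_less_mono[OF _ elim(3)]) (use h in simp)
      finally show ?case by (simp add: dist_norm)
    qed
  qed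
  then show ?thesis by (simp add: m_def[abs_def] \<kappa>_def)
qed

text \<open>For a Herglotz function the replacement by 0 changes a null set only; the results on
  value distribution ask for a nonnegative imaginary part at every point.\<close>

definition nonneg_boundary_value :: "(complex \<Rightarrow> complex) \<Rightarrow> real \<Rightarrow> complex" where
  "nonneg_boundary_value F x = (if Im (boundary_value F x) \<ge> 0 then boundary_value F x else 0)"

lemma nonneg_boundary_value:
  assumes F: "herglotz F"
  shows "nonneg_boundary_value F \<in> borel_measurable borel" "Im (nonneg_boundary_value F x) \<ge> 0"
    "AE x in lborel. ((\<lambda>y. F (Complex x y)) \<longlongrightarrow> nonneg_boundary_value F x) (at_right 0)"
proof -
  have [measurable]: "boundary_value F \<in> borel_measurable borel"
    using F by (intro boundary_value_measurable holomorphic_on_imp_continuous_on) (simp add: herglotz_def)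
  show "nonneg_boundary_value F \<in> borel_measurable borel" unfolding nonneg_boundary_value_def by measurable
  show "Im (nonneg_boundary_value F x) \<ge> 0" by (simp add: nonneg_boundary_value_def)
  show "AE x in lborel. ((\<lambda>y. F (Complex x y)) \<longlongrightarrow> nonneg_boundary_value F x) (at_right 0)"
    using herglotz_boundary_value[OF F]
  proof eventually_elim
    case (elim x)
    have "0 \<le> Im (boundary_value F x)"
    proof (rule tendsto_lowerbound[OF tendsto_Im[OF elim]])
      show "\<forall>\<^sub>F y in at_right 0. 0 \<le> Im (F (Complex x y))"
        using eventually_at_right_less[of "0::real"]
        by eventually_elim (use F in \<open>simp add: herglotz_def less_imp_le\<close>)
    qed simp
    then show ?case using elim by (simp add: nonneg_boundary_value_def)
  qed
qed

text \<open>\<open>H\<close> is tied to the Borel function \<open>G\<close> only almost everywhere,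
  as \<open>m_plus\<close> is to its Borel version; measurability of the integrand comes from
  completeness of Lebesgue measure.\<close>

lemma angle_integral_eq:
  assumes A[measurable]: "A \<in> sets borel" and S[measurable]: "S \<in> sets borel"
    and G[measurable]: "G \<in> borel_measurable borel" and G_Im: "\<And>x. Im (G x) \<ge> 0"
    and H: "AE x in lborel. H x = G x"
  shows "1 / pi * (LINT l:A|lebesgue. angle_subtended (H l) S) = (\<integral>x. indicator A x * harmonic_measure (G x) S \<partial>lborel)"
proof -
  let ?g = "\<lambda>x. indicat_real A x * (pi * harmonic_measure (G x) S)"
  have gm: "?g \<in> borel_measurable lborel" using harmonic_measure_measurable[OF S, of G borel] by simp
  have gm': "?g \<in> borel_measurable lebesgue" by (rule measurable_completion[OF gm])
  have "AE x in lebesgue. H x = G x" using H by (rule AE_completion)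
  then have ae: "AE x in lebesgue. ?g x = indicat_real A x *\<^sub>R angle_subtended (H x) S"
    by eventually_elim (simp add: angle_subtended_eq_harmonic_measure[OF S G_Im])
  have hm: "(\<lambda>x. indicat_real A x *\<^sub>R angle_subtended (H x) S) \<in> borel_measurable lebesgue"
    by (rule borel_measurable_AE[OF gm' ae])
  have "(LINT l:A|lebesgue. angle_subtended (H l) S) = (\<integral>x. ?g x \<partial>lebesgue)"
    unfolding set_lebesgue_integral_def
    by (rule integral_cong_AE[OF hm gm']) (use ae in \<open>auto elim: eventually_mono\<close>)
  also have "\<dots> = (\<integral>x. ?g x \<partial>lborel)" by (rule integral_completion[OF gm])
  also have "\<dots> = (\<integral>x. pi * (indicat_real A x * harmonic_measure (G x) S) \<partial>lborel)"
    by (rule Bochner_Integration.integral_cong) auto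
  also have "\<dots> = pi * (\<integral>x. indicat_real A x * harmonic_measure (G x) S \<partial>lborel)" by (rule integral_mult_right_zero)
  finally show ?thesis by simp
qed

lemma harmonic_measure_of_real:
  assumes [measurable]: "S \<in> sets borel"
  shows "harmonic_measure (of_real r) S = indicator S r"
  using cauchy_law.prob_space by (simp add: harmonic_measure_eq_integral)

theorem theorem2:
  fixes V :: "real \<Rightarrow> real"
    and v v' :: "real \<Rightarrow> real \<Rightarrow> real"
    and a b :: "nat \<Rightarrow> real"
    and A S :: "real set"
  assumes "L2_sparse V"
    and "\<And>l::real. schroedinger_solution V l (\<lambda>x. v x l) (\<lambda>x. v' x l)"
    and "\<And>l. v 0 l = 0"
    and "\<And>l. v' 0 l = 1"
    and "\<And>k. 0 \<le> a k \<and> a k < b k"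
    and "filterlim (\<lambda>k. b k - a k) at_top sequentially"
    and "(\<lambda>k. \<integral>\<^sup>+t\<in>{a k<..<b k}. ennreal (\<bar>V t\<bar>\<^sup>2) \<partial>lebesgue) \<longlonglongrightarrow> 0"
    and "A \<in> sets borel" and "S \<in> sets borel"
    and "emeasure lebesgue A < \<infinity>"
  shows "((\<lambda>k. 1 / pi * (LINT l:A|lebesgue. angle_subtended (m_plus V (a k) l) S))
           \<longlonglongrightarrow> 1 / pi * (LINT l:A|lebesgue. angle_subtended (i_sqrt l) S))
         \<and> ((\<lambda>k. measure lebesgue {l\<in>A. v (b k) l \<noteq> 0 \<and> v' (b k) l / v (b k) l \<in> S})
           \<longlonglongrightarrow> 1 / pi * (LINT l:A|lebesgue. angle_subtended (i_sqrt l) (uminus ` S)))"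
proof -
  have li: "locally_integrable V" using assms(1) by (simp add: L2_sparse_def)
  have ab: "0 \<le> a k" "a k < b k" "0 < b k" for k using assms(5)[of k] by auto
  have A_fin: "emeasure lborel A < \<infinity>" using assms(8,10) by simp
  have small: "(\<lambda>k. \<integral>\<^sup>+t\<in>{a k<..<b k}. ennreal ((V t)\<^sup>2) \<partial>lebesgue) \<longlonglongrightarrow> 0"
    using assms(7) by simp
  \<comment> \<open>The integrals may be infinite for finitely many \<open>k\<close>, where
    \<open>V\<close> is not square integrable on the interval; facts about
    \<open>square_integral\<close> are therefore obtained eventually.\<close>
  have fin: "\<forall>\<^sub>F k in sequentially. (\<integral>\<^sup>+t\<in>{a k<..<b k}. ennreal ((V t)\<^sup>2) \<partial>lebesgue) < \<infinity>"
    by (rule order_tendstoD(2)[OF small]) simp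
  then have V2: "\<forall>\<^sub>F k in sequentially. (\<lambda>x. (V x)\<^sup>2) integrable_on {a k..b k}"
    by (rule eventually_mono) (rule square_integral_eq_nn_integral(1)[OF li ab(1)])
  have sq0: "(\<lambda>k. square_integral V (a k) (b k)) \<longlonglongrightarrow> 0"
  proof -
    from fin have "\<forall>\<^sub>F k in sequentially. (\<integral>\<^sup>+t\<in>{a k<..<b k}. ennreal ((V t)\<^sup>2) \<partial>lebesgue) = ennreal (square_integral V (a k) (b k))"
      by (rule eventually_mono) (rule square_integral_eq_nn_integral(2)[OF li ab(1), symmetric])
    from Lim_transform_eventually[OF small this]
    have "(\<lambda>k. ennreal (square_integral V (a k) (b k))) \<longlonglongrightarrow> ennreal 0" by simp
    moreover have "\<forall>\<^sub>F k in sequentially. 0 \<le> square_integral V (a k) (b k)"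
      using V2 by eventually_elim (simp add: square_integral_def integral_nonneg)
    ultimately show ?thesis by (subst (asm) tendsto_ennreal_iff) simp_all
  qed
  let ?F0 = "\<lambda>z. \<i> * csqrt z"
  have lim0: "AE x in lborel. ((\<lambda>y. ?F0 (Complex x y)) \<longlongrightarrow> i_sqrt x) (at_right 0)"
    by (rule AE_I2) (rule i_sqrt_boundary_value)
  have S': "uminus ` S \<in> sets borel"
  proof -
    have "uminus ` S = uminus -` S" by (force simp: image_iff)
    then show ?thesis using measurable_sets[of uminus borel borel S] assms(9) by simp
  qed

  \<comment> \<open>Value distribution of the m-functions\<close>
  define F where "F k = m_function V (a k)" for k
  have F: "herglotz (F k)" for k unfolding F_def by (rule m_function_herglotz[OF li assms(1) ab(1)])
  have F_lim: "(\<lambda>k. F k z) \<longlonglongrightarrow> ?F0 z" if z: "Im z > 0" for z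
  proof -
    obtain M where "\<forall>z. Im z > 0 \<longrightarrow> weyl_solution V z
        (\<lambda>x. fst (cauchy_solution V z 1 0) x + M z * fst (cauchy_solution V z 0 1) x)
        (\<lambda>x. snd (cauchy_solution V z 1 0) x + M z * snd (cauchy_solution V z 0 1) x)"
      using weyl_coefficient_exists[OF li] by blast
    with z obtain f g where W: "weyl_solution V z f g" by blast
    note w = weyl_quotient_unique[OF assms(1) z _ W W]
    have S: "sol V z (a k) (b k) f g" for k
      using weyl_solution_bounded[OF li W] by (auto simp: bounded_solution_def intro: sol_restrict[OF _ ab(1) order_refl])
    have "(\<lambda>k. g (a k) / f (a k)) \<longlonglongrightarrow> ?F0 z"
    proof (rule m_value_tendsto[OF z S ab(2) _ _ assms(6) V2 sq0])
      show "energy f g (b k) \<ge> 0" for k using w(3)[of "b k"] ab(3)[of k] by simp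
      show "f (a k) \<noteq> 0" for k by (rule w(2)[OF ab(1)])
    qed
    then show ?thesis unfolding F_def m_function_eq[OF assms(1) z ab(1) W] .
  qed
  have first: "(\<lambda>k. 1 / pi * (LINT l:A|lebesgue. angle_subtended (m_plus V (a k) l) S))
      \<longlonglongrightarrow> 1 / pi * (LINT l:A|lebesgue. angle_subtended (i_sqrt l) S)"
  proof -
    note G = nonneg_boundary_value[OF F]
    have "AE l in lborel. m_plus V (a k) l = nonneg_boundary_value (F k) l" for k
      using G(3)[of k]
    proof eventually_elim
      case (elim l)
      show ?case unfolding m_plus_def using elim unfolding F_def by (intro tendsto_Lim) simp_all
    qed
    note e = angle_integral_eq[OF assms(8,9) G(1) G(2) this]
    have e0: "1 / pi * (LINT l:A|lebesgue. angle_subtended (i_sqrt l) S) = (\<integral>x. indicator A x * harmonic_measure (i_sqrt x) S \<partial>lborel)"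
      by (rule angle_integral_eq[OF assms(8,9) i_sqrt_measurable i_sqrt_Im]) simp
    show ?thesis
      unfolding e e0
      by (rule value_distribution_tendsto[OF F i_csqrt_herglotz F_lim G(1) i_sqrt_measurable G(2) i_sqrt_Im G(3) lim0 assms(8) A_fin assms(9)])
  qed

  \<comment> \<open>Value distribution of the Dirichlet solution at the right ends\<close>
  let ?v = "\<lambda>z. fst (cauchy_solution V z 0 1)" and ?v' = "\<lambda>z. snd (cauchy_solution V z 0 1)"
  have vz: "sol V z 0 c (?v z) (?v' z)" "?v z 0 = 0" "?v' z 0 = 1" for z c
    by (simp_all add: cauchy_solution[OF li])
  have v_real: "?v (of_real l) x = of_real (v x l)" "?v' (of_real l) x = of_real (v' x l)" if "x \<ge> 0" for l x
  proof -
    have "sol V (of_real l) 0 c (\<lambda>x. of_real (v x l)) (\<lambda>x. of_real (v' x l))" for c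
      by (rule sol_if_schroedinger_solution[OF li schroedinger_solution_of_real[OF assms(2)]])
    from cauchy_solution_unique[OF li this that]
    show "?v (of_real l) x = of_real (v x l)" "?v' (of_real l) x = of_real (v' x l)"
      by (simp_all add: assms(3,4))
  qed
  define P where "P k z = - ?v' z (b k) / ?v z (b k)" for k z
  have P: "herglotz (P k)" for k unfolding P_def by (rule dirichlet_herglotz[OF li ab(3)])
  have P_lim: "(\<lambda>k. P k z) \<longlonglongrightarrow> ?F0 z" if z: "Im z > 0" for z
  proof -
    have S: "sol (\<lambda>x. V (b k - x)) z 0 (b k - a k) (\<lambda>x. ?v z (b k - x)) (\<lambda>x. - ?v' z (b k - x))" for k
      by (rule sol_reflect, rule sol_restrict[OF vz(1) ab(1) order_refl])
    have "(\<lambda>k. - ?v' z (b k - 0) / ?v z (b k - 0)) \<longlonglongrightarrow> ?F0 z"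
    proof (rule m_value_tendsto[OF z S])
      show "0 < b k - a k" for k using ab(2)[of k] by simp
      \<comment> \<open>Reflection reverses the current, so the condition at the far end is that the
        current of \<open>v\<close> at \<open>a k\<close> is at most 0; for \<open>a k = 0\<close>
        it vanishes with \<open>v\<close>.\<close>
      show "0 \<le> energy (\<lambda>x. ?v z (b k - x)) (\<lambda>x. - ?v' z (b k - x)) (b k - a k)" for k
      proof (cases "a k = 0")
        case True
        then show ?thesis by (simp add: energy_def vz(2))
      next
        case False
        then have "energy (?v z) (?v' z) (a k) < 0" using ab(1)[of k] by (intro v_energy(1)[OF li z]) simp
        then show ?thesis by (simp add: energy_def)
      qed
      show "?v z (b k - 0) \<noteq> 0" for k using v_energy(2)[OF li z ab(3)] by simp
      show "filterlim (\<lambda>k. b k - a k - 0) at_top sequentially" using assms(6) by simp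
      show "\<forall>\<^sub>F k in sequentially. (\<lambda>x. (V (b k - x))\<^sup>2) integrable_on {0..b k - a k}"
        using V2 by (rule eventually_mono) (rule square_integral_reflect(1))
      have "\<forall>\<^sub>F k in sequentially. square_integral V (a k) (b k) = square_integral (\<lambda>x. V (b k - x)) 0 (b k - a k)"
        using V2 by (rule eventually_mono) (rule square_integral_reflect(2)[symmetric])
      then show "(\<lambda>k. square_integral (\<lambda>x. V (b k - x)) 0 (b k - a k)) \<longlonglongrightarrow> 0"
        by (rule Lim_transform_eventually[OF sq0])
    qed
    then show ?thesis by (simp add: P_def)
  qed
  define q where "q k l = - (v' (b k) l / v (b k) l)" for k l
  have cont: "continuous_on UNIV (\<lambda>z. ?v z (b k))" "continuous_on UNIV (\<lambda>z. ?v' z (b k))" for k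
    using cauchy_solution_holomorphic[OF li less_imp_le[OF ab(3)]] by (auto intro: holomorphic_on_imp_continuous_on)
  have vm: "(\<lambda>l. v (b k) l) \<in> borel_measurable borel" "(\<lambda>l. v' (b k) l) \<in> borel_measurable borel" for k
  proof -
    have "(\<lambda>l. Re (?v (of_real l) (b k))) \<in> borel_measurable borel" "(\<lambda>l. Re (?v' (of_real l) (b k))) \<in> borel_measurable borel"
      by (auto intro!: borel_measurable_continuous_onI continuous_intros continuous_on_compose2[OF cont(1)] continuous_on_compose2[OF cont(2)])
    then show "(\<lambda>l. v (b k) l) \<in> borel_measurable borel" "(\<lambda>l. v' (b k) l) \<in> borel_measurable borel"
      using ab(3)[of k] by (simp_all add: v_real)
  qed
  have qm: "q k \<in> borel_measurable borel" for k unfolding q_def using vm[of k] by measurable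
  \<comment> \<open>\<open>v (b k)\<close> extends to an entire function of the spectral parameter
    that is nonzero at \<open>\<i>\<close>, so its zeros are countable. Off them \<open>P k\<close>
    extends continuously to the axis.\<close>
  have zeros: "AE l in lborel. v (b k) l \<noteq> 0" for k
  proof -
    let ?Z = "{z \<in> UNIV. ?v z (b k) = 0}"
    have "countable ?Z"
    proof (cases "(\<lambda>z. ?v z (b k)) constant_on UNIV")
      case True
      then obtain c where c: "?v z (b k) = c" for z by (auto simp: constant_on_def)
      have "?v \<i> (b k) \<noteq> 0" by (rule v_energy(2)[OF li _ ab(3)]) simp
      then show ?thesis by (simp add: c)
    next
      case False
      then show ?thesis
        by (intro holomorphic_countable_zeros cauchy_solution_holomorphic[OF li less_imp_le[OF ab(3)]]) auto
    qed
    moreover have "complex_of_real ` {l. v (b k) l = 0} \<subseteq> ?Z"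
      using v_real(1)[OF less_imp_le[OF ab(3)]] by auto
    ultimately have "countable (complex_of_real ` {l. v (b k) l = 0})" by (rule countable_subset[rotated])
    then have "countable {l. v (b k) l = 0}" by (rule countable_image_inj_on) (simp add: inj_on_def)
    then have "{l. v (b k) l = 0} \<in> null_sets lborel" by (rule countable_imp_null_set_lborel)
    from AE_not_in[OF this] show ?thesis by simp
  qed
  have P_bdry: "AE l in lborel. ((\<lambda>y. P k (Complex l y)) \<longlongrightarrow> complex_of_real (q k l)) (at_right 0)" for k
    using zeros[of k]
  proof eventually_elim
    case (elim l)
    have c: "((\<lambda>y. Complex l y) \<longlongrightarrow> of_real l) (at_right 0)"
      using tendsto_Complex[OF tendsto_const tendsto_ident_at, of l "0::real" "{0<..}"] by (simp add: complex_of_real_def)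
    have i: "isCont (\<lambda>z. ?v z (b k)) (of_real l)" "isCont (\<lambda>z. ?v' z (b k)) (of_real l)"
      using cont[of k] by (auto simp: continuous_on_eq_continuous_at)
    have nz: "?v (of_real l) (b k) \<noteq> 0" using elim v_real(1)[OF less_imp_le[OF ab(3)]] by simp
    have "((\<lambda>y. P k (Complex l y)) \<longlongrightarrow> P k (of_real l)) (at_right 0)"
      unfolding P_def by (intro tendsto_intros isCont_tendsto_compose[OF i(1) c] isCont_tendsto_compose[OF i(2) c] nz)
    moreover have "P k (of_real l) = of_real (q k l)"
      using v_real[OF less_imp_le[OF ab(3)]] by (simp add: P_def q_def)
    ultimately show ?case by simp
  qed
  have second: "(\<lambda>k. measure lebesgue {l\<in>A. v (b k) l \<noteq> 0 \<and> v' (b k) l / v (b k) l \<in> S})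
      \<longlonglongrightarrow> 1 / pi * (LINT l:A|lebesgue. angle_subtended (i_sqrt l) (uminus ` S))"
  proof -
    have e0: "1 / pi * (LINT l:A|lebesgue. angle_subtended (i_sqrt l) (uminus ` S)) = (\<integral>x. indicator A x * harmonic_measure (i_sqrt x) (uminus ` S) \<partial>lborel)"
      by (rule angle_integral_eq[OF assms(8) S' i_sqrt_measurable i_sqrt_Im]) simp
    have e: "measure lebesgue {l\<in>A. v (b k) l \<noteq> 0 \<and> v' (b k) l / v (b k) l \<in> S}
      = (\<integral>x. indicator A x * harmonic_measure (of_real (q k x)) (uminus ` S) \<partial>lborel)" for k
    proof -
      let ?E = "{l\<in>A. v (b k) l \<noteq> 0 \<and> v' (b k) l / v (b k) l \<in> S}"
      have E: "?E \<in> sets borel"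
      proof -
        note [measurable] = vm[of k] assms(8,9)
        have "Measurable.pred borel (\<lambda>l. l \<in> A \<and> v (b k) l \<noteq> 0 \<and> v' (b k) l / v (b k) l \<in> S)" by measurable
        then show ?thesis by (simp add: pred_def)
      qed
      have "measure lebesgue ?E = measure lborel ?E" using E by simp
      also have "\<dots> = (\<integral>x. indicat_real ?E x \<partial>lborel)" by simp
      \<comment> \<open>The points with \<open>v (b k) x = 0\<close>, where the quotient is 0 by
        convention, are excluded on the left only; they form a null set. The set \<open>-S\<close>
        appears because \<open>q k\<close> is minus the quotient.\<close>
      also have "\<dots> = (\<integral>x. indicat_real A x * indicat_real (uminus ` S) (q k x) \<partial>lborel)"
      proof (rule integral_cong_AE)
        show "AE x in lborel. indicat_real ?E x = indicat_real A x * indicat_real (uminus ` S) (q k x)"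
          using zeros[of k]
        proof eventually_elim
          case (elim x)
          have "q k x \<in> uminus ` S \<longleftrightarrow> v' (b k) x / v (b k) x \<in> S" by (auto simp: q_def)
          then show ?case using elim by (simp add: indicator_def)
        qed
        show "(\<lambda>x. indicat_real A x * indicat_real (uminus ` S) (q k x)) \<in> borel_measurable lborel"
          using qm[of k] assms(8) S' by measurable
      qed (use E in measurable)
      also have "\<dots> = (\<integral>x. indicator A x * harmonic_measure (of_real (q k x)) (uminus ` S) \<partial>lborel)"
        by (simp only: harmonic_measure_of_real[OF S'])
      finally show ?thesis .
    qed
    have Gm: "(\<lambda>x. complex_of_real (q k x)) \<in> borel_measurable borel" for k using qm[of k] by measurable
    have G_Im: "Im (complex_of_real (q k x)) \<ge> 0" for k x by simp
    show ?thesis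
      unfolding e e0
      by (rule value_distribution_tendsto[OF P i_csqrt_herglotz P_lim Gm i_sqrt_measurable G_Im i_sqrt_Im P_bdry lim0 assms(8) A_fin S'])
  qed
  show ?thesis using first second by (rule conjI)
qed

end
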